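(* Let $V:\mathbb{Z}\to\mathbb{R}$ be a bounded real-valued function, let $H$ be the operator $[Hu](n)=u(n+1)+u(n-1)+V(n)u(n)$ on $\ell^2(\mathbb{Z})$, and let $K\ge4$ be such that $\sigma(H)\subseteq[-K+1,K-1]$. Suppose that for some $C\in(0,\infty)$ and $\alpha\in(0,1)$ we have, for every $m\ge1$, as $t\to\infty$, $$\int_{-K}^K\left(\max_{1\le n\le Ct^\alpha}\left\|\Phi\left(n,E+it^{-1}\right)\right\|^2\right)^{-1}dE=O(t^{-m})$$ and $$\int_{-K}^K\left(\max_{1\le -n\le Ct^\alpha}\left\|\Phi\left(n,E+it^{-1}\right)\right\|^2\right)^{-1}dE=O(t^{-m}).$$ Then $\alpha_u^+\le\alpha$. In particular, $\beta^+_{\delta_0}(p)\le\alpha$ for every $p>0$.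
   Context: $\{\delta_n\}_{n\in\mathbb{Z}}$ is the standard basis of $\ell^2(\mathbb{Z})$. Transfer matrices: for $m\in\mathbb{Z}$, $z\in\mathbb{C}$ let $T(m,z)=\begin{pmatrix} z-V(m) & -1\\ 1 & 0\end{pmatrix}$, and let $\Phi(n,z)=T(n,z)\cdots T(1,z)$ for $n\ge1$, $\Phi(0,z)=\mathrm{Id}$, $\Phi(n,z)=[T(n+1,z)]^{-1}\cdots[T(0,z)]^{-1}$ for $n\le-1$. Outside probabilities: for real $N$, $P_r(N,t)=\sum_{n\ge N}|\langle e^{-itH}\delta_0,\delta_n\rangle|^2$, $P_l(N,t)=\sum_{n\le -N}|\langle e^{-itH}\delta_0,\delta_n\rangle|^2$ (sums over integers $n$), and $P(N,t)=P_l(N,t)+P_r(N,t)$. For $\alpha\ge0$ let $$S^+(\alpha)=-\limsup_{t\to\infty}\frac{\log P(t^\alpha-1,t)}{\log t}\in[0,\infty],\qquad \alpha_u^+=\sup\{\alpha\ge0: S^+(\alpha)<\infty\}.$$ Moments and transport exponent: for $p>0$, $\langle|X|^p_{\delta_0}\rangle(t)=\sum_{n\in\mathbb{Z}}|n|^p|\langle e^{-itH}\delta_0,\delta_n\rangle|^2$ and $$\beta^+_{\delta_0}(p)=\limsup_{t\to\infty}\frac{\log\langle|X|^p_{\delta_0}\rangle(t)}{p\log t}.$$ *)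

theory Defs
  imports "HOL-Analysis.Analysis" "HOL-Library.Landau_Symbols"
begin

section \<open>The Hilbert space of square-summable functions\<close>

typedef 'a ell2 = "{u :: 'a \<Rightarrow> complex. (\<lambda>n. (cmod (u n))\<^sup>2) summable_on UNIV}"
  morphisms ell2_apply Abs_ell2
  by (rule exI[of _ "\<lambda>_. 0"]) simp

setup_lifting type_definition_ell2

lemma ell2_summable: "(\<lambda>n. (cmod (ell2_apply u n))\<^sup>2) summable_on UNIV"
  using ell2_apply[of u] by simp

lemma ell2_eqI: "(\<And>n. ell2_apply u n = ell2_apply v n) \<Longrightarrow> u = v"
  by (metis ell2_apply_inject ext)

lemma ell2_summable_add:
  fixes u v :: "'a \<Rightarrow> complex"
  assumes "(\<lambda>n. (cmod (u n))\<^sup>2) summable_on UNIV" "(\<lambda>n. (cmod (v n))\<^sup>2) summable_on UNIV"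
  shows "(\<lambda>n. (cmod (u n + v n))\<^sup>2) summable_on UNIV"
proof (rule summable_on_comparison_test)
  show "(\<lambda>n. 2 * (cmod (u n))\<^sup>2 + 2 * (cmod (v n))\<^sup>2) summable_on UNIV"
    by (intro summable_on_add summable_on_cmult_right assms)
  fix n
  have "(cmod (u n + v n))\<^sup>2 \<le> (cmod (u n) + cmod (v n))\<^sup>2"
    by (intro power_mono norm_triangle_ineq) simp
  also have "\<dots> \<le> 2 * (cmod (u n))\<^sup>2 + 2 * (cmod (v n))\<^sup>2"
    using sum_squares_bound[of "cmod (u n)" "cmod (v n)"] by (simp add: power2_sum)
  finally show "(cmod (u n + v n))\<^sup>2 \<le> 2 * (cmod (u n))\<^sup>2 + 2 * (cmod (v n))\<^sup>2" .
qed simp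

lemma ell2_summable_mult:
  fixes u v :: "'a \<Rightarrow> complex"
  assumes "(\<lambda>n. (cmod (u n))\<^sup>2) summable_on UNIV" and "\<And>n. cmod (v n) \<le> M * cmod (u n)"
  shows "(\<lambda>n. (cmod (v n))\<^sup>2) summable_on UNIV"
proof (rule summable_on_comparison_test)
  show "(\<lambda>n. M\<^sup>2 * (cmod (u n))\<^sup>2) summable_on UNIV"
    by (intro summable_on_cmult_right assms)
  fix n
  show "(cmod (v n))\<^sup>2 \<le> M\<^sup>2 * (cmod (u n))\<^sup>2"
    using power_mono[OF assms(2)[of n], of 2] by (simp add: power_mult_distrib)
qed simp

lemma ell2_summable_cinner:
  fixes u v :: "'a \<Rightarrow> complex"
  assumes "(\<lambda>n. (cmod (u n))\<^sup>2) summable_on UNIV" "(\<lambda>n. (cmod (v n))\<^sup>2) summable_on UNIV"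
  shows "(\<lambda>n. cnj (u n) * v n) summable_on UNIV"
proof (rule Infinite_Sum.abs_summable_summable, rule Infinite_Sum.abs_summable_on_comparison_test')
  show "(\<lambda>n. (cmod (u n))\<^sup>2 + (cmod (v n))\<^sup>2) summable_on UNIV"
    by (intro summable_on_add assms)
  fix n
  show "norm (cnj (u n) * v n) \<le> (cmod (u n))\<^sup>2 + (cmod (v n))\<^sup>2"
    using sum_squares_bound[of "cmod (u n)" "cmod (v n)"]
      mult_nonneg_nonneg[OF norm_ge_zero[of "u n"] norm_ge_zero[of "v n"]]
    unfolding norm_mult complex_mod_cnj by linarith
qed

text \<open>Conjugate-linear in the first argument.\<close>

definition cinner :: "'a ell2 \<Rightarrow> 'a ell2 \<Rightarrow> complex" where
  "cinner u v = (\<Sum>\<^sub>\<infinity>n. cnj (ell2_apply u n) * ell2_apply v n)"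

instantiation ell2 :: (type) real_vector
begin

lift_definition zero_ell2 :: "'a ell2" is "\<lambda>_. 0" by simp

lift_definition plus_ell2 :: "'a ell2 \<Rightarrow> 'a ell2 \<Rightarrow> 'a ell2" is "\<lambda>u v n. u n + v n"
  by (rule ell2_summable_add)

lift_definition uminus_ell2 :: "'a ell2 \<Rightarrow> 'a ell2" is "\<lambda>u n. - u n" by simp

lift_definition minus_ell2 :: "'a ell2 \<Rightarrow> 'a ell2 \<Rightarrow> 'a ell2" is "\<lambda>u v n. u n - v n"
  subgoal for u v using ell2_summable_add[of u "\<lambda>n. - v n"] by simp
  done

lift_definition scaleR_ell2 :: "real \<Rightarrow> 'a ell2 \<Rightarrow> 'a ell2" is "\<lambda>r u n. r *\<^sub>R u n"
  subgoal for r u by (erule ell2_summable_mult[where M="\<bar>r\<bar>"]) simp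
  done

instance
  by standard (rule ell2_eqI, simp add: plus_ell2.rep_eq minus_ell2.rep_eq uminus_ell2.rep_eq
      zero_ell2.rep_eq scaleR_ell2.rep_eq scaleR_add_left scaleR_add_right)+

end

instantiation ell2 :: (type) real_inner
begin

definition inner_ell2 :: "'a ell2 \<Rightarrow> 'a ell2 \<Rightarrow> real" where
  "inner_ell2 u v = Re (cinner u v)"

definition norm_ell2 :: "'a ell2 \<Rightarrow> real" where
  "norm_ell2 u = sqrt (inner u u)"

definition sgn_ell2 :: "'a ell2 \<Rightarrow> 'a ell2" where
  "sgn_ell2 u = u /\<^sub>R norm u"

definition dist_ell2 :: "'a ell2 \<Rightarrow> 'a ell2 \<Rightarrow> real" where
  "dist_ell2 u v = norm (u - v)"

definition uniformity_ell2 :: "('a ell2 \<times> 'a ell2) filter" where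
  "uniformity_ell2 = (INF e\<in>{0 <..}. principal {(x, y). dist x y < e})"

definition open_ell2 :: "'a ell2 set \<Rightarrow> bool" where
  "open_ell2 S = (\<forall>x\<in>S. \<forall>\<^sub>F (x', y) in uniformity. x' = x \<longrightarrow> y \<in> S)"

instance
proof
  fix u v w :: "'a ell2" and r :: real
  note s = ell2_summable_cinner[OF ell2_summable ell2_summable]
  have I: "inner u v = (\<Sum>\<^sub>\<infinity>n. Re (cnj (ell2_apply u n) * ell2_apply v n))" for u v :: "'a ell2"
    unfolding inner_ell2_def cinner_def by (rule infsum_Re[symmetric, OF s])
  have S: "(\<lambda>n. Re (cnj (ell2_apply u n) * ell2_apply v n)) summable_on UNIV" for u v :: "'a ell2"
    by (rule summable_on_Re[OF s])
  have Iuu: "inner u u = (\<Sum>\<^sub>\<infinity>n. (cmod (ell2_apply u n))\<^sup>2)" for u :: "'a ell2"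
    unfolding I by (intro infsum_cong) (simp add: cmod_power2 flip: power2_eq_square)
  show "inner u v = inner v u"
    unfolding I by (intro infsum_cong) (simp add: algebra_simps)
  show "inner (u + v) w = inner u w + inner v w"
    unfolding I infsum_add[OF S S, symmetric]
    by (intro infsum_cong) (simp add: plus_ell2.rep_eq algebra_simps)
  show "inner (r *\<^sub>R u) v = r * inner u v"
    unfolding I infsum_cmult_right'[symmetric]
    by (intro infsum_cong) (simp add: scaleR_ell2.rep_eq algebra_simps)
  show "0 \<le> inner u u"
    unfolding Iuu by (intro infsum_nonneg) simp
  show "inner u u = 0 \<longleftrightarrow> u = 0"
  proof
    assume "inner u u = 0"
    then have "(cmod (ell2_apply u n))\<^sup>2 = 0" for n
      using nonneg_infsum_le_0D[OF _ ell2_summable, of u n] unfolding Iuu by simp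
    then show "u = 0"
      by (intro ell2_eqI) (simp add: zero_ell2.rep_eq)
  qed (simp add: Iuu zero_ell2.rep_eq)
qed (rule norm_ell2_def sgn_ell2_def dist_ell2_def uniformity_ell2_def open_ell2_def)+

end

lemma norm_ell2_square: "(norm u)\<^sup>2 = (\<Sum>\<^sub>\<infinity>n. (cmod (ell2_apply u n))\<^sup>2)"
proof -
  have "(norm u)\<^sup>2 = inner u u"
    by (simp add: power2_norm_eq_inner)
  also have "\<dots> = (\<Sum>\<^sub>\<infinity>n. Re (cnj (ell2_apply u n) * ell2_apply u n))"
    unfolding inner_ell2_def cinner_def
    by (rule infsum_Re[symmetric, OF ell2_summable_cinner[OF ell2_summable ell2_summable]])
  also have "\<dots> = (\<Sum>\<^sub>\<infinity>n. (cmod (ell2_apply u n))\<^sup>2)"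
    by (intro infsum_cong) (simp add: cmod_power2 flip: power2_eq_square)
  finally show ?thesis .
qed

lemma sum_le_norm_ell2: "finite F \<Longrightarrow> (\<Sum>n\<in>F. (cmod (ell2_apply u n))\<^sup>2) \<le> (norm u)\<^sup>2"
  unfolding norm_ell2_square by (intro finite_sum_le_infsum ell2_summable) auto

lemma cmod_le_norm_ell2: "cmod (ell2_apply u n) \<le> norm u"
  using sum_le_norm_ell2[of "{n}" u] by (simp add: power2_le_iff_abs_le)

instance ell2 :: (type) banach
proof
  fix X :: "nat \<Rightarrow> 'a ell2"
  assume X: "Cauchy X"
  have "Cauchy (\<lambda>m. ell2_apply (X m) n)" for n
  proof (rule metric_CauchyI)
    fix e :: real assume "0 < e"
    then obtain M where M: "\<And>m k. m \<ge> M \<Longrightarrow> k \<ge> M \<Longrightarrow> dist (X m) (X k) < e"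
      using X by (meson metric_CauchyD)
    have "dist (ell2_apply (X m) n) (ell2_apply (X k) n) \<le> dist (X m) (X k)" for m k
      using cmod_le_norm_ell2[of "X m - X k" n] by (simp add: dist_norm minus_ell2.rep_eq)
    with M show "\<exists>M. \<forall>m\<ge>M. \<forall>k\<ge>M. dist (ell2_apply (X m) n) (ell2_apply (X k) n) < e"
      by (meson le_less_trans)
  qed
  then have "\<exists>x. (\<lambda>m. ell2_apply (X m) n) \<longlonglongrightarrow> x" for n
    by (simp add: Cauchy_convergent convergentD)
  then obtain x where x: "\<And>n. (\<lambda>m. ell2_apply (X m) n) \<longlonglongrightarrow> x n"
    by metis
  have key: "(\<Sum>n\<in>F. (cmod (ell2_apply (X m) n - x n))\<^sup>2) \<le> e\<^sup>2"
    if "finite F" "\<And>k. k \<ge> M \<Longrightarrow> dist (X m) (X k) \<le> e" for F m M e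
  proof (rule LIMSEQ_le_const2)
    show "(\<lambda>k. \<Sum>n\<in>F. (cmod (ell2_apply (X m) n - ell2_apply (X k) n))\<^sup>2)
      \<longlonglongrightarrow> (\<Sum>n\<in>F. (cmod (ell2_apply (X m) n - x n))\<^sup>2)"
      by (intro tendsto_intros x)
    have "(\<Sum>n\<in>F. (cmod (ell2_apply (X m) n - ell2_apply (X k) n))\<^sup>2) \<le> e\<^sup>2" if "k \<ge> M" for k
      using sum_le_norm_ell2[OF \<open>finite F\<close>, of "X m - X k"]
        power_mono[OF \<open>\<And>k. k \<ge> M \<Longrightarrow> dist (X m) (X k) \<le> e\<close>[OF that], of 2]
      by (simp add: dist_norm minus_ell2.rep_eq)
    then show "\<exists>N. \<forall>k\<ge>N. (\<Sum>n\<in>F. (cmod (ell2_apply (X m) n - ell2_apply (X k) n))\<^sup>2) \<le> e\<^sup>2"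
      by blast
  qed
  have diff: "(\<lambda>n. (cmod (ell2_apply (X m) n - x n))\<^sup>2) summable_on UNIV"
    if "\<And>k. k \<ge> M \<Longrightarrow> dist (X m) (X k) \<le> e" for m M e
    by (rule nonneg_bdd_above_summable_on) (auto intro!: bdd_aboveI2[where M="e\<^sup>2"] key that)
  obtain M1 where "\<And>m k. m \<ge> M1 \<Longrightarrow> k \<ge> M1 \<Longrightarrow> dist (X m) (X k) < 1"
    using X by (meson metric_CauchyD zero_less_one)
  then have "(\<lambda>n. (cmod (ell2_apply (X M1) n - x n))\<^sup>2) summable_on UNIV"
    by (intro diff[of M1 _ 1]) (auto simp: less_imp_le)
  then have "(\<lambda>n. (cmod (x n - ell2_apply (X M1) n))\<^sup>2) summable_on UNIV"
    by (simp add: norm_minus_commute)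
  from ell2_summable_add[OF this ell2_summable[of "X M1"]]
  have "(\<lambda>n. (cmod (x n))\<^sup>2) summable_on UNIV"
    by simp
  then obtain y where y: "ell2_apply y = x"
    by (metis Abs_ell2_inverse mem_Collect_eq)
  have "X \<longlonglongrightarrow> y"
  proof (rule metric_LIMSEQ_I)
    fix e :: real assume e: "0 < e"
    then obtain M where M: "\<And>m k. m \<ge> M \<Longrightarrow> k \<ge> M \<Longrightarrow> dist (X m) (X k) < e / 2"
      using X by (meson metric_CauchyD half_gt_zero)
    have "dist (X m) y < e" if "m \<ge> M" for m
    proof -
      have "(norm (X m - y))\<^sup>2 \<le> (e / 2)\<^sup>2"
        unfolding norm_ell2_square
      proof (rule infsum_le_finite_sums[OF ell2_summable])
        fix F :: "'a set" assume "finite F"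
        then show "(\<Sum>n\<in>F. (cmod (ell2_apply (X m - y) n))\<^sup>2) \<le> (e / 2)\<^sup>2"
          unfolding minus_ell2.rep_eq y by (rule key[of _ M]) (use M[OF that] in \<open>simp add: less_imp_le\<close>)
      qed
      then have "norm (X m - y) \<le> e / 2"
        by (rule power2_le_imp_le) (use e in simp)
      then show ?thesis
        using e by (simp add: dist_norm)
    qed
    then show "\<exists>N. \<forall>n\<ge>N. dist (X n) y < e"
      by blast
  qed
  then show "convergent X"
    by (rule convergentI)
qed

lift_definition delta :: "'a \<Rightarrow> 'a ell2" is "\<lambda>m n. if n = m then 1 else 0"
  subgoal for m
    by (rule finite_nonzero_values_imp_summable_on, rule finite_subset[of _ "{m}"]) auto
  done

section \<open>Bounded operators\<close>

text \<open>
  The operators of type \<^typ>\<open>'a ell2 \<Rightarrow>\<^sub>L 'a ell2\<close> are only real-linear, so multiplication by a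
  complex scalar is introduced as such an operator.
\<close>

lift_definition scaleC_ell2 :: "complex \<Rightarrow> 'a ell2 \<Rightarrow> 'a ell2" is "\<lambda>c u n. c * u n"
  subgoal for c u by (erule ell2_summable_mult[where M="cmod c"]) (simp add: norm_mult)
  done

lemma bounded_linear_scaleC_ell2: "bounded_linear (scaleC_ell2 c :: 'a ell2 \<Rightarrow> 'a ell2)"
proof (rule bounded_linear_intro)
  fix u v :: "'a ell2" and r :: real
  show "scaleC_ell2 c (u + v) = scaleC_ell2 c u + scaleC_ell2 c v"
    by transfer (simp add: algebra_simps)
  show "scaleC_ell2 c (r *\<^sub>R u) = r *\<^sub>R scaleC_ell2 c u"
    by transfer simp
  have "(norm (scaleC_ell2 c u))\<^sup>2 = (norm u * cmod c)\<^sup>2"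
    by (simp add: norm_ell2_square scaleC_ell2.rep_eq norm_mult power_mult_distrib
        infsum_cmult_right' mult.commute[of _ "(cmod c)\<^sup>2"])
  then show "norm (scaleC_ell2 c u) \<le> norm u * cmod c"
    by (rule power2_le_imp_le[OF eq_refl]) simp
qed

lift_definition scalarC :: "complex \<Rightarrow> 'a ell2 \<Rightarrow>\<^sub>L 'a ell2" is scaleC_ell2
  by (rule bounded_linear_scaleC_ell2)

text \<open>
  If \<open>A\<close> is complex-linear then so is any two-sided real-linear inverse of \<open>A - z\<close>; hence, for
  complex-linear \<open>A\<close>, this is the usual spectrum.
\<close>

definition spectrum :: "('a ell2 \<Rightarrow>\<^sub>L 'a ell2) \<Rightarrow> complex set" where
  "spectrum A = {z. \<not> (\<exists>B. B o\<^sub>L (A - scalarC z) = id_blinfun \<and> (A - scalarC z) o\<^sub>L B = id_blinfun)}"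

text \<open>The power series converges in operator norm.\<close>

definition exp_blinfun :: "('b::banach \<Rightarrow>\<^sub>L 'b) \<Rightarrow> ('b \<Rightarrow>\<^sub>L 'b)" where
  "exp_blinfun A = (\<Sum>k. (((o\<^sub>L) A ^^ k) id_blinfun) /\<^sub>R fact k)"

lemma summable_exp_blinfun: "summable (\<lambda>k. (((o\<^sub>L) A ^^ k) id_blinfun) /\<^sub>R fact k)"
  for A :: "'b::banach \<Rightarrow>\<^sub>L 'b"
proof (rule summable_comparison_test'[OF summable_exp[of "norm A"]])
  fix k
  have "norm (((o\<^sub>L) A ^^ k) id_blinfun) \<le> norm A ^ k"
  proof (induction k)
    case 0
    show ?case by (simp add: norm_blinfun_id_le)
  next
    case (Suc k)
    then show ?case
      using norm_blinfun_compose[of A "((o\<^sub>L) A ^^ k) id_blinfun"]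
      by (simp, meson mult_left_mono norm_ge_zero order_trans)
  qed
  then show "norm ((((o\<^sub>L) A ^^ k) id_blinfun) /\<^sub>R fact k) \<le> inverse (fact k) * norm A ^ k"
    by (simp add: mult_left_mono)
qed

section \<open>The discrete Schroedinger operator and its transfer matrices\<close>

text \<open>Only meaningful for bounded \<open>V\<close>, see \<open>schroedinger_apply\<close> below.\<close>

definition schroedinger :: "(int \<Rightarrow> real) \<Rightarrow> int ell2 \<Rightarrow>\<^sub>L int ell2" where
  "schroedinger V = Blinfun (\<lambda>u. Abs_ell2 (\<lambda>n.
     ell2_apply u (n + 1) + ell2_apply u (n - 1) + complex_of_real (V n) * ell2_apply u n))"

lift_definition shift_ell2 :: "int \<Rightarrow> int ell2 \<Rightarrow> int ell2" is "\<lambda>k u n. u (n + k)"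
  subgoal for k u
    by (subst summable_on_reindex_bij_betw[of "\<lambda>n. n + k" UNIV UNIV "\<lambda>n. (cmod (u n))\<^sup>2"])
      (auto intro!: bij_betwI[where g="\<lambda>n. n - k"])
  done

lemma norm_shift_ell2: "norm (shift_ell2 k u) = norm u"
proof -
  have "(norm (shift_ell2 k u))\<^sup>2 = (norm u)\<^sup>2"
    unfolding norm_ell2_square shift_ell2.rep_eq
    by (rule infsum_reindex_bij_betw[of "\<lambda>n. n + k" UNIV UNIV "\<lambda>n. (cmod (ell2_apply u n))\<^sup>2"])
      (auto intro!: bij_betwI[where g="\<lambda>n. n - k"])
  then show ?thesis
    by simp
qed

lemma schroedinger_apply:
  assumes "bounded (range V)"
  shows "ell2_apply (blinfun_apply (schroedinger V) u) n =
    ell2_apply u (n + 1) + ell2_apply u (n - 1) + complex_of_real (V n) * ell2_apply u n"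
proof -
  obtain M where M: "\<And>n. \<bar>V n\<bar> \<le> M"
    using assms by (auto simp: bounded_iff)
  have M0: "0 \<le> M"
    using M[of 0] by simp
  have mem: "(\<lambda>n. (cmod (complex_of_real (V n) * ell2_apply u n))\<^sup>2) summable_on UNIV" for u
    by (rule ell2_summable_mult[OF ell2_summable[of u], where M=M])
      (simp add: norm_mult mult_right_mono M)
  define W where "W u = Abs_ell2 (\<lambda>n. complex_of_real (V n) * ell2_apply u n)" for u
  have W: "ell2_apply (W u) n = complex_of_real (V n) * ell2_apply u n" for u n
    unfolding W_def by (subst Abs_ell2_inverse) (use mem in auto)
  have NW: "norm (W u) \<le> M * norm u" for u
  proof (rule power2_le_imp_le)
    have "(\<Sum>\<^sub>\<infinity>n. (cmod (ell2_apply (W u) n))\<^sup>2) \<le> (\<Sum>\<^sub>\<infinity>n. M\<^sup>2 * (cmod (ell2_apply u n))\<^sup>2)"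
    proof (intro infsum_mono ell2_summable summable_on_cmult_right)
      fix n
      have "(\<bar>V n\<bar>)\<^sup>2 \<le> M\<^sup>2"
        by (intro power_mono M) simp
      then show "(cmod (ell2_apply (W u) n))\<^sup>2 \<le> M\<^sup>2 * (cmod (ell2_apply u n))\<^sup>2"
        by (simp add: W norm_mult power_mult_distrib mult_right_mono)
    qed
    then show "(norm (W u))\<^sup>2 \<le> (M * norm u)\<^sup>2"
      by (simp add: norm_ell2_square power_mult_distrib infsum_cmult_right')
  qed (use M0 in simp)
  define G where "G u = shift_ell2 1 u + shift_ell2 (- 1) u + W u" for u
  have G: "ell2_apply (G u) n =
      ell2_apply u (n + 1) + ell2_apply u (n - 1) + complex_of_real (V n) * ell2_apply u n" for u n
    by (simp add: G_def plus_ell2.rep_eq shift_ell2.rep_eq W)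
  have "bounded_linear G"
  proof (rule bounded_linear_intro)
    fix u v :: "int ell2" and r :: real
    show "G (u + v) = G u + G v"
      by (rule ell2_eqI) (simp add: G plus_ell2.rep_eq algebra_simps)
    show "G (r *\<^sub>R u) = r *\<^sub>R G u"
      by (rule ell2_eqI) (simp add: G scaleR_ell2.rep_eq algebra_simps)
    have "norm (G u) \<le> norm (shift_ell2 1 u) + norm (shift_ell2 (- 1) u) + norm (W u)"
      unfolding G_def by (intro norm_triangle_le add_right_mono norm_triangle_ineq)
    also have "\<dots> \<le> norm u * (2 + M)"
      using NW[of u] by (simp add: norm_shift_ell2 algebra_simps)
    finally show "norm (G u) \<le> norm u * (2 + M)" .
  qed
  moreover have "schroedinger V = Blinfun G"
    unfolding schroedinger_def G[symmetric] ell2_apply_inverse ..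
  ultimately show ?thesis
    by (simp add: bounded_linear_Blinfun_apply G)
qed

text \<open>The solution at time \<open>t\<close> started from \<open>\<delta>\<^sub>0\<close> is \<open>exp (- i t H) \<delta>\<^sub>0\<close>.\<close>

definition evolution :: "(int \<Rightarrow> real) \<Rightarrow> real \<Rightarrow> int ell2 \<Rightarrow>\<^sub>L int ell2" where
  "evolution V t = exp_blinfun (scalarC (- \<i> * complex_of_real t) o\<^sub>L schroedinger V)"

definition transition_prob :: "(int \<Rightarrow> real) \<Rightarrow> real \<Rightarrow> int \<Rightarrow> real" where
  "transition_prob V t n = (cmod (cinner (blinfun_apply (evolution V t) (delta 0)) (delta n)))\<^sup>2"

definition transfer :: "(int \<Rightarrow> real) \<Rightarrow> int \<Rightarrow> complex \<Rightarrow> complex^2^2" where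
  "transfer V m z = vector [vector [z - complex_of_real (V m), -1], vector [1, 0]]"

primrec transfer_right :: "(int \<Rightarrow> real) \<Rightarrow> nat \<Rightarrow> complex \<Rightarrow> complex^2^2" where
  "transfer_right V 0 z = mat 1"
| "transfer_right V (Suc k) z = transfer V (int k + 1) z ** transfer_right V k z"

text \<open>\<open>transfer_left V k\<close> is \<open>\<Phi>(-k)\<close>, and \<open>\<Phi>(-(k+1)) = T(-k)\<inverse> \<Phi>(-k)\<close>.\<close>

primrec transfer_left :: "(int \<Rightarrow> real) \<Rightarrow> nat \<Rightarrow> complex \<Rightarrow> complex^2^2" where
  "transfer_left V 0 z = mat 1"
| "transfer_left V (Suc k) z = matrix_inv (transfer V (- int k) z) ** transfer_left V k z"

definition Phi :: "(int \<Rightarrow> real) \<Rightarrow> int \<Rightarrow> complex \<Rightarrow> complex^2^2" where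
  "Phi V n z = (if n \<ge> 0 then transfer_right V (nat n) z else transfer_left V (nat (- n)) z)"

text \<open>The operator norm with respect to the Euclidean norm (the norm of \<^typ>\<open>complex^2^2\<close> itself
  is the Frobenius norm).\<close>

definition matrix_norm :: "complex^2^2 \<Rightarrow> real" where
  "matrix_norm A = onorm (\<lambda>x. A *v x)"

section \<open>Outside probabilities, moments and transport exponents\<close>

definition P_right :: "(int \<Rightarrow> real) \<Rightarrow> real \<Rightarrow> real \<Rightarrow> real" where
  "P_right V N t = (\<Sum>\<^sub>\<infinity>n\<in>{n::int. real_of_int n \<ge> N}. transition_prob V t n)"

definition P_left :: "(int \<Rightarrow> real) \<Rightarrow> real \<Rightarrow> real \<Rightarrow> real" where
  "P_left V N t = (\<Sum>\<^sub>\<infinity>n\<in>{n::int. real_of_int n \<le> - N}. transition_prob V t n)"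

definition P_outside :: "(int \<Rightarrow> real) \<Rightarrow> real \<Rightarrow> real \<Rightarrow> real" where
  "P_outside V N t = P_left V N t + P_right V N t"

text \<open>Logarithm on \<open>[0, \<infinity>]\<close> with \<open>log 0 = -\<infinity>\<close>; note that \<open>ln 0 = 0\<close> for the library function.\<close>

definition ereal_log :: "ereal \<Rightarrow> ereal" where
  "ereal_log x = (if x \<le> 0 then - \<infinity> else if x = \<infinity> then \<infinity> else ereal (ln (real_of_ereal x)))"

definition S_plus :: "(int \<Rightarrow> real) \<Rightarrow> real \<Rightarrow> ereal" where
  "S_plus V \<alpha> = - Limsup at_top (\<lambda>t::real.
     ereal_log (ereal (P_outside V (t powr \<alpha> - 1) t)) / ereal (ln t))"

definition alpha_u_plus :: "(int \<Rightarrow> real) \<Rightarrow> ereal" where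
  "alpha_u_plus V = Sup (ereal ` {\<alpha>. \<alpha> \<ge> 0 \<and> S_plus V \<alpha> < \<infinity>})"

text \<open>The sum is taken in \<^typ>\<open>ennreal\<close>, so that a divergent series has value \<open>\<infinity>\<close>.\<close>

definition moment :: "(int \<Rightarrow> real) \<Rightarrow> real \<Rightarrow> real \<Rightarrow> ennreal" where
  "moment V p t = (\<Sum>\<^sub>\<infinity>n. ennreal (\<bar>real_of_int n\<bar> powr p * transition_prob V t n))"

definition beta_plus :: "(int \<Rightarrow> real) \<Rightarrow> real \<Rightarrow> ereal" where
  "beta_plus V p = Limsup at_top (\<lambda>t::real.
     ereal_log (enn2ereal (moment V p t)) / ereal (p * ln t))"

end

theory Submission
  imports Defs "HOL-Complex_Analysis.Complex_Analysis" "HOL-Real_Asymp.Real_Asymp"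
begin

text \<open>
  The amplitude \<open>\<langle>\<delta>\<^sub>n, exp (- i t H) \<delta>\<^sub>0\<rangle>\<close> is a contour integral of \<open>exp (- i t z) G z n\<close>, with
  \<open>G z = (H - z)\<inverse> \<delta>\<^sub>0\<close>, over the rectangle with vertices \<open>\<plusminus>K - i\<close> and \<open>\<plusminus>K + i/t\<close>, where the exponential is
  bounded. On the lower side and on the vertical sides, \<open>G z\<close> decays exponentially in \<open>|n|\<close>,
  uniformly in \<open>z\<close>. On the upper side, the sum of \<open>|G z n|\<^sup>2\<close> over the sites beyond \<open>N\<close> is at most a power of
  \<open>t\<close> times \<open>max |\<Phi>(n, z)|\<^sup>-\<^sup>2\<close> over \<open>n \<le> N\<close>, because the Wronskian of \<open>G z\<close> with a growing solution is constant. Hence the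
  probability outside \<open>C t\<^sup>\<alpha>\<close> decays faster than any power of \<open>t\<close>. The same contour with upper side
  at height \<open>1\<close> gives \<open>exp (2 t - c |n|)\<close> decay, which controls the moments beyond \<open>|n| = t\<^sup>2\<close>.
\<close>

section \<open>Square-summable functions and symmetry of \<open>H\<close>\<close>

text \<open>For \<open>t \<ge> 0\<close> the modulus of \<open>exp (- i t z)\<close> is
  \<open>exp (t * Im z)\<close>. Below the real axis the contour may therefore stay at distance 1,
  but above it the height must shrink like 1/t, and there the decay rate obtained from a lower bound
  on \<open>H - z\<close> alone degenerates. This is the only side that needs the transfer matrices.
  The margin 1 between the spectrum and the points K and -K makes room for the vertical sides. The
  contour integral asks only for the resolvent and Cauchy's theorem, so no spectral measure is ever
  built.

  Powers of t lost on the upper side are harmless, because the hypothesis holds for every exponent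
  m. The site where \<Phi> is large may depend on the energy: the tail considered lies beyond all
  admissible sites, so the best one can be taken for each energy separately.

  For the moments, superpolynomial smallness of the outside mass is not enough, since the weight
  |n|^p is unbounded. Conservation of the norm bounds the bulk, the outside estimate pays for
  weights up to t^(2p), and beyond t^2 a pointwise exponential bound takes over.\<close>

lemma inner_ell2_eq: "inner u v = (\<Sum>\<^sub>\<infinity>n. Re (cnj (ell2_apply u n) * ell2_apply v n))"
  unfolding inner_ell2_def cinner_def
  by (rule infsum_Re[symmetric, OF ell2_summable_cinner[OF ell2_summable ell2_summable]])

lemma bounded_linear_ell2_apply: "bounded_linear (\<lambda>u. ell2_apply u n)"
  by (rule bounded_linear_intro[where K = 1])
    (simp_all add: plus_ell2.rep_eq scaleR_ell2.rep_eq cmod_le_norm_ell2)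

lemma norm_delta [simp]: "norm (delta m) = 1"
proof -
  have "(norm (delta m))\<^sup>2 = (\<Sum>\<^sub>\<infinity>n. if n = m then 1 else (0::real))"
    unfolding norm_ell2_square by (intro infsum_cong) (simp add: delta.rep_eq)
  also have "\<dots> = (\<Sum>\<^sub>\<infinity>n\<in>{m}. 1)"
    by (rule infsum_cong_neutral) auto
  finally show ?thesis
    using norm_ge_zero[of "delta m"] by (simp add: power2_eq_1_iff del: norm_ge_zero)
qed

lemma cinner_delta_right: "cinner u (delta n) = cnj (ell2_apply u n)"
proof -
  have "cinner u (delta n) = (\<Sum>\<^sub>\<infinity>k\<in>{n}. cnj (ell2_apply u k))"
    unfolding cinner_def by (rule infsum_cong_neutral) (auto simp: delta.rep_eq)
  then show ?thesis by simp
qed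

lemma norm_scaleC_ell2: "norm (scaleC_ell2 c u) = cmod c * norm u"
proof -
  have "(norm (scaleC_ell2 c u))\<^sup>2 = (cmod c * norm u)\<^sup>2"
    by (simp add: norm_ell2_square scaleC_ell2.rep_eq norm_mult power_mult_distrib
        infsum_cmult_right')
  then show ?thesis
    by (simp add: power2_eq_iff_nonneg)
qed

lemma inner_scaleC_ii: "inner (scaleC_ell2 \<i> u) v = - inner u (scaleC_ell2 \<i> v)"
  unfolding inner_ell2_eq infsum_uminus[symmetric]
  by (intro infsum_cong) (simp add: scaleC_ell2.rep_eq)

text \<open>Lets exponential decay on the left half-line be read off from the right half-line with
  the potential \<open>V (- n)\<close>.\<close>

lift_definition reflect_ell2 :: "int ell2 \<Rightarrow> int ell2" is "\<lambda>u n. u (- n)"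
  subgoal for u
    by (subst summable_on_reindex_bij_betw[of uminus UNIV UNIV "\<lambda>n. (cmod (u n))\<^sup>2"])
      (auto intro!: bij_betwI[where g = uminus])
  done

lemma norm_reflect_ell2 [simp]: "norm (reflect_ell2 u) = norm u"
proof -
  have "(norm (reflect_ell2 u))\<^sup>2 = (norm u)\<^sup>2"
    unfolding norm_ell2_square reflect_ell2.rep_eq
    by (rule infsum_reindex_bij_betw[of uminus UNIV UNIV "\<lambda>n. (cmod (ell2_apply u n))\<^sup>2"])
      (auto intro!: bij_betwI[where g = uminus])
  then show ?thesis
    by simp
qed

lemma reflect_delta_0 [simp]: "reflect_ell2 (delta 0) = delta 0"
  by (rule ell2_eqI) (auto simp: reflect_ell2.rep_eq delta.rep_eq)

lift_definition restrict_ell2 :: "'a set \<Rightarrow> 'a ell2 \<Rightarrow> 'a ell2" is "\<lambda>A u n. if n \<in> A then u n else 0"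
  subgoal for A u by (erule ell2_summable_mult[where M = 1]) simp
  done

lemma norm_restrict_ell2: "(norm (restrict_ell2 A u))\<^sup>2 = (\<Sum>\<^sub>\<infinity>n\<in>A. (cmod (ell2_apply u n))\<^sup>2)"
  unfolding norm_ell2_square restrict_ell2.rep_eq by (rule infsum_cong_neutral) auto

locale bounded_potential =
  fixes V :: "int \<Rightarrow> real"
  assumes bounded_V: "bounded (range V)"
begin

abbreviation H :: "int ell2 \<Rightarrow>\<^sub>L int ell2" where "H \<equiv> schroedinger V"

lemmas H_apply = schroedinger_apply[OF bounded_V]

lemma H_minus_apply:
  "ell2_apply (blinfun_apply (H - scalarC z) u) n =
    ell2_apply u (n + 1) + ell2_apply u (n - 1) + (complex_of_real (V n) - z) * ell2_apply u n"
  by (simp add: minus_blinfun.rep_eq minus_ell2.rep_eq H_apply scalarC.rep_eq scaleC_ell2.rep_eq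
      algebra_simps)

lemma H_scaleC: "blinfun_apply H (scaleC_ell2 c u) = scaleC_ell2 c (blinfun_apply H u)"
  by (rule ell2_eqI) (simp add: H_apply scaleC_ell2.rep_eq algebra_simps)

lemma H_minus_scaleC:
  "blinfun_apply (H - scalarC z) (scaleC_ell2 c u) = scaleC_ell2 c (blinfun_apply (H - scalarC z) u)"
  by (rule ell2_eqI) (simp add: H_minus_apply scaleC_ell2.rep_eq algebra_simps)

text \<open>The shifts by 1 and -1 are adjoint to each other and \<open>V\<close> is real.
  \<open>inner\<close> is only the real part of \<open>cinner\<close>; together with
  \<open>H_scaleC\<close> the statement carries full self-adjointness.\<close>

lemma H_symmetric: "inner (blinfun_apply H u) v = inner u (blinfun_apply H v)"
proof -
  have shift: "inner (shift_ell2 k u) v = inner u (shift_ell2 (- k) v)" for k u v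
    unfolding inner_ell2_eq shift_ell2.rep_eq
    by (subst infsum_reindex_bij_betw[of "\<lambda>n. n - k" UNIV UNIV, symmetric])
      (auto intro!: bij_betwI[where g = "\<lambda>n. n + k"])
  define W where "W u = blinfun_apply H u - shift_ell2 1 u - shift_ell2 (-1) u" for u
  have W: "ell2_apply (W u) n = complex_of_real (V n) * ell2_apply u n" for u n
    by (simp add: W_def minus_ell2.rep_eq shift_ell2.rep_eq H_apply)
  have "inner (W u) v = inner u (W v)"
    unfolding inner_ell2_eq W by (intro infsum_cong) (simp add: algebra_simps)
  then show ?thesis
    using shift[of 1 u v] shift[of "-1" u v]
    by (simp add: W_def inner_diff_left inner_diff_right)
qed

text \<open>Pythagoras: by symmetry of \<open>H\<close>, the vectors \<open>(H - Re z) u\<close> and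
  \<open>i u\<close> are orthogonal in the real inner product. All lower bounds used on the contour
  come from this identity.\<close>

lemma norm_H_minus:
  "(norm (blinfun_apply (H - scalarC z) u))\<^sup>2 =
    (norm (blinfun_apply (H - scalarC (complex_of_real (Re z))) u))\<^sup>2 + (Im z)\<^sup>2 * (norm u)\<^sup>2"
proof -
  let ?A = "blinfun_apply (H - scalarC (complex_of_real (Re z))) u"
  have eq: "blinfun_apply (H - scalarC z) u = ?A - Im z *\<^sub>R scaleC_ell2 \<i> u"
    by (rule ell2_eqI)
      (simp add: H_minus_apply minus_ell2.rep_eq scaleR_ell2.rep_eq scaleC_ell2.rep_eq
        complex_eq_iff algebra_simps)
  have A: "?A = blinfun_apply H u - Re z *\<^sub>R u"
    by (rule ell2_eqI)
      (simp add: H_minus_apply H_apply minus_ell2.rep_eq scaleR_ell2.rep_eq scaleR_conv_of_real algebra_simps)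
  have 0: "inner u (scaleC_ell2 \<i> u) = 0" for u :: "int ell2"
    using inner_scaleC_ii[of u u] by (simp add: inner_commute)
  \<comment> \<open>\<open>H\<close> is symmetric and commutes with the skew map \<open>i\<close>,
    so moving both across the inner product returns its negative.\<close>
  have "inner (blinfun_apply H u) (scaleC_ell2 \<i> u) = - inner (blinfun_apply H u) (scaleC_ell2 \<i> u)"
    by (metis H_symmetric H_scaleC inner_scaleC_ii inner_commute)
  then have "inner ?A (scaleC_ell2 \<i> u) = 0"
    by (simp add: A inner_diff_left 0)
  then have "(norm (?A - Im z *\<^sub>R scaleC_ell2 \<i> u))\<^sup>2 = (norm ?A)\<^sup>2 + (norm (Im z *\<^sub>R scaleC_ell2 \<i> u))\<^sup>2"
    by (simp only: power2_norm_eq_inner inner_diff_left inner_diff_right) (simp add: inner_commute)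
  then show ?thesis
    by (simp add: eq norm_scaleC_ell2 power_mult_distrib)
qed

lemma norm_H_minus_ge_Im: "\<bar>Im z\<bar> * norm u \<le> norm (blinfun_apply (H - scalarC z) u)"
  by (rule power2_le_imp_le) (simp_all add: norm_H_minus[of z] power_mult_distrib)

text \<open>Spreads a lower bound at one real point over the whole vertical line through it, with
  the same constant.\<close>

lemma norm_H_minus_ge_Re:
  "norm (blinfun_apply (H - scalarC (complex_of_real (Re z))) u) \<le> norm (blinfun_apply (H - scalarC z) u)"
  by (rule power2_le_imp_le) (simp_all add: norm_H_minus[of z])

end

lemma (in bounded_potential) reflected: "bounded_potential (\<lambda>n. V (- n))"
  using bounded_V by unfold_locales (auto simp: bounded_iff)

lemma (in bounded_potential) reflect_H_minus:
  "blinfun_apply (schroedinger (\<lambda>n. V (- n)) - scalarC z) (reflect_ell2 u) =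
    reflect_ell2 (blinfun_apply (H - scalarC z) u)"
proof -
  interpret R: bounded_potential "\<lambda>n. V (- n)" by (rule reflected)
  show ?thesis
    by (rule ell2_eqI)
      (simp add: H_minus_apply R.H_minus_apply reflect_ell2.rep_eq add.commute)
qed

section \<open>Exponential decay of the resolvent away from the spectrum\<close>

definition right_tail :: "int ell2 \<Rightarrow> nat \<Rightarrow> real" where
  "right_tail u n = (\<Sum>\<^sub>\<infinity>k\<in>{int n..}. (cmod (ell2_apply u k))\<^sup>2)"

lemma ell2_summable_on: "(\<lambda>n. (cmod (ell2_apply u n))\<^sup>2) summable_on A"
  by (rule summable_on_subset_banach[OF ell2_summable]) simp

lemma right_tail_Suc: "right_tail u n = (cmod (ell2_apply u (int n)))\<^sup>2 + right_tail u (Suc n)"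
proof -
  have "{int n..} = insert (int n) {int (Suc n)..}"
    by auto
  then show ?thesis
    unfolding right_tail_def by (simp add: infsum_insert ell2_summable_on)
qed

lemma right_tail_le_norm: "right_tail u n \<le> (norm u)\<^sup>2"
  unfolding right_tail_def norm_ell2_square
  by (rule infsum_mono_neutral) (auto simp: ell2_summable_on)

lemma sum_le_right_tail:
  assumes "finite F" "F \<subseteq> {int n..}"
  shows "(\<Sum>k\<in>F. (cmod (ell2_apply u k))\<^sup>2) \<le> right_tail u n"
  unfolding right_tail_def by (rule finite_sum_le_infsum) (use assms ell2_summable_on in auto)

lemma norm_two_deltas:
  assumes "j \<noteq> k" "\<And>n. n \<noteq> j \<Longrightarrow> n \<noteq> k \<Longrightarrow> ell2_apply v n = 0"
  shows "(norm v)\<^sup>2 = (cmod (ell2_apply v j))\<^sup>2 + (cmod (ell2_apply v k))\<^sup>2"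
proof -
  have "(norm v)\<^sup>2 = (\<Sum>\<^sub>\<infinity>n\<in>{j, k}. (cmod (ell2_apply v n))\<^sup>2)"
    unfolding norm_ell2_square by (rule infsum_cong_neutral) (use assms in auto)
  then show ?thesis
    using assms(1) by simp
qed

context bounded_potential
begin

text \<open>Truncating \<open>u\<close> to \<open>[n, \<infinity>)\<close> leaves only two boundary terms in \<open>(H - z) u\<close>; this replaces the
  Combes--Thomas estimate.\<close>

lemma right_tail_step:
  assumes u: "blinfun_apply (H - scalarC z) u = delta 0"
    and lower: "\<And>v. \<kappa> * norm v \<le> norm (blinfun_apply (H - scalarC z) v)"
    and "0 \<le> \<kappa>"
  shows "(1 + \<kappa>\<^sup>2) * right_tail u (n + 2) \<le> right_tail u n"
proof -
  \<comment> \<open>Cutting at \<open>Suc n\<close> puts the boundary terms at the sites n and n +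
    1. The equation for \<open>u\<close> is used only at sites \<ge> n + 1 \<ge> 1, so the source at
    0 does not appear even for n = 0.\<close>
  let ?v = "restrict_ell2 {int (Suc n)..} u"
  let ?w = "blinfun_apply (H - scalarC z) ?v"
  have eq: "ell2_apply u (k + 1) + ell2_apply u (k - 1) + (complex_of_real (V k) - z) * ell2_apply u k
      = (if k = 0 then 1 else 0)" for k
    using arg_cong[OF u, of "\<lambda>u. ell2_apply u k"] by (simp only: H_minus_apply) (simp add: delta.rep_eq)
  have w1: "ell2_apply ?w (int n) = ell2_apply u (int (Suc n))"
    by (simp add: H_minus_apply restrict_ell2.rep_eq add.commute)
  have w2: "ell2_apply ?w (int (Suc n)) = - ell2_apply u (int n)"
    using eq[of "int (Suc n)"] by (simp add: H_minus_apply restrict_ell2.rep_eq algebra_simps eq_neg_iff_add_eq_0)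
  have w0: "ell2_apply ?w k = 0" if "k \<noteq> int n" "k \<noteq> int (Suc n)" for k
  proof (cases "k < int n")
    case True
    then show ?thesis by (simp add: H_minus_apply restrict_ell2.rep_eq)
  next
    case False
    then have "k > int (Suc n)" using that by simp
    then show ?thesis using eq[of k] by (simp add: H_minus_apply restrict_ell2.rep_eq)
  qed
  have "(\<kappa> * norm ?v)\<^sup>2 \<le> (norm ?w)\<^sup>2"
    by (intro power_mono lower) (use assms(3) in simp)
  also have "\<dots> = (cmod (ell2_apply u (int n)))\<^sup>2 + (cmod (ell2_apply u (int (Suc n))))\<^sup>2"
    using norm_two_deltas[of "int n" "int (Suc n)" ?w, OF _ w0] unfolding w1 w2 by simp
  also have "(\<kappa> * norm ?v)\<^sup>2 = \<kappa>\<^sup>2 * right_tail u (Suc n)"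
    by (simp only: power_mult_distrib norm_restrict_ell2 right_tail_def)
  \<comment> \<open>The two boundary masses are exactly what the tail loses from n to n + 2; this
    turns the lower bound into a contraction.\<close>
  finally have "\<kappa>\<^sup>2 * right_tail u (Suc n) \<le> right_tail u n - right_tail u (n + 2)"
    using right_tail_Suc[of u n] right_tail_Suc[of u "Suc n"] by simp
  moreover have "\<kappa>\<^sup>2 * right_tail u (n + 2) \<le> \<kappa>\<^sup>2 * right_tail u (Suc n)"
    by (rule mult_left_mono) (use right_tail_Suc[of u "Suc n"] in simp_all)
  ultimately show ?thesis
    by (simp add: algebra_simps)
qed

text \<open>Iterates the contraction over two sites, hence \<open>n div 2\<close>. The start is
  \<open>norm u \<le> 1 / \<kappa>\<close>, which is the lower bound applied to \<open>u\<close>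
  itself.\<close>

lemma right_tail_decay:
  assumes u: "blinfun_apply (H - scalarC z) u = delta 0"
    and lower: "\<And>v. \<kappa> * norm v \<le> norm (blinfun_apply (H - scalarC z) v)"
    and "0 < \<kappa>"
  shows "right_tail u n \<le> (1 / (1 + \<kappa>\<^sup>2)) ^ (n div 2) / \<kappa>\<^sup>2"
proof (induction n rule: less_induct)
  case (less n)
  show ?case
  proof (cases "n < 2")
    case True
    have "\<kappa> * norm u \<le> 1"
      using lower[of u] by (simp add: u)
    then have "(norm u)\<^sup>2 \<le> 1 / \<kappa>\<^sup>2"
      using power_mono[of "norm u" "1 / \<kappa>" 2] assms(3) by (simp add: field_simps)
    with right_tail_le_norm[of u n] True show ?thesis
      by simp
  next
    case False
    then obtain m where m: "n = m + 2"
      by (metis add.commute le_add_diff_inverse not_less)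
    have pos: "0 < 1 + \<kappa>\<^sup>2"
      by (simp add: add_pos_nonneg)
    have "right_tail u n \<le> (1 / (1 + \<kappa>\<^sup>2)) * right_tail u m"
      using right_tail_step[OF u lower, of m] assms(3) pos by (simp add: m field_simps)
    also have "\<dots> \<le> (1 / (1 + \<kappa>\<^sup>2)) * ((1 / (1 + \<kappa>\<^sup>2)) ^ (m div 2) / \<kappa>\<^sup>2)"
      by (intro mult_left_mono less) (use m pos in auto)
    finally show ?thesis
      by (simp add: m)
  qed
qed

end

lemma (in bounded_potential) reflect_lower:
  assumes "\<And>v. \<kappa> * norm v \<le> norm (blinfun_apply (H - scalarC z) v)"
  shows "\<kappa> * norm v \<le> norm (blinfun_apply (schroedinger (\<lambda>n. V (- n)) - scalarC z) v)"
proof -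
  have "v = reflect_ell2 (reflect_ell2 v)"
    by (rule ell2_eqI) (simp add: reflect_ell2.rep_eq)
  then show ?thesis
    using assms[of "reflect_ell2 v"] by (metis norm_reflect_ell2 reflect_H_minus)
qed

text \<open>Finite sets \<open>F\<close> stand for the infinite outside region from here on: the
  contour estimates then exchange integrals with finite sums only, and the passage to infinite sums
  is made at the very end.\<close>

lemma (in bounded_potential) outside_decay:
  assumes u: "blinfun_apply (H - scalarC z) u = delta 0"
    and lower: "\<And>v. \<kappa> * norm v \<le> norm (blinfun_apply (H - scalarC z) v)"
    and "0 < \<kappa>" and F: "finite F" "\<And>k. k \<in> F \<Longrightarrow> int n \<le> \<bar>k\<bar>"
  shows "(\<Sum>k\<in>F. (cmod (ell2_apply u k))\<^sup>2) \<le> 2 * (1 / (1 + \<kappa>\<^sup>2)) ^ (n div 2) / \<kappa>\<^sup>2"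
proof -
  interpret R: bounded_potential "\<lambda>n. V (- n)" by (rule reflected)
  let ?F1 = "F \<inter> {0..}" and ?F2 = "F \<inter> {..-1}"
  have "(\<Sum>k\<in>?F1. (cmod (ell2_apply u k))\<^sup>2) \<le> right_tail u n"
    by (rule sum_le_right_tail) (use F in force)+
  also have "\<dots> \<le> (1 / (1 + \<kappa>\<^sup>2)) ^ (n div 2) / \<kappa>\<^sup>2"
    by (rule right_tail_decay[OF u lower assms(3)])
  finally have 1: "(\<Sum>k\<in>?F1. (cmod (ell2_apply u k))\<^sup>2) \<le> (1 / (1 + \<kappa>\<^sup>2)) ^ (n div 2) / \<kappa>\<^sup>2" .
  have "(\<Sum>k\<in>?F2. (cmod (ell2_apply u k))\<^sup>2) = (\<Sum>k\<in>uminus ` ?F2. (cmod (ell2_apply (reflect_ell2 u) k))\<^sup>2)"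
    by (subst sum.reindex) (auto simp: reflect_ell2.rep_eq)
  also have "\<dots> \<le> right_tail (reflect_ell2 u) n"
    by (rule sum_le_right_tail) (use F in force)+
  also have "\<dots> \<le> (1 / (1 + \<kappa>\<^sup>2)) ^ (n div 2) / \<kappa>\<^sup>2"
    by (rule R.right_tail_decay[OF _ reflect_lower[OF lower] assms(3)]) (simp add: reflect_H_minus u)
  finally have 2: "(\<Sum>k\<in>?F2. (cmod (ell2_apply u k))\<^sup>2) \<le> (1 / (1 + \<kappa>\<^sup>2)) ^ (n div 2) / \<kappa>\<^sup>2" .
  have "(\<Sum>k\<in>F. (cmod (ell2_apply u k))\<^sup>2) =
      (\<Sum>k\<in>?F1. (cmod (ell2_apply u k))\<^sup>2) + (\<Sum>k\<in>?F2. (cmod (ell2_apply u k))\<^sup>2)"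
    by (subst sum.union_disjoint[symmetric]) (use F in \<open>auto intro!: sum.cong\<close>)
  with 1 2 show ?thesis
    by simp
qed

section \<open>Transfer matrices and the tail of the resolvent\<close>

text \<open>The current \<open>Im (cnj (x k) * x (k + 1))\<close> grows by \<open>\<eta> |x|\<^sup>2\<close> at each step. It is therefore
  nonpositive for the square-summable solution \<open>w\<close> and large for \<open>x\<close>, so these two solutions are
  quantitatively transversal and their constant Wronskian forces \<open>w\<close> to be small where \<open>x\<close> is large.\<close>

lemma decaying_solution_tail:
  fixes a x w :: "nat \<Rightarrow> complex"
  assumes Ima: "\<And>k. Im (a k) = \<eta>" and \<eta>: "0 < \<eta>" "\<eta> \<le> 1" and A: "\<And>k. cmod (a k) \<le> A"
    and x: "\<And>k. x (k + 2) = a (k + 1) * x (k + 1) - x k"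
    and x0: "x 0 = 0 \<and> x 1 = 1 \<or> x 0 = 1 \<and> x 1 = 0"
    and w: "\<And>k. w (k + 3) = a (k + 2) * w (k + 2) - w (k + 1)"
    and w0: "w \<longlonglongrightarrow> 0"
    and W: "\<And>F. finite F \<Longrightarrow> (\<Sum>k\<in>F. (cmod (w k))\<^sup>2) \<le> W\<^sup>2" "0 \<le> W"
    and n: "1 \<le> n" and F: "finite F" "F \<subseteq> {n<..}"
  shows "(\<Sum>k\<in>F. (cmod (w k))\<^sup>2) * (cmod (x n) + cmod (x (n + 1)))\<^sup>2 \<le> 4 * (A + 2) ^ 6 * W\<^sup>2 / \<eta> ^ 3"
proof -
  define S where "S = (\<Sum>k\<in>F. (cmod (w k))\<^sup>2)"
  define B where "B = cmod (x n) + cmod (x (n + 1))"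
  have A0: "0 \<le> A" using A[of 0] norm_ge_zero order_trans by blast
  have S0: "0 \<le> S" "S \<le> W\<^sup>2" unfolding S_def using W F by (auto intro: sum_nonneg)
  have B0: "0 \<le> B" by (simp add: B_def)
  have x2: "cmod (x 2) \<le> A + 1" "cmod (x 1) + cmod (x 2) \<le> A + 2"
  proof -
    have "x 2 = a 1 * x 1 - x 0"
      using x[of 0] by (metis One_nat_def add_0)
    then show "cmod (x 2) \<le> A + 1" "cmod (x 1) + cmod (x 2) \<le> A + 2"
      using x0 A[of 1] A0 by auto
  qed
  have W1: "cmod (w 1) \<le> W" "cmod (w 2) \<le> W"
    using W(1)[of "{1}"] W(1)[of "{2}"] W(2) by (auto simp: power2_le_iff_abs_le)
  show ?thesis
  proof (cases "n = 1")
    \<comment> \<open>The lower bound on the current of \<open>x\<close> needs two steps behind n,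
      and with \<open>x 1 = 0\<close> that current still vanishes at n = 1. Here
      \<open>B \<le> A + 2\<close>, so the trivial bound \<open>S \<le> W^2\<close> is
      enough.\<close>
    case True
    have "S * B\<^sup>2 \<le> W\<^sup>2 * (A + 2)\<^sup>2"
      by (intro mult_mono S0 power_mono) (use True x2 B0 in \<open>auto simp: B_def numeral_2_eq_2\<close>)
    also have "\<dots> \<le> W\<^sup>2 * (4 * (A + 2) ^ 6)"
    proof (rule mult_left_mono)
      have "(A + 2)\<^sup>2 \<le> (A + 2) ^ 6"
        by (rule power_increasing) (use A0 in auto)
      then show "(A + 2)\<^sup>2 \<le> 4 * (A + 2) ^ 6"
        by (smt (verit) zero_le_power2)
    qed simp
    also have "\<dots> \<le> W\<^sup>2 * (4 * (A + 2) ^ 6) / \<eta> ^ 3"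
      using \<eta> A0 by (simp add: le_divide_eq mult_left_le power_le_one)
    finally show ?thesis
      by (simp add: S_def B_def mult_ac)
  next
    case False
    with n obtain m where m: "n = m + 2"
      by (metis One_nat_def Suc_1 add.commute le_add_diff_inverse le_antisym not_less_eq_eq)
    define Q where "Q y k = Im (cnj (y k) * y (k + 1))" for y :: "nat \<Rightarrow> complex" and k
    have step: "Q y (k + 1) = Q y k + \<eta> * (cmod (y (k + 1)))\<^sup>2"
      if "y (k + 2) = a j * y (k + 1) - y k" for y k j
    proof -
      have y: "y (Suc (Suc k)) = a j * y (Suc k) - y k"
        using that by simp
      have "Im (cnj v * (a j * v - v')) = Im (cnj v' * v) + \<eta> * (cmod v)\<^sup>2" for v v'
        unfolding cmod_power2 by (simp add: Ima power2_eq_square algebra_simps)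
      then show ?thesis
        by (simp add: Q_def y)
    qed
    have Qx: "0 \<le> Q x k" for k
    proof (induction k)
      case 0
      then show ?case using x0 by (auto simp: Q_def)
    next
      case (Suc k)
      then show ?case using step[OF x, of k] \<eta> by simp
    qed
    have Qw: "Q w (k + 2) = Q w (k + 1) + \<eta> * (cmod (w (k + 2)))\<^sup>2" for k
      using step[of w "k + 1" "k + 2"] w[of k] by (simp add: numeral_3_eq_3)
    have Qw_sum: "Q w (k + n) - Q w n = \<eta> * (\<Sum>j\<in>{n<..k + n}. (cmod (w j))\<^sup>2)" for k
    proof (induction k)
      case (Suc k)
      have "{n<..Suc k + n} = insert (Suc k + n) {n<..k + n}" by auto
      then show ?case
        using Suc Qw[of "k + m + 1"] by (simp add: m algebra_simps)
    qed simp
    have Qlim: "(\<lambda>k. Q w (k + n) - Q w n) \<longlonglongrightarrow> - Q w n"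
    proof -
      have "(\<lambda>k. w (k + n)) \<longlonglongrightarrow> 0" "(\<lambda>k. w (k + n + 1)) \<longlonglongrightarrow> 0"
        using LIMSEQ_ignore_initial_segment[OF w0, of n] LIMSEQ_ignore_initial_segment[OF w0, of "n + 1"]
        by (simp_all add: add_ac)
      then have "(\<lambda>k. Q w (k + n) - Q w n) \<longlonglongrightarrow> Im (cnj 0 * 0) - Q w n"
        unfolding Q_def by (intro tendsto_intros)
      then show ?thesis by simp
    qed
    \<comment> \<open>The current of \<open>w\<close> tends to 0 together with \<open>w\<close>. Its
      total growth beyond n, which is \<eta> times the tail mass, is therefore
      \<open>- Q w n\<close>.\<close>
    have S: "\<eta> * S \<le> - Q w n"
    proof (rule LIMSEQ_le_const[OF Qlim])
      obtain M where M: "F \<subseteq> {..M}"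
        using F(1) by (metis finite_nat_iff_bounded_le)
      have "\<eta> * S \<le> Q w (k + n) - Q w n" if "k \<ge> M" for k
        unfolding Qw_sum S_def
        by (intro mult_left_mono sum_mono2) (use F M that \<eta> in force)+
      then show "\<exists>N. \<forall>k\<ge>N. \<eta> * S \<le> Q w (k + n) - Q w n" by blast
    qed
    \<comment> \<open>The Wronskian. It is constant only from index 1 on, since the recurrence for
      \<open>w\<close> is not assumed around index 1.\<close>
    define D where "D k = w k * x (k + 1) - w (k + 1) * x k" for k
    have Dk: "D (k + 1) = D 1" for k
    proof (induction k)
      case (Suc k)
      have "D (k + 2) = D (k + 1)"
      proof -
        have x': "x (k + 3) = a (k + 2) * x (k + 2) - x (k + 1)"
          using x[of "k + 1"] by (simp add: numeral_3_eq_3)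
        have "w (k + 2) * x (k + 3) - w (k + 3) * x (k + 2) = w (k + 1) * x (k + 2) - w (k + 2) * x (k + 1)"
          unfolding w x' by (simp add: algebra_simps)
        then show ?thesis by (simp add: D_def numeral_3_eq_3)
      qed
      then show ?case using Suc by simp
    qed simp
    have "cmod (D 1) \<le> cmod (w 1) * cmod (x 2) + cmod (w 2) * cmod (x 1)"
      unfolding D_def by (metis norm_mult norm_triangle_ineq4 one_add_one)
    also have "\<dots> \<le> W * cmod (x 2) + W * cmod (x 1)"
      by (intro add_mono mult_right_mono W1) auto
    also have "\<dots> \<le> W * (A + 2)"
      using mult_left_mono[OF x2(2) W(2)] by (simp add: algebra_simps)
    finally have D: "cmod (D n) \<le> W * (A + 2)"
      using Dk[of "m + 1"] by (simp add: m)
    \<comment> \<open>The last two steps of the current contribute \<eta> times the sum of |x|^2 at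
      n and n - 1. The factor \<open>(A + 1)^2\<close> compares these two values with those at n and
      n + 1, and the 2 comes from squaring a sum.\<close>
    define c where "c = \<eta> / (2 * (A + 1)\<^sup>2)"
    have c0: "0 < c" using \<eta> A0 by (simp add: c_def)
    have QB: "c * B\<^sup>2 \<le> Q x n"
    proof -
      have "cmod (x (m + 3)) \<le> A * cmod (x (m + 2)) + cmod (x (m + 1))"
      proof -
        have "cmod (x (m + 3)) \<le> cmod (a (m + 2)) * cmod (x (m + 2)) + cmod (x (m + 1))"
          using x[of "m + 1"] norm_triangle_ineq4[of "a (m + 2) * x (m + 2)" "x (m + 1)"]
          by (simp add: numeral_3_eq_3 norm_mult)
        also have "\<dots> \<le> A * cmod (x (m + 2)) + cmod (x (m + 1))"
          by (intro add_right_mono mult_right_mono A) auto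
        finally show ?thesis .
      qed
      then have "B \<le> (A + 1) * (cmod (x (m + 2)) + cmod (x (m + 1)))"
        using A0 by (simp add: B_def m numeral_3_eq_3 algebra_simps)
          (smt (verit) mult_nonneg_nonneg norm_ge_zero)
      then have "B\<^sup>2 \<le> (A + 1)\<^sup>2 * (cmod (x (m + 2)) + cmod (x (m + 1)))\<^sup>2"
        using B0 power_mono by (fastforce simp flip: power_mult_distrib)
      also have "\<dots> \<le> (A + 1)\<^sup>2 * (2 * ((cmod (x (m + 2)))\<^sup>2 + (cmod (x (m + 1)))\<^sup>2))"
        by (intro mult_left_mono zero_le_power2) (use sum_squares_bound[of "cmod (x (m + 2))" "cmod (x (m + 1))"] in
            \<open>simp add: power2_sum\<close>)
      finally have "c * B\<^sup>2 \<le> c * ((A + 1)\<^sup>2 * (2 * ((cmod (x (m + 2)))\<^sup>2 + (cmod (x (m + 1)))\<^sup>2)))"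
        using c0 by simp
      also have "\<dots> = \<eta> * ((cmod (x (m + 2)))\<^sup>2 + (cmod (x (m + 1)))\<^sup>2)"
        using A0 by (simp add: c_def)
      also have "\<dots> \<le> Q x n"
        using step[OF x, of "m + 1"] step[OF x, of m] Qx[of m] by (simp add: m algebra_simps)
      finally show ?thesis .
    qed
    have Qwn: "Q w n \<le> 0"
      using S S0 \<eta> by (smt (verit) mult_nonneg_nonneg)
    \<comment> \<open>Multiplying the Wronskian by \<open>cnj (x n) * cnj (w n)\<close>, or by the
      analogous product at n + 1, splits its imaginary part into the two currents with weights |w|^2
      and |x|^2. The sign of \<open>Q w n\<close> makes both contributions nonnegative, so one
      factor \<open>B * cmod v\<close> cancels.\<close>
    have small: "c * B * cmod v \<le> cmod (D n)"
      if "Q x n * (cmod v)\<^sup>2 - Q w n * (cmod y)\<^sup>2 \<le> cmod y * cmod v * cmod (D n)" "cmod y \<le> B" for v y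
    proof (cases "v = 0 \<or> B = 0")
      case False
      then have pos: "0 < B * cmod v" using B0 by simp
      have "(c * B * cmod v) * (B * cmod v) = c * B\<^sup>2 * (cmod v)\<^sup>2"
        by (simp add: power2_eq_square)
      also have "\<dots> \<le> Q x n * (cmod v)\<^sup>2 - Q w n * (cmod y)\<^sup>2"
        using mult_right_mono[OF QB, of "(cmod v)\<^sup>2"] mult_nonneg_nonneg[of "- Q w n" "(cmod y)\<^sup>2"] Qwn by simp
      also have "\<dots> \<le> cmod y * cmod v * cmod (D n)" by (rule that)
      also have "\<dots> \<le> cmod (D n) * (B * cmod v)"
        using mult_right_mono[OF that(2), of "cmod v * cmod (D n)"] by (simp add: mult_ac)
      finally show ?thesis
        using pos by (rule mult_right_le_imp_le)
    qed auto
    have s1: "c * B * cmod (w n) \<le> cmod (D n)"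
    proof (rule small)
      have "Q x n * (cmod (w n))\<^sup>2 - Q w n * (cmod (x n))\<^sup>2 = Im (cnj (x n) * cnj (w n) * D n)"
        unfolding Q_def D_def cmod_power2 by (simp add: power2_eq_square algebra_simps)
      also have "\<dots> \<le> cmod (cnj (x n) * cnj (w n) * D n)"
        by (rule order_trans[OF abs_ge_self abs_Im_le_cmod])
      finally show "Q x n * (cmod (w n))\<^sup>2 - Q w n * (cmod (x n))\<^sup>2 \<le> cmod (x n) * cmod (w n) * cmod (D n)"
        by (simp add: norm_mult)
    qed (simp add: B_def)
    have s2: "c * B * cmod (w (n + 1)) \<le> cmod (D n)"
    proof (rule small)
      have "Q x n * (cmod (w (n + 1)))\<^sup>2 - Q w n * (cmod (x (n + 1)))\<^sup>2
          = Im (x (n + 1) * w (n + 1) * cnj (- D n))"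
        unfolding Q_def D_def cmod_power2 by (simp add: power2_eq_square algebra_simps)
      also have "\<dots> \<le> cmod (x (n + 1) * w (n + 1) * cnj (- D n))"
        by (rule order_trans[OF abs_ge_self abs_Im_le_cmod])
      finally show "Q x n * (cmod (w (n + 1)))\<^sup>2 - Q w n * (cmod (x (n + 1)))\<^sup>2
          \<le> cmod (x (n + 1)) * cmod (w (n + 1)) * cmod (D n)"
        by (simp add: norm_mult)
    qed (simp add: B_def)
    have "\<eta> * S \<le> cmod (w n) * cmod (w (n + 1))"
    proof -
      have "- Q w n \<le> cmod (cnj (w n) * w (n + 1))"
        unfolding Q_def using abs_Im_le_cmod by (metis abs_ge_minus_self order_trans)
      with S show ?thesis by (simp add: norm_mult)
    qed
    then have "(c * B)\<^sup>2 * (\<eta> * S) \<le> (c * B)\<^sup>2 * (cmod (w n) * cmod (w (n + 1)))"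
      by (rule mult_left_mono) simp
    also have "\<dots> = (c * B * cmod (w n)) * (c * B * cmod (w (n + 1)))"
      by (simp add: power2_eq_square)
    also have "\<dots> \<le> cmod (D n) * cmod (D n)"
      by (intro mult_mono s1 s2) (use c0 B0 in auto)
    also have "\<dots> \<le> (W * (A + 2)) * (W * (A + 2))"
      by (intro mult_mono D) (use A0 W in auto)
    finally have "S * B\<^sup>2 * (c\<^sup>2 * \<eta>) \<le> W\<^sup>2 * (A + 2)\<^sup>2"
      by (simp add: power2_eq_square mult_ac)
    moreover have "0 < c\<^sup>2 * \<eta>" using c0 \<eta> by simp
    \<comment> \<open>As \<open>c\<close> is proportional to \<eta>, the divisor is of order
      \<eta>^3; this is the cube in the statement.\<close>
    ultimately have "S * B\<^sup>2 \<le> W\<^sup>2 * (A + 2)\<^sup>2 / (c\<^sup>2 * \<eta>)"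
      by (simp add: le_divide_eq)
    also have "\<dots> = 4 * ((A + 2)\<^sup>2 * (A + 1) ^ 4) * W\<^sup>2 / \<eta> ^ 3"
      using \<eta> A0 by (simp add: c_def field_simps power2_eq_square power3_eq_cube power4_eq_xxxx)
    also have "\<dots> \<le> 4 * (A + 2) ^ 6 * W\<^sup>2 / \<eta> ^ 3"
    proof -
      have "(A + 2)\<^sup>2 * (A + 1) ^ 4 \<le> (A + 2)\<^sup>2 * (A + 2) ^ 4"
        by (intro mult_left_mono power_mono) (use A0 in auto)
      then have "(A + 2)\<^sup>2 * (A + 1) ^ 4 \<le> (A + 2) ^ 6"
        by (simp flip: power_add)
      then show ?thesis
        using \<eta> by (intro divide_right_mono mult_right_mono mult_left_mono) auto
    qed
    finally show ?thesis
      by (simp add: S_def B_def)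
  qed
qed

section \<open>Transfer matrices and their columns\<close>

lemma transfer_mult:
  "(transfer V m z *v c) $ 1 = (z - complex_of_real (V m)) * c $ 1 - c $ 2"
  "(transfer V m z *v c) $ 2 = c $ 1"
  by (simp_all add: transfer_def matrix_vector_mult_def sum_2)

text \<open>The determinant is 1. \<open>matrix_inv\<close> is a choice operator, so the candidate
  must also be shown to be the only two-sided inverse.\<close>

lemma matrix_inv_transfer:
  "matrix_inv (transfer V m z) = vector [vector [0, 1], vector [-1, z - complex_of_real (V m)]]"
proof -
  define B :: "complex^2^2" where "B = vector [vector [0, 1], vector [-1, z - complex_of_real (V m)]]"
  have "transfer V m z ** B = mat 1" "B ** transfer V m z = mat 1"
    by (simp_all add: B_def transfer_def vec_eq_iff forall_2 matrix_matrix_mult_def sum_2 mat_def)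
  then have "matrix_inv (transfer V m z) = B"
    unfolding matrix_inv_def
    by (intro some_equality conjI) (metis matrix_mul_assoc matrix_mul_lid matrix_mul_rid)+
  then show ?thesis by (simp add: B_def)
qed

lemma matrix_inv_transfer_mult:
  "(matrix_inv (transfer V m z) *v c) $ 1 = c $ 2"
  "(matrix_inv (transfer V m z) *v c) $ 2 = - c $ 1 + (z - complex_of_real (V m)) * c $ 2"
  by (simp_all add: matrix_inv_transfer matrix_vector_mult_def sum_2)

lemma bounded_linear_matrix_vector_mult: "bounded_linear (\<lambda>v. (M::complex^2^2) *v v)"
proof (rule linear_conv_bounded_linear[THEN iffD1], rule linearI)
  show "M *v (r *\<^sub>R v) = r *\<^sub>R (M *v v)" for r v
    by (simp add: vec_eq_iff matrix_vector_mult_def scaleR_sum_right)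
qed (rule matrix_vector_right_distrib)

lemma norm_nth: "norm (v $ i) \<le> norm v" for v :: "complex^'n"
  unfolding norm_vec_def by (rule member_le_L2_set) auto

lemma norm_le_sum_2: "norm (v :: complex^2) \<le> cmod (v $ 1) + cmod (v $ 2)"
  using L2_set_le_sum[of UNIV "\<lambda>i. cmod (v $ i)"] by (simp add: norm_vec_def sum_2)

text \<open>The columns of a transfer matrix are the two fundamental solutions, so estimates for
  scalar solutions become estimates for the operator norm.\<close>

lemma matrix_norm_le_columns:
  "matrix_norm M \<le> (cmod ((M *v axis 1 1) $ 1) + cmod ((M *v axis 1 1) $ 2))
    + (cmod ((M *v axis 2 1) $ 1) + cmod ((M *v axis 2 1) $ 2))"
  unfolding matrix_norm_def
proof (rule onorm_le)
  fix v :: "complex^2"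
  have col: "(M *v axis j 1) $ i = M $ i $ j" for i j
    by (simp add: matrix_vector_mult_def axis_def if_distrib cong: if_cong)
  have comp: "cmod ((M *v v) $ i) \<le> (cmod (M $ i $ 1) + cmod (M $ i $ 2)) * norm v" for i
  proof -
    have "cmod ((M *v v) $ i) \<le> cmod (M $ i $ 1) * cmod (v $ 1) + cmod (M $ i $ 2) * cmod (v $ 2)"
      unfolding matrix_vector_mult_def using norm_triangle_ineq by (auto simp: sum_2 norm_mult[symmetric])
    also have "\<dots> \<le> cmod (M $ i $ 1) * norm v + cmod (M $ i $ 2) * norm v"
      by (intro add_mono mult_left_mono norm_nth) auto
    finally show ?thesis by (simp add: algebra_simps)
  qed
  have "norm (M *v v) \<le> cmod ((M *v v) $ 1) + cmod ((M *v v) $ 2)"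
    by (rule norm_le_sum_2)
  also have "\<dots> \<le> (cmod (M $ 1 $ 1) + cmod (M $ 1 $ 2)) * norm v + (cmod (M $ 2 $ 1) + cmod (M $ 2 $ 2)) * norm v"
    by (intro add_mono comp)
  finally show "norm (M *v v) \<le> (cmod ((M *v axis 1 1) $ 1) + cmod ((M *v axis 1 1) $ 2)
    + (cmod ((M *v axis 2 1) $ 1) + cmod ((M *v axis 2 1) $ 2))) * norm v"
    unfolding col by (simp add: algebra_simps)
qed

lemma matrix_norm_nonneg: "0 \<le> matrix_norm M"
  unfolding matrix_norm_def by (rule onorm_pos_le[OF bounded_linear_matrix_vector_mult])

text \<open>The factor 4 is 2 from squaring a sum times 2 for the number of columns; it turns the
  constant 4 for scalar solutions into the 16 for \<open>Phi\<close>.\<close>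

lemma columns_bound:
  assumes "0 \<le> S" and "S * (cmod ((M *v axis 1 1) $ 1) + cmod ((M *v axis 1 1) $ 2))\<^sup>2 \<le> b"
    and "S * (cmod ((M *v axis 2 1) $ 1) + cmod ((M *v axis 2 1) $ 2))\<^sup>2 \<le> b"
  shows "S * (matrix_norm M)\<^sup>2 \<le> 4 * b"
proof -
  let ?p = "cmod ((M *v axis 1 1) $ 1) + cmod ((M *v axis 1 1) $ 2)"
  let ?q = "cmod ((M *v axis 2 1) $ 1) + cmod ((M *v axis 2 1) $ 2)"
  have "(matrix_norm M)\<^sup>2 \<le> (?p + ?q)\<^sup>2"
    by (intro power_mono matrix_norm_le_columns matrix_norm_nonneg)
  also have "\<dots> \<le> 2 * ?p\<^sup>2 + 2 * ?q\<^sup>2"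
    using sum_squares_bound[of ?p ?q] by (simp add: power2_sum)
  finally have "S * (matrix_norm M)\<^sup>2 \<le> S * (2 * ?p\<^sup>2 + 2 * ?q\<^sup>2)"
    using assms(1) by (rule mult_left_mono)
  also have "\<dots> = 2 * (S * ?p\<^sup>2) + 2 * (S * ?q\<^sup>2)"
    by (simp add: algebra_simps)
  also have "\<dots> \<le> 4 * b"
    using assms by linarith
  finally show ?thesis .
qed

lemma ell2_tendsto_0:
  fixes f :: "nat \<Rightarrow> 'a"
  assumes "inj f"
  shows "(\<lambda>k. ell2_apply u (f k)) \<longlonglongrightarrow> 0"
proof -
  have "(\<lambda>n. (cmod (ell2_apply u n))\<^sup>2) summable_on range f"
    by (rule ell2_summable_on)
  then have "(\<lambda>k. (cmod (ell2_apply u (f k)))\<^sup>2) summable_on UNIV"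
    by (subst (asm) summable_on_reindex[OF assms]) (simp add: o_def)
  then have "summable (\<lambda>k. (cmod (ell2_apply u (f k)))\<^sup>2)"
    using summable_on_imp_summable by blast
  then have "(\<lambda>k. (cmod (ell2_apply u (f k)))\<^sup>2) \<longlonglongrightarrow> 0"
    by (rule summable_LIMSEQ_zero)
  then have "(\<lambda>k. sqrt ((cmod (ell2_apply u (f k)))\<^sup>2)) \<longlonglongrightarrow> sqrt 0"
    by (rule tendsto_real_sqrt)
  then show ?thesis
    by (simp add: tendsto_norm_zero_iff)
qed

lemma sum_inj_le_norm_ell2:
  assumes "inj f" "finite F"
  shows "(\<Sum>k\<in>F. (cmod (ell2_apply u (f k)))\<^sup>2) \<le> (norm u)\<^sup>2"
proof -
  have "(\<Sum>k\<in>F. (cmod (ell2_apply u (f k)))\<^sup>2) = (\<Sum>n\<in>f ` F. (cmod (ell2_apply u n))\<^sup>2)"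
    by (subst sum.reindex) (use assms inj_on_subset in auto)
  then show ?thesis
    using sum_le_norm_ell2[of "f ` F" u] assms by simp
qed

context bounded_potential
begin

lemma green_right_tail:
  assumes u: "blinfun_apply (H - scalarC z) u = delta 0"
    and z: "0 < Im z" "Im z \<le> 1" and A: "\<And>n. cmod (z - complex_of_real (V n)) \<le> A"
    and n: "1 \<le> n" and F: "finite F" "F \<subseteq> {int n<..}"
  shows "(\<Sum>k\<in>F. (cmod (ell2_apply u k))\<^sup>2) * (matrix_norm (Phi V (int n) z))\<^sup>2
    \<le> 16 * (A + 2) ^ 6 * (norm u)\<^sup>2 / (Im z) ^ 3"
proof -
  define w where "w k = ell2_apply u (int k)" for k
  define a where "a k = z - complex_of_real (V (int k))" for k
  have eq: "ell2_apply u (k + 1) + ell2_apply u (k - 1) + (complex_of_real (V k) - z) * ell2_apply u k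
      = (if k = 0 then 1 else 0)" for k
    using arg_cong[OF u, of "\<lambda>u. ell2_apply u k"] by (simp only: H_minus_apply) (simp add: delta.rep_eq)
  have w: "w (k + 3) = a (k + 2) * w (k + 2) - w (k + 1)" for k
    using eq[of "int (k + 2)"] unfolding w_def a_def by (simp add: algebra_simps)
  have sumF: "(\<Sum>k\<in>F. (cmod (ell2_apply u k))\<^sup>2) = (\<Sum>k\<in>nat ` F. (cmod (w k))\<^sup>2)"
  proof -
    have "inj_on nat F" using F by (force intro!: inj_onI)
    then show ?thesis
      using F by (subst sum.reindex) (auto intro!: sum.cong simp: w_def)
  qed
  have bound: "(\<Sum>k\<in>F. (cmod (ell2_apply u k))\<^sup>2) *
      (cmod ((transfer_right V n z *v axis i 1) $ 1) + cmod ((transfer_right V n z *v axis i 1) $ 2))\<^sup>2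
      \<le> 4 * (A + 2) ^ 6 * (norm u)\<^sup>2 / (Im z) ^ 3" for i :: 2
  proof -
    \<comment> \<open>The column after k steps is the pair \<open>(x (k + 1), x k)\<close>, the
      usual solution vector.\<close>
    define x where "x k = (transfer_right V k z *v axis i 1) $ 2" for k
    have x1: "x (Suc k) = (transfer_right V k z *v axis i 1) $ 1" for k
      by (simp add: x_def matrix_vector_mul_assoc[symmetric] transfer_mult)
    have x: "x (k + 2) = a (k + 1) * x (k + 1) - x k" for k
      using x1[of "Suc k"] x1[of k]
      by (simp add: a_def matrix_vector_mul_assoc[symmetric] transfer_mult)
        (simp add: x_def add.commute)
    have x0: "x 0 = 0 \<and> x 1 = 1 \<or> x 0 = 1 \<and> x 1 = 0"
      using exhaust_2[of i] x1[of 0] by (auto simp: x_def axis_def)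
    have "(\<Sum>k\<in>nat ` F. (cmod (w k))\<^sup>2) * (cmod (x n) + cmod (x (n + 1)))\<^sup>2
        \<le> 4 * (A + 2) ^ 6 * (norm u)\<^sup>2 / (Im z) ^ 3"
      by (rule decaying_solution_tail[where a = a, OF _ z _ x x0 w])
        (use A F n in \<open>auto simp: a_def w_def intro!: ell2_tendsto_0 sum_inj_le_norm_ell2\<close>)
    then show ?thesis
      by (simp add: sumF x1) (simp add: x_def add.commute)
  qed
  show ?thesis
    using columns_bound[OF _ bound bound] by (simp add: Phi_def sum_nonneg)
qed

text \<open>\<open>Phi V (- int n)\<close> is built from V 0, ..., V (1 - n) and not from V (-1),
  ..., V (-n), so it is not the right transfer matrix of the reflected potential. The numbering
  \<open>1 - int k\<close> fits instead. It gives the site -n the index n + 1, which is why -n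
  itself may belong to \<open>F\<close>.\<close>

lemma green_left_tail:
  assumes u: "blinfun_apply (H - scalarC z) u = delta 0"
    and z: "0 < Im z" "Im z \<le> 1" and A: "\<And>n. cmod (z - complex_of_real (V n)) \<le> A"
    and n: "1 \<le> n" and F: "finite F" "F \<subseteq> {..- int n}"
  shows "(\<Sum>k\<in>F. (cmod (ell2_apply u k))\<^sup>2) * (matrix_norm (Phi V (- int n) z))\<^sup>2
    \<le> 16 * (A + 2) ^ 6 * (norm u)\<^sup>2 / (Im z) ^ 3"
proof -
  define w where "w k = ell2_apply u (1 - int k)" for k
  define a where "a k = z - complex_of_real (V (1 - int k))" for k
  have eq: "ell2_apply u (k + 1) + ell2_apply u (k - 1) + (complex_of_real (V k) - z) * ell2_apply u k
      = (if k = 0 then 1 else 0)" for k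
    using arg_cong[OF u, of "\<lambda>u. ell2_apply u k"] by (simp only: H_minus_apply) (simp add: delta.rep_eq)
  \<comment> \<open>The source at site 0 sits in the equation centred at index 1; the homogeneous
    recurrence starts just after it.\<close>
  have w: "w (k + 3) = a (k + 2) * w (k + 2) - w (k + 1)" for k
    using eq[of "1 - int (k + 2)"] unfolding w_def a_def by (simp add: algebra_simps)
  have inj: "inj (\<lambda>k. 1 - int k)" by (simp add: inj_def)
  have sumF: "(\<Sum>k\<in>F. (cmod (ell2_apply u k))\<^sup>2) = (\<Sum>k\<in>(\<lambda>k. nat (1 - k)) ` F. (cmod (w k))\<^sup>2)"
  proof -
    have "inj_on (\<lambda>k. nat (1 - k)) F" using F by (force intro!: inj_onI)
    then show ?thesis
      using F by (subst sum.reindex) (auto intro!: sum.cong simp: w_def)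
  qed
  have bound: "(\<Sum>k\<in>F. (cmod (ell2_apply u k))\<^sup>2) *
      (cmod ((transfer_left V n z *v axis i 1) $ 1) + cmod ((transfer_left V n z *v axis i 1) $ 2))\<^sup>2
      \<le> 4 * (A + 2) ^ 6 * (norm u)\<^sup>2 / (Im z) ^ 3" for i :: 2
  proof -
    define x where "x k = (transfer_left V k z *v axis i 1) $ 1" for k
    have x1: "x (Suc k) = (transfer_left V k z *v axis i 1) $ 2" for k
      by (simp add: x_def matrix_vector_mul_assoc[symmetric] matrix_inv_transfer_mult)
    have x: "x (k + 2) = a (k + 1) * x (k + 1) - x k" for k
      using x1[of "Suc k"] x1[of k]
      by (simp add: a_def matrix_vector_mul_assoc[symmetric] matrix_inv_transfer_mult)
        (simp add: x_def)
    have x0: "x 0 = 0 \<and> x 1 = 1 \<or> x 0 = 1 \<and> x 1 = 0"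
      using exhaust_2[of i] x1[of 0] by (auto simp: x_def axis_def)
    have "(\<Sum>k\<in>(\<lambda>k. nat (1 - k)) ` F. (cmod (w k))\<^sup>2) * (cmod (x n) + cmod (x (n + 1)))\<^sup>2
        \<le> 4 * (A + 2) ^ 6 * (norm u)\<^sup>2 / (Im z) ^ 3"
      by (rule decaying_solution_tail[where a = a, OF _ z _ x x0 w])
        (use A F n in \<open>auto simp: a_def w_def intro!: ell2_tendsto_0 sum_inj_le_norm_ell2 inj\<close>)
    then show ?thesis
      by (simp add: sumF x1) (simp add: x_def)
  qed
  show ?thesis
    using columns_bound[OF _ bound bound] n by (simp add: Phi_def sum_nonneg)
qed

end

section \<open>The contour integral representation of the evolution\<close>

abbreviation rect :: "real \<Rightarrow> real \<Rightarrow> real \<Rightarrow> real \<Rightarrow> real \<Rightarrow> complex" where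
  "rect a b c d \<equiv> rectpath (Complex a c) (Complex b d)"

lemma contour_integral_rect:
  assumes "continuous_on (path_image (rect a b c d)) f"
  shows "contour_integral (rect a b c d) f =
    contour_integral (linepath (Complex a c) (Complex b c)) f
    + contour_integral (linepath (Complex b c) (Complex b d)) f
    + contour_integral (linepath (Complex b d) (Complex a d)) f
    + contour_integral (linepath (Complex a d) (Complex a c)) f"
proof -
  have "f contour_integrable_on linepath p q" if "closed_segment p q \<subseteq> path_image (rect a b c d)" for p q
    by (rule contour_integrable_continuous_linepath) (rule continuous_on_subset[OF assms that])
  then show ?thesis
    by (simp add: rectpath_def Let_def path_image_join contour_integral_join contour_integrable_join le_supI1 le_supI2)
qed

lemma rect_integral_bound:
  assumes f: "continuous_on (path_image (rect a b c d)) f"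
    and B: "\<And>z. z \<in> path_image (rect a b c d) \<Longrightarrow> cmod (f z) \<le> B" and ab: "a \<le> b" "c \<le> d"
  shows "cmod (contour_integral (rect a b c d) f) \<le> B * (2 * (b - a) + 2 * (d - c))"
proof -
  let ?I = "\<lambda>p q. contour_integral (linepath p q) f"
  have B0: "0 \<le> B"
  proof -
    have "Complex a c \<in> path_image (rect a b c d)"
      using pathstart_in_path_image[of "rect a b c d"] by simp
    then show ?thesis
      using B[of "Complex a c"] by (metis norm_ge_zero order_trans)
  qed
  have *: "cmod (?I p q) \<le> B * cmod (q - p)" if "closed_segment p q \<subseteq> path_image (rect a b c d)" for p q
    using that B B0 continuous_on_subset[OF f that]
    by (intro contour_integral_bound_linepath contour_integrable_continuous_linepath) auto
  have len: "cmod (Complex b c - Complex a c) = b - a" "cmod (Complex b d - Complex b c) = d - c"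
    "cmod (Complex a d - Complex b d) = b - a" "cmod (Complex a c - Complex a d) = d - c"
    using ab by (simp_all add: cmod_def)
  have sub: "closed_segment (Complex a c) (Complex b c) \<subseteq> path_image (rect a b c d)"
    "closed_segment (Complex b c) (Complex b d) \<subseteq> path_image (rect a b c d)"
    "closed_segment (Complex b d) (Complex a d) \<subseteq> path_image (rect a b c d)"
    "closed_segment (Complex a d) (Complex a c) \<subseteq> path_image (rect a b c d)"
    by (auto simp: rectpath_def Let_def path_image_join)
  note I = sub[THEN *, unfolded len]
  have "cmod (contour_integral (rect a b c d) f) \<le> cmod (?I (Complex a c) (Complex b c))
      + cmod (?I (Complex b c) (Complex b d)) + cmod (?I (Complex b d) (Complex a d)) + cmod (?I (Complex a d) (Complex a c))"
    unfolding contour_integral_rect[OF f] by (intro norm_triangle_mono order_refl)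
  also have "\<dots> \<le> B * (b - a) + B * (d - c) + B * (b - a) + B * (d - c)"
    by (intro add_mono I)
  finally show ?thesis
    by (simp add: algebra_simps)
qed

text \<open>Two rectangles are joined from four sides in the same pattern, so a pointwise relation
  between them can be checked side by side.\<close>

lemma joinpaths_related:
  assumes "\<And>s. s \<in> {0..1} \<Longrightarrow> P (g1 s) (h1 s)" "\<And>s. s \<in> {0..1} \<Longrightarrow> P (g2 s) (h2 s)" "t \<in> {0..1}"
  shows "P ((g1 +++ g2) t) ((h1 +++ h2) t)"
  using assms by (auto simp: joinpaths_def)

text \<open>Linear homotopy: corresponding sides lie in a common open half-plane that misses the
  real interval, and half-planes are convex.\<close>

lemma rect_homotopic:
  assumes "a < lo" "a' < lo" "hi < b" "hi < b'" "c < 0" "c' < 0" "0 < d" "0 < d'"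
  shows "homotopic_loops (- complex_of_real ` {lo..hi}) (rect a b c d) (rect a' b' c' d')"
proof (rule homotopic_loops_linear)
  fix t :: real assume t: "t \<in> {0..1}"
  have seg: "closed_segment (linepath p q s) (linepath p' q' s) \<subseteq> - complex_of_real ` {lo..hi}"
    if "convex T" "{p, q, p', q'} \<subseteq> T" "T \<subseteq> - complex_of_real ` {lo..hi}" "s \<in> {0..1}" for p q p' q' T s
  proof -
    have "linepath p q s \<in> T" "linepath p' q' s \<in> T"
      using that closed_segment_subset[of _ T] linepath_in_path[of s] by blast+
    then show ?thesis
      using closed_segment_subset[of _ T] that by blast
  qed
  show "closed_segment (rect a b c d t) (rect a' b' c' d' t) \<subseteq> - complex_of_real ` {lo..hi}"
    unfolding rectpath_def Let_def complex.sel
  proof (intro joinpaths_related[where P = "\<lambda>u v. closed_segment u v \<subseteq> - complex_of_real ` {lo..hi}"] t)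
    fix s :: real assume "s \<in> {0..1}"
    then show "closed_segment (linepath (Complex a c) (Complex b c) s) (linepath (Complex a' c') (Complex b' c') s)
        \<subseteq> - complex_of_real ` {lo..hi}"
      by (intro seg[OF convex_halfspace_Im_lt[of 0]]) (use assms in auto)
  next
    fix s :: real assume "s \<in> {0..1}"
    then show "closed_segment (linepath (Complex b c) (Complex b d) s) (linepath (Complex b' c') (Complex b' d') s)
        \<subseteq> - complex_of_real ` {lo..hi}"
      by (intro seg[OF convex_halfspace_Re_gt[of hi]]) (use assms in auto)
  next
    fix s :: real assume "s \<in> {0..1}"
    then show "closed_segment (linepath (Complex b d) (Complex a d) s) (linepath (Complex b' d') (Complex a' d') s)
        \<subseteq> - complex_of_real ` {lo..hi}"
      by (intro seg[OF convex_halfspace_Im_gt[of 0]]) (use assms in auto)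
  next
    fix s :: real assume "s \<in> {0..1}"
    then show "closed_segment (linepath (Complex a d) (Complex a c) s) (linepath (Complex a' d') (Complex a' c') s)
        \<subseteq> - complex_of_real ` {lo..hi}"
      by (intro seg[OF convex_halfspace_Re_lt[of lo]]) (use assms in auto)
  qed
qed auto

section \<open>The resolvent vector and its contour moments\<close>

locale spectral_interval = bounded_potential +
  fixes K :: real
  assumes K_gt_1: "1 < K"
    and spectrum_subset: "spectrum (schroedinger V) \<subseteq> complex_of_real ` {- K + 1..K - 1}"
begin

text \<open>Complement of the enclosing interval instead of the spectrum: openness is immediate and
  the geometry needed for homotopies is explicit.\<close>

abbreviation off_spectrum :: "complex set" where
  "off_spectrum \<equiv> - complex_of_real ` {- K + 1..K - 1}"

text \<open>On \<open>off_spectrum\<close> the operator \<open>H - z\<close> is bijective, so the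
  choice is the resolvent applied to \<open>delta 0\<close>; elsewhere nothing is claimed.\<close>

definition green :: "complex \<Rightarrow> int ell2" where
  "green z = (SOME u. blinfun_apply (H - scalarC z) u = delta 0)"

lemma open_off_spectrum: "open off_spectrum"
  by (intro open_Compl compact_imp_closed compact_continuous_image continuous_intros compact_Icc)

lemma resolvent_exists:
  assumes "z \<in> off_spectrum"
  obtains B where "\<And>u. blinfun_apply B (blinfun_apply (H - scalarC z) u) = u"
    "\<And>u. blinfun_apply (H - scalarC z) (blinfun_apply B u) = u"
proof -
  have "z \<notin> spectrum H"
    using assms spectrum_subset by blast
  then obtain B where "B o\<^sub>L (H - scalarC z) = id_blinfun" "(H - scalarC z) o\<^sub>L B = id_blinfun"
    by (auto simp: spectrum_def)
  then show thesis
    by (intro that[of B]) (metis blinfun_apply_blinfun_compose blinfun_apply_id_blinfun)+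
qed

lemma resolvent_lower_bound:
  assumes "z \<in> off_spectrum"
  obtains \<kappa> where "0 < \<kappa>" "\<And>u. \<kappa> * norm u \<le> norm (blinfun_apply (H - scalarC z) u)"
proof -
  obtain B where B: "\<And>u. blinfun_apply B (blinfun_apply (H - scalarC z) u) = u"
    using resolvent_exists[OF assms] by blast
  have "(1 / (norm B + 1)) * norm u \<le> norm (blinfun_apply (H - scalarC z) u)" for u
  proof -
    have "norm u \<le> norm B * norm (blinfun_apply (H - scalarC z) u)"
      using norm_blinfun[of B "blinfun_apply (H - scalarC z) u"] by (simp only: B)
    also have "\<dots> \<le> (norm B + 1) * norm (blinfun_apply (H - scalarC z) u)"
      by (intro mult_right_mono) auto
    finally show ?thesis
      by (simp add: divide_le_eq add_nonneg_pos mult.commute)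
  qed
  then show thesis
    by (intro that[of "1 / (norm B + 1)"]) (auto simp: add_nonneg_pos)
qed

lemma green: "z \<in> off_spectrum \<Longrightarrow> blinfun_apply (H - scalarC z) (green z) = delta 0"
  unfolding green_def by (rule someI_ex) (metis resolvent_exists)

lemma green_recurrence:
  assumes "z \<in> off_spectrum"
  shows "z * ell2_apply (green z) n = ell2_apply (green z) (n + 1) + ell2_apply (green z) (n - 1)
    + complex_of_real (V n) * ell2_apply (green z) n - (if n = 0 then 1 else 0)"
  using arg_cong[OF green[OF assms], of "\<lambda>u. ell2_apply u n"]
  by (simp only: H_minus_apply) (simp add: delta.rep_eq algebra_simps)

text \<open>By the resolvent identity the difference quotient at z0 is \<open>B (green z)\<close>
  with \<open>B\<close> the resolvent at z0. Differentiability thus reduces to continuity of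
  \<open>green\<close> at z0.\<close>

lemma green_holomorphic: "(\<lambda>z. ell2_apply (green z) n) holomorphic_on off_spectrum"
  unfolding holomorphic_on_def field_differentiable_def has_field_derivative_iff
proof (intro ballI)
  fix z0 assume z0: "z0 \<in> off_spectrum"
  obtain B where B: "\<And>u. blinfun_apply B (blinfun_apply (H - scalarC z0) u) = u"
    "\<And>u. blinfun_apply (H - scalarC z0) (blinfun_apply B u) = u"
    using resolvent_exists[OF z0] by blast
  define d where "d z = blinfun_apply B (green z)" for z
  have diff: "green z - green z0 = scaleC_ell2 (z - z0) (d z)" if z: "z \<in> off_spectrum" for z
  proof -
    have "blinfun_apply (H - scalarC z0) (green z - green z0)
        = (blinfun_apply (H - scalarC z) (green z) + scaleC_ell2 (z - z0) (green z)) - delta 0"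
      by (simp only: blinfun.diff_right green[OF z0])
        (rule ell2_eqI, simp add: H_minus_apply plus_ell2.rep_eq minus_ell2.rep_eq scaleC_ell2.rep_eq algebra_simps)
    also have "\<dots> = scaleC_ell2 (z - z0) (green z)"
      by (simp add: green[OF z])
    also have "\<dots> = blinfun_apply (H - scalarC z0) (scaleC_ell2 (z - z0) (d z))"
      by (simp add: H_minus_scaleC d_def B)
    finally show ?thesis
      by (metis B(1))
  qed
  have near: "\<forall>\<^sub>F z in at z0 within off_spectrum. z \<in> off_spectrum \<and> z \<noteq> z0 \<and> cmod (z - z0) * norm B < 1 / 2"
  proof (intro eventually_conj)
    have "((\<lambda>z. cmod (z - z0) * norm B) \<longlongrightarrow> cmod (z0 - z0) * norm B) (at z0 within off_spectrum)"
      by (intro tendsto_intros)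
    then show "\<forall>\<^sub>F z in at z0 within off_spectrum. cmod (z - z0) * norm B < 1 / 2"
      by (rule order_tendstoD(2)) simp
  qed (auto simp: eventually_at_filter)
  \<comment> \<open>For z this close to z0 the resolvent identity bounds
    \<open>norm (green z)\<close> by twice \<open>norm (green z0)\<close>, which removes the unknown
    from the right-hand side.\<close>
  have bound: "norm (green z - green z0) \<le> cmod (z - z0) * (norm B * (2 * norm (green z0)))"
    if z: "z \<in> off_spectrum" and small: "cmod (z - z0) * norm B < 1 / 2" for z
  proof -
    have 1: "norm (green z - green z0) \<le> cmod (z - z0) * (norm B * norm (green z))"
      unfolding diff[OF z] norm_scaleC_ell2 d_def by (intro mult_left_mono norm_blinfun) auto
    also have "\<dots> = (cmod (z - z0) * norm B) * norm (green z)"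
      by simp
    also have "\<dots> \<le> (1 / 2) * norm (green z)"
      by (rule mult_right_mono) (use small in auto)
    finally have "norm (green z) \<le> 2 * norm (green z0)"
      using norm_triangle_sub[of "green z" "green z0"] by linarith
    then show ?thesis
      using 1 by (smt (verit) mult_left_mono norm_ge_zero)
  qed
  have "((\<lambda>z. green z - green z0) \<longlongrightarrow> 0) (at z0 within off_spectrum)"
  proof (rule Lim_null_comparison)
    show "\<forall>\<^sub>F z in at z0 within off_spectrum.
        norm (green z - green z0) \<le> cmod (z - z0) * (norm B * (2 * norm (green z0)))"
      using near by eventually_elim (use bound in blast)
    have "((\<lambda>z. cmod (z - z0) * (norm B * (2 * norm (green z0))))
        \<longlongrightarrow> cmod (z0 - z0) * (norm B * (2 * norm (green z0)))) (at z0 within off_spectrum)"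
      by (intro tendsto_intros)
    then show "((\<lambda>z. cmod (z - z0) * (norm B * (2 * norm (green z0)))) \<longlongrightarrow> 0) (at z0 within off_spectrum)"
      by simp
  qed
  then have "(green \<longlongrightarrow> green z0) (at z0 within off_spectrum)"
    by (simp add: Lim_null[symmetric])
  then have "((\<lambda>z. ell2_apply (d z) n) \<longlongrightarrow> ell2_apply (d z0) n) (at z0 within off_spectrum)"
    unfolding d_def
    by (intro bounded_linear.tendsto[OF bounded_linear_ell2_apply] tendsto_intros)
  then have "((\<lambda>y. (ell2_apply (green y) n - ell2_apply (green z0) n) / (y - z0)) \<longlongrightarrow> ell2_apply (d z0) n)
      (at z0 within off_spectrum)"
  proof (rule Lim_transform_eventually)
    show "\<forall>\<^sub>F z in at z0 within off_spectrum.
        ell2_apply (d z) n = (ell2_apply (green z) n - ell2_apply (green z0) n) / (z - z0)"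
      using near
    proof eventually_elim
      case (elim z)
      then show ?case
        using arg_cong[OF diff[of z], of "\<lambda>u. ell2_apply u n"]
        by (simp add: minus_ell2.rep_eq scaleC_ell2.rep_eq)
    qed
  qed
  then show "\<exists>D. ((\<lambda>y. (ell2_apply (green y) n - ell2_apply (green z0) n) / (y - z0)) \<longlongrightarrow> D)
      (at z0 within off_spectrum)" ..
qed

lemma green_large:
  assumes "z \<in> off_spectrum" "norm H < cmod z"
  shows "norm (green z) \<le> 1 / (cmod z - norm H)"
proof -
  have "scaleC_ell2 z (green z) = blinfun_apply H (green z) - delta 0"
    by (rule ell2_eqI)
      (simp add: scaleC_ell2.rep_eq minus_ell2.rep_eq H_apply delta.rep_eq green_recurrence[OF assms(1)])
  then have "cmod z * norm (green z) \<le> norm H * norm (green z) + 1"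
    using norm_triangle_ineq4[of "blinfun_apply H (green z)" "delta 0"] norm_blinfun[of H "green z"]
    by (simp flip: norm_scaleC_ell2)
  then show ?thesis
    using assms(2) by (simp add: field_simps)
qed

lemma rect_off_spectrum:
  assumes "K \<le> r" "c < 0" "0 < d"
  shows "path_image (rect (- r) r c d) \<subseteq> off_spectrum"
  using assms K_gt_1 by (auto simp: path_image_rectpath)

lemma green_integrable:
  assumes "K \<le> r" "c < 0" "0 < d" "f holomorphic_on UNIV"
  shows "(\<lambda>z. f z * ell2_apply (green z) n) contour_integrable_on (rect (- r) r c d)"
  by (rule contour_integrable_holomorphic_simple[OF _ open_off_spectrum valid_path_rectpath
        rect_off_spectrum[OF assms(1-3)]])
    (intro holomorphic_intros green_holomorphic holomorphic_on_subset[OF assms(4)] subset_UNIV)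

text \<open>From \<open>z G = H G - delta 0\<close>, the function G is \<open>- delta 0 / z\<close>
  up to \<open>H G / z\<close>, which is of order r^-2 on a contour of length 8 r. The sign of the
  residue is that of (H - z)^-1, opposite to (z - H)^-1.\<close>

lemma green_integral_large_rect:
  assumes r: "K \<le> r" "norm H < r"
  shows "cmod (contour_integral (rect (- r) r (- r) r) (\<lambda>z. ell2_apply (green z) n)
      + 2 * pi * \<i> * ell2_apply (delta 0) n) \<le> 8 * norm H / (r - norm H)"
proof -
  let ?\<Gamma> = "rect (- r) r (- r) r"
  have r0: "0 < r" using r K_gt_1 by simp
  have \<Gamma>: "path_image ?\<Gamma> \<subseteq> off_spectrum" "\<And>z. z \<in> path_image ?\<Gamma> \<Longrightarrow> r \<le> cmod z"
  proof -
    show "path_image ?\<Gamma> \<subseteq> off_spectrum" by (rule rect_off_spectrum) (use r r0 in auto)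
    fix z assume "z \<in> path_image ?\<Gamma>"
    then have "\<bar>Re z\<bar> = r \<or> \<bar>Im z\<bar> = r" using r0 by (auto simp: path_image_rectpath)
    then show "r \<le> cmod z" using abs_Re_le_cmod[of z] abs_Im_le_cmod[of z] by auto
  qed
  define g where "g z = ell2_apply (blinfun_apply H (green z)) n / z" for z
  have g: "g z = ell2_apply (green z) n + ell2_apply (delta 0) n * (1 / (z - 0))"
    if "z \<in> path_image ?\<Gamma>" for z
  proof -
    have "z \<in> off_spectrum" "z \<noteq> 0" using that \<Gamma> r0 by force+
    then have "z * ell2_apply (green z) n = ell2_apply (blinfun_apply H (green z)) n - ell2_apply (delta 0) n"
      by (simp add: green_recurrence H_apply delta.rep_eq)
    with \<open>z \<noteq> 0\<close> show ?thesis
      by (simp add: g_def field_simps)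
  qed
  have 0: "0 \<notin> path_image ?\<Gamma>" using \<Gamma>(2)[of 0] r0 by force
  have "winding_number ?\<Gamma> 0 = 1"
    by (rule winding_number_rectpath) (use r0 in \<open>auto simp: in_box_complex_iff\<close>)
  then have 1: "((\<lambda>z. 1 / (z - 0)) has_contour_integral 2 * pi * \<i>) ?\<Gamma>"
    using has_contour_integral_winding_number[OF valid_path_rectpath 0] by simp
  have int: "(\<lambda>z. ell2_apply (green z) n) contour_integrable_on ?\<Gamma>"
    using green_integrable[of r "-r" r "\<lambda>_. 1"] r r0 by simp
  have "contour_integral ?\<Gamma> g = contour_integral ?\<Gamma> (\<lambda>z. ell2_apply (green z) n + ell2_apply (delta 0) n * (1 / (z - 0)))"
    by (rule contour_integral_cong[OF refl g])
  also have "\<dots> = contour_integral ?\<Gamma> (\<lambda>z. ell2_apply (green z) n) + ell2_apply (delta 0) n * (2 * pi * \<i>)"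
    by (intro contour_integral_unique has_contour_integral_add has_contour_integral_lmul
        has_contour_integral_integral[OF int] 1)
  finally have eq: "contour_integral ?\<Gamma> g
      = contour_integral ?\<Gamma> (\<lambda>z. ell2_apply (green z) n) + 2 * pi * \<i> * ell2_apply (delta 0) n"
    by simp
  have "cmod (contour_integral ?\<Gamma> g) \<le> (norm H * (1 / (r - norm H)) / r) * (2 * (r - - r) + 2 * (r - - r))"
  proof (rule rect_integral_bound)
    have "continuous_on (path_image ?\<Gamma>) (\<lambda>z. ell2_apply (green z) n + ell2_apply (delta 0) n * (1 / (z - 0)))"
      by (intro continuous_intros holomorphic_on_imp_continuous_on holomorphic_on_subset[OF green_holomorphic \<Gamma>(1)])
        (use 0 in auto)
    then show "continuous_on (path_image ?\<Gamma>) g"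
      by (rule continuous_on_eq) (simp add: g)
    fix z assume z: "z \<in> path_image ?\<Gamma>"
    have "cmod (ell2_apply (blinfun_apply H (green z)) n) \<le> norm H * norm (green z)"
      by (rule order_trans[OF cmod_le_norm_ell2 norm_blinfun])
    also have "\<dots> \<le> norm H * (1 / (cmod z - norm H))"
      by (intro mult_left_mono green_large) (use z \<Gamma> r in force)+
    also have "\<dots> \<le> norm H * (1 / (r - norm H))"
      by (intro mult_left_mono divide_left_mono) (use \<Gamma>(2)[OF z] r in auto)
    finally show "cmod (g z) \<le> norm H * (1 / (r - norm H)) / r"
      unfolding g_def norm_divide by (rule frac_le[rotated]) (use \<Gamma>(2)[OF z] r r0 in auto)
  qed (use r0 in auto)
  also have "\<dots> = 8 * norm H / (r - norm H)"
    using r0 r by simp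
  finally show ?thesis
    unfolding eq .
qed

text \<open>The integral is the same for all these rectangles, so the error on the large one can be
  sent to 0.\<close>

lemma green_integral:
  assumes "c < 0" "0 < d"
  shows "contour_integral (rect (- K) K c d) (\<lambda>z. ell2_apply (green z) n) = - 2 * pi * \<i> * ell2_apply (delta 0) n"
proof -
  let ?J = "contour_integral (rect (- K) K c d) (\<lambda>z. ell2_apply (green z) n) + 2 * pi * \<i> * ell2_apply (delta 0) n"
  have "cmod ?J \<le> 8 * norm H / (r - norm H)" if "r \<ge> max K (norm H) + 1" for r
  proof -
    have "homotopic_loops off_spectrum (rect (- K) K c d) (rect (- r) r (- r) r)"
      by (rule rect_homotopic) (use that K_gt_1 assms in auto)
    then have "contour_integral (rect (- K) K c d) (\<lambda>z. ell2_apply (green z) n)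
        = contour_integral (rect (- r) r (- r) r) (\<lambda>z. ell2_apply (green z) n)"
      by (rule Cauchy_theorem_homotopic_loops[OF _ open_off_spectrum green_holomorphic]) auto
    then show ?thesis
      using green_integral_large_rect[of r n] that by simp
  qed
  then have "\<forall>\<^sub>F r in at_top. cmod ?J \<le> 8 * norm H / (r - norm H)"
    unfolding eventually_at_top_linorder by blast
  moreover have "((\<lambda>r. 8 * norm H / (r - norm H)) \<longlongrightarrow> 0) at_top"
  proof (rule tendsto_divide_0[OF tendsto_const filterlim_at_top_imp_at_infinity])
    have "filterlim (\<lambda>r. r - c) at_top at_top" for c :: real
      by real_asymp
    then show "filterlim (\<lambda>r. r - norm H) at_top at_top" .
  qed
  ultimately have "cmod ?J \<le> 0"
    by (metis tendsto_lowerbound trivial_limit_at_top_linorder)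
  then show ?thesis
    by (simp add: add_eq_0_iff)
qed

text \<open>Each factor z is traded for \<open>H\<close> through the recurrence; the inhomogeneous
  term leaves a multiple of the entire function \<open>z ^ k\<close>, which integrates to 0 over a
  closed contour. The neighbours of n occur, hence n is arbitrary in the induction.\<close>

lemma green_moment_integral:
  assumes "c < 0" "0 < d"
  shows "contour_integral (rect (- K) K c d) (\<lambda>z. z ^ k * ell2_apply (green z) n)
    = - 2 * pi * \<i> * ell2_apply ((blinfun_apply H ^^ k) (delta 0)) n"
proof (induction k arbitrary: n)
  case 0
  then show ?case using green_integral[OF assms] by simp
next
  case (Suc k)
  let ?\<Gamma> = "rect (- K) K c d"
  let ?G = "\<lambda>n z. ell2_apply (green z) n"
  have int: "(\<lambda>z. z ^ k * ?G n z) contour_integrable_on ?\<Gamma>" for n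
    by (rule green_integrable) (use assms in \<open>auto intro!: holomorphic_intros\<close>)
  have pow: "((\<lambda>z. z ^ k) has_contour_integral 0) ?\<Gamma>"
    by (rule Cauchy_theorem_convex_simple[of _ UNIV]) (auto intro!: holomorphic_intros)
  let ?e = "if n = 0 then 1 else 0 :: complex"
  have "contour_integral ?\<Gamma> (\<lambda>z. z ^ Suc k * ?G n z) = contour_integral ?\<Gamma>
      (\<lambda>z. z ^ k * ?G (n + 1) z + z ^ k * ?G (n - 1) z + complex_of_real (V n) * (z ^ k * ?G n z) + (- ?e) * z ^ k)"
  proof (rule contour_integral_cong[OF refl])
    fix z assume "z \<in> path_image ?\<Gamma>"
    then have z: "z \<in> off_spectrum" using rect_off_spectrum[of K c d] assms by auto
    show "z ^ Suc k * ?G n z = z ^ k * ?G (n + 1) z + z ^ k * ?G (n - 1) z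
        + complex_of_real (V n) * (z ^ k * ?G n z) + (- ?e) * z ^ k"
      using arg_cong[OF green_recurrence[OF z, of n], of "\<lambda>y. z ^ k * y"] by (simp add: algebra_simps)
  qed
  also have "\<dots> = contour_integral ?\<Gamma> (\<lambda>z. z ^ k * ?G (n + 1) z) + contour_integral ?\<Gamma> (\<lambda>z. z ^ k * ?G (n - 1) z)
      + complex_of_real (V n) * contour_integral ?\<Gamma> (\<lambda>z. z ^ k * ?G n z) + (- ?e) * 0"
    by (intro contour_integral_unique has_contour_integral_add has_contour_integral_lmul
        has_contour_integral_integral[OF int] pow)
  also have "\<dots> = - 2 * pi * \<i> * ell2_apply ((blinfun_apply H ^^ Suc k) (delta 0)) n"
    unfolding Suc.IH by (simp add: H_apply algebra_simps)
  finally show ?case .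
qed

end

section \<open>From moments to the exponential\<close>

lemma exp_blinfun_sums:
  "(\<lambda>k. (blinfun_apply A ^^ k) u /\<^sub>R fact k) sums blinfun_apply (exp_blinfun A) u"
proof -
  have pow: "blinfun_apply (((o\<^sub>L) A ^^ k) id_blinfun) u = (blinfun_apply A ^^ k) u" for k
    by (induction k) simp_all
  have "(\<lambda>k. blinfun_apply ((((o\<^sub>L) A ^^ k) id_blinfun) /\<^sub>R fact k) u) sums blinfun_apply (exp_blinfun A) u"
    unfolding exp_blinfun_def
    by (intro bounded_linear.sums[OF blinfun.bounded_linear_left] summable_sums summable_exp_blinfun)
  then show ?thesis
    unfolding blinfun.scaleR_left pow .
qed

lemma (in bounded_potential) evolution_sums:
  "(\<lambda>k. (- \<i> * of_real t) ^ k / fact k * ell2_apply ((blinfun_apply H ^^ k) (delta 0)) n)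
    sums ell2_apply (blinfun_apply (evolution V t) (delta 0)) n"
proof -
  let ?c = "- \<i> * complex_of_real t"
  have pow: "(blinfun_apply (scalarC ?c o\<^sub>L H) ^^ k) (delta 0) = scaleC_ell2 (?c ^ k) ((blinfun_apply H ^^ k) (delta 0))" for k
    by (induction k; rule ell2_eqI) (simp_all add: H_scaleC scalarC.rep_eq scaleC_ell2.rep_eq mult_ac)
  have "(\<lambda>k. ell2_apply ((blinfun_apply (scalarC ?c o\<^sub>L H) ^^ k) (delta 0) /\<^sub>R fact k) n)
      sums ell2_apply (blinfun_apply (evolution V t) (delta 0)) n"
    unfolding evolution_def by (intro bounded_linear.sums[OF bounded_linear_ell2_apply] exp_blinfun_sums)
  then show ?thesis
    unfolding pow scaleR_ell2.rep_eq scaleC_ell2.rep_eq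
    by (simp add: scaleR_conv_of_real field_simps)
qed

text \<open>The Dunford formula for the exponential: its power series converges uniformly on the
  compact contour, so the moments may be summed termwise.\<close>

lemma (in spectral_interval) evolution_contour_integral:
  assumes cd: "c < 0" "0 < d"
  shows "contour_integral (rect (- K) K c d) (\<lambda>z. exp (- \<i> * of_real t * z) * ell2_apply (green z) n)
    = - 2 * pi * \<i> * ell2_apply (blinfun_apply (evolution V t) (delta 0)) n"
proof -
  let ?\<Gamma> = "rect (- K) K c d"
  let ?G = "\<lambda>z. ell2_apply (green z) n"
  let ?c = "- \<i> * complex_of_real t"
  let ?f = "\<lambda>k z. (?c * z) ^ k /\<^sub>R fact k"
  have contG: "continuous_on (path_image ?\<Gamma>) ?G"
    by (intro holomorphic_on_imp_continuous_on holomorphic_on_subset[OF green_holomorphic] rect_off_spectrum) (use cd in auto)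
  have cpt: "compact (path_image ?\<Gamma>)" by (intro compact_path_image) auto
  obtain M where M: "\<And>z. z \<in> path_image ?\<Gamma> \<Longrightarrow> cmod (?G z) \<le> M"
    using compact_imp_bounded[OF compact_continuous_image[OF contG cpt]] by (auto simp: bounded_iff)
  obtain R where R: "\<And>z. z \<in> path_image ?\<Gamma> \<Longrightarrow> cmod z \<le> R"
    using compact_imp_bounded[OF cpt] by (auto simp: bounded_iff)
  have start: "Complex (- K) c \<in> path_image ?\<Gamma>"
    using pathstart_in_path_image[of ?\<Gamma>] by simp
  have M0: "0 \<le> M" and R0: "0 \<le> R"
    using M[OF start] R[OF start] norm_ge_zero order_trans by blast+
  have "uniform_limit (path_image ?\<Gamma>) (\<lambda>N z. \<Sum>k<N. ?f k z) (\<lambda>z. \<Sum>k. ?f k z) sequentially"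
  proof (rule Weierstrass_m_test)
    show "cmod (?f k z) \<le> (\<bar>t\<bar> * R) ^ k /\<^sub>R fact k" if "z \<in> path_image ?\<Gamma>" for k z
    proof -
      have "cmod (?f k z) = (\<bar>t\<bar> * cmod z) ^ k /\<^sub>R fact k"
        by (simp add: norm_power norm_mult)
      also have "\<dots> \<le> (\<bar>t\<bar> * R) ^ k /\<^sub>R fact k"
        by (intro scaleR_left_mono power_mono mult_left_mono R that) auto
      finally show ?thesis .
    qed
    show "summable (\<lambda>k. (\<bar>t\<bar> * R) ^ k /\<^sub>R fact k)"
      by (rule summable_exp_generic)
  qed
  then have ul: "uniform_limit (path_image ?\<Gamma>) (\<lambda>N z. \<Sum>k<N. ?f k z) (\<lambda>z. exp (?c * z)) sequentially"
    by (simp add: exp_def)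
  have int: "(\<lambda>z. f z * ?G z) contour_integrable_on ?\<Gamma>" if "f holomorphic_on UNIV" for f
    by (rule green_integrable) (use cd that in auto)
  have hol: "?f k holomorphic_on UNIV" for k
    unfolding scaleR_conv_of_real by (intro holomorphic_intros)
  have coeff: "contour_integral ?\<Gamma> (\<lambda>z. ?f k z * ?G z)
      = - 2 * pi * \<i> * (?c ^ k / fact k * ell2_apply ((blinfun_apply H ^^ k) (delta 0)) n)" for k
  proof -
    have "(\<lambda>z. ?f k z * ?G z) = (\<lambda>z. (?c ^ k / fact k) * (z ^ k * ?G z))"
      unfolding power_mult_distrib by (simp add: scaleR_conv_of_real field_simps)
    then have "contour_integral ?\<Gamma> (\<lambda>z. ?f k z * ?G z)
        = (?c ^ k / fact k) * contour_integral ?\<Gamma> (\<lambda>z. z ^ k * ?G z)"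
      by (simp only: contour_integral_lmul[OF int[of "\<lambda>z. z ^ k"]] holomorphic_intros)
    then show ?thesis
      by (simp add: green_moment_integral[OF cd] mult_ac)
  qed
  have lim1: "(\<lambda>N. contour_integral ?\<Gamma> (\<lambda>z. (\<Sum>k<N. ?f k z) * ?G z))
      \<longlonglongrightarrow> - 2 * pi * \<i> * ell2_apply (blinfun_apply (evolution V t) (delta 0)) n"
  proof -
    have "contour_integral ?\<Gamma> (\<lambda>z. (\<Sum>k<N. ?f k z) * ?G z) =
        (\<Sum>k<N. - 2 * pi * \<i> * (?c ^ k / fact k * ell2_apply ((blinfun_apply H ^^ k) (delta 0)) n))" for N
      unfolding sum_distrib_right
      by (subst contour_integral_sum) (use int[OF hol] coeff in auto)
    then show ?thesis
      using sums_mult[OF evolution_sums[of t n], of "- 2 * pi * \<i>"] by (simp only: sums_def)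
  qed
  have lim2: "(\<lambda>N. contour_integral ?\<Gamma> (\<lambda>z. (\<Sum>k<N. ?f k z) * ?G z))
      \<longlonglongrightarrow> contour_integral ?\<Gamma> (\<lambda>z. exp (?c * z) * ?G z)"
  proof (rule tendstoI)
    fix e :: real assume e: "0 < e"
    define L where "L = 2 * (K - - K) + 2 * (d - c)"
    have L: "0 < L" using K_gt_1 cd by (simp add: L_def)
    \<comment> \<open>\<open>L\<close> is the length of the contour and \<open>M\<close> bounds G on
      it; \<open>M + 1\<close> keeps the denominator positive.\<close>
    define e' where "e' = e / (2 * (M + 1) * L)"
    have e': "0 < e'" using e L M0 by (simp add: e'_def)
    show "\<forall>\<^sub>F N in sequentially. dist (contour_integral ?\<Gamma> (\<lambda>z. (\<Sum>k<N. ?f k z) * ?G z))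
        (contour_integral ?\<Gamma> (\<lambda>z. exp (?c * z) * ?G z)) < e"
      using uniform_limitD[OF ul e']
    proof eventually_elim
      case (elim N)
      have hols: "(\<lambda>z. \<Sum>k<N. ?f k z) holomorphic_on UNIV" "(\<lambda>z. exp (?c * z)) holomorphic_on UNIV"
        by (intro holomorphic_intros hol)+
      have "contour_integral ?\<Gamma> (\<lambda>z. (\<Sum>k<N. ?f k z) * ?G z) - contour_integral ?\<Gamma> (\<lambda>z. exp (?c * z) * ?G z)
          = contour_integral ?\<Gamma> (\<lambda>z. ((\<Sum>k<N. ?f k z) - exp (?c * z)) * ?G z)"
        unfolding left_diff_distrib by (rule contour_integral_diff[symmetric]) (intro int hols)+
      also have "cmod \<dots> \<le> (e' * (M + 1)) * (2 * (K - - K) + 2 * (d - c))"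
      proof (rule rect_integral_bound)
        show "continuous_on (path_image ?\<Gamma>) (\<lambda>z. ((\<Sum>k<N. ?f k z) - exp (?c * z)) * ?G z)"
          by (intro continuous_intros contG) auto
        fix z assume z: "z \<in> path_image ?\<Gamma>"
        show "cmod (((\<Sum>k<N. ?f k z) - exp (?c * z)) * ?G z) \<le> e' * (M + 1)"
          unfolding norm_mult using elim z M[OF z] M0 e' by (intro mult_mono) (auto simp: dist_norm less_imp_le)
      qed (use K_gt_1 cd in auto)
      also have "\<dots> = e / 2"
        unfolding L_def[symmetric] e'_def using M0 L nonzero_mult_divide_mult_cancel_right[of "(M + 1) * L" e 2]
        by (simp add: mult_ac)
      finally show ?case
        using e by (simp add: dist_norm)
    qed
  qed
  show ?thesis
    by (rule LIMSEQ_unique[OF lim2 lim1])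
qed

section \<open>Unitarity\<close>

text \<open>The derivative of \<open>|exp (t A) u|\<^sup>2\<close> vanishes.\<close>

lemma norm_exp_skew:
  fixes A :: "'b::{real_inner,banach} \<Rightarrow>\<^sub>L 'b"
  assumes skew: "\<And>v. inner (blinfun_apply A v) v = 0"
  shows "norm (blinfun_apply (exp_blinfun (t *\<^sub>R A)) u) = norm u"
proof -
  define x where "x k = (blinfun_apply A ^^ k) u" for k
  define f where "f k s = (s ^ k / fact k) *\<^sub>R x k" for k and s :: real
  define f' where "f' k s h = (h * (real k * s ^ (k - 1) / fact k)) *\<^sub>R x k" for k and s h :: real
  \<comment> \<open>A compact interval containing both 0 and t, on which the exponential series
    converges uniformly.\<close>
  define T where "T = \<bar>t\<bar>"
  have pow: "(blinfun_apply (s *\<^sub>R A) ^^ k) u = s ^ k *\<^sub>R x k" for s k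
    by (induction k) (simp_all add: x_def blinfun.scaleR_left blinfun.scaleR_right)
  have sums: "(\<lambda>k. f k s) sums blinfun_apply (exp_blinfun (s *\<^sub>R A)) u" for s
    using exp_blinfun_sums[of "s *\<^sub>R A" u] by (simp add: pow f_def divide_inverse mult.commute)
  define \<psi> where "\<psi> s = blinfun_apply (exp_blinfun (s *\<^sub>R A)) u" for s
  have nx: "norm (x k) \<le> norm A ^ k * norm u" for k
  proof (induction k)
    case (Suc k)
    have "norm (x (Suc k)) \<le> norm A * norm (x k)"
      by (simp add: x_def norm_blinfun)
    also have "\<dots> \<le> norm A * (norm A ^ k * norm u)"
      by (intro mult_left_mono Suc) simp
    finally show ?case by simp
  qed (simp add: x_def)
  have ul: "uniform_limit {- T..T} (\<lambda>n s. \<Sum>k<n. f k s) (\<lambda>s. \<Sum>k. f k s) sequentially"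
  proof (rule Weierstrass_m_test)
    fix k s assume "s \<in> {- T..T}"
    then have "\<bar>s\<bar> ^ k \<le> T ^ k" by (intro power_mono) auto
    have "norm (f k s) = \<bar>s\<bar> ^ k / fact k * norm (x k)"
      by (simp add: f_def power_abs)
    also have "\<dots> \<le> T ^ k / fact k * (norm A ^ k * norm u)"
      by (intro mult_mono nx divide_right_mono) (use \<open>\<bar>s\<bar> ^ k \<le> T ^ k\<close> in \<open>auto simp: T_def\<close>)
    finally show "norm (f k s) \<le> (T * norm A) ^ k /\<^sub>R fact k * norm u"
      by (simp add: power_mult_distrib divide_inverse mult_ac)
  next
    show "summable (\<lambda>k. (T * norm A) ^ k /\<^sub>R fact k * norm u)"
      by (intro summable_mult2 summable_exp_generic)
  qed
  \<comment> \<open>Differentiating n + 1 terms gives \<open>A\<close> applied to the first n terms.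
    Uniform convergence of the derivatives therefore follows from that of the series itself.\<close>
  have part: "(\<Sum>k<Suc n. f' k s h) = h *\<^sub>R blinfun_apply A (\<Sum>k<n. f k s)" for n s h
  proof -
    have "f' (Suc k) s h = h *\<^sub>R blinfun_apply A (f k s)" for k
      by (simp add: f'_def f_def x_def blinfun.scaleR_right)
    then show ?thesis
      by (subst sum.lessThan_Suc_shift) (simp add: f'_def blinfun.sum_right scaleR_sum_right)
  qed
  have "\<exists>g. \<forall>s\<in>{- T..T}. (\<lambda>k. f k s) sums g s \<and>
      (g has_derivative (\<lambda>h. h *\<^sub>R blinfun_apply A (\<psi> s))) (at s within {- T..T})"
  proof (rule has_derivative_series)
    show "(f n has_derivative f' n s) (at s within {- T..T})" for n s
      unfolding f_def f'_def by (auto intro!: derivative_eq_intros simp: fun_eq_iff field_simps)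
    show "\<forall>\<^sub>F n in sequentially. \<forall>s\<in>{- T..T}. \<forall>h.
        norm (sum (\<lambda>i. f' i s h) {..<n} - h *\<^sub>R blinfun_apply A (\<psi> s)) \<le> e * norm h" if e: "e > 0" for e
    proof -
      have "0 < e / (norm A + 1)" using e by (simp add: add_nonneg_pos)
      from uniform_limitD[OF ul this]
      have "\<forall>\<^sub>F n in sequentially. \<forall>s\<in>{- T..T}. \<forall>h.
          norm (sum (\<lambda>i. f' i s h) {..<Suc n} - h *\<^sub>R blinfun_apply A (\<psi> s)) \<le> e * norm h"
      proof eventually_elim
        case (elim n)
        show ?case
        proof (intro ballI allI)
          fix s h :: real assume s: "s \<in> {- T..T}"
          have \<psi>: "\<psi> s = (\<Sum>k. f k s)" using sums_unique[OF sums] by (simp add: \<psi>_def)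
          have "norm (sum (\<lambda>i. f' i s h) {..<Suc n} - h *\<^sub>R blinfun_apply A (\<psi> s))
              = \<bar>h\<bar> * norm (blinfun_apply A ((\<Sum>k<n. f k s) - \<psi> s))"
            unfolding part by (simp add: blinfun.diff_right flip: scaleR_diff_right)
          also have "\<dots> \<le> \<bar>h\<bar> * (norm A * (e / (norm A + 1)))"
            by (intro mult_left_mono order_trans[OF norm_blinfun])
              (use elim s in \<open>auto simp: \<psi> dist_norm less_imp_le\<close>)
          also have "\<dots> \<le> \<bar>h\<bar> * e"
          proof (rule mult_left_mono)
            have "0 < norm A + 1" by (simp add: add_nonneg_pos)
            then show "norm A * (e / (norm A + 1)) \<le> e"
              using e by (simp add: pos_divide_le_eq algebra_simps)
          qed simp
          finally show "norm (sum (\<lambda>i. f' i s h) {..<Suc n} - h *\<^sub>R blinfun_apply A (\<psi> s)) \<le> e * norm h"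
            by (simp add: mult.commute)
        qed
      qed
      then show ?thesis
        by (rule eventually_sequentially_Suc[THEN iffD1])
    qed
    show "(\<lambda>k. f k 0) sums \<psi> 0" unfolding \<psi>_def by (rule sums)
  qed (auto simp: T_def)
  then obtain g where g: "\<And>s. s \<in> {- T..T} \<Longrightarrow> (\<lambda>k. f k s) sums g s"
    "\<And>s. s \<in> {- T..T} \<Longrightarrow> (g has_derivative (\<lambda>h. h *\<^sub>R blinfun_apply A (\<psi> s))) (at s within {- T..T})"
    by blast
  have g\<psi>: "g s = \<psi> s" if "s \<in> {- T..T}" for s
    using sums_unique2[OF g(1)[OF that] sums] by (simp add: \<psi>_def)
  have "((\<lambda>s. inner (g s) (g s)) has_derivative (\<lambda>h. 0)) (at s within {- T..T})" if "s \<in> {- T..T}" for s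
    using has_derivative_inner[OF g(2)[OF that] g(2)[OF that]]
    by (simp add: g\<psi>[OF that] skew inner_commute[of "\<psi> s"])
  then obtain c where c: "\<And>s. s \<in> {- T..T} \<Longrightarrow> inner (g s) (g s) = c"
    using has_derivative_zero_constant[of "{- T..T}" "\<lambda>s. inner (g s) (g s)"] by auto
  have "t \<in> {- T..T}" "0 \<in> {- T..T}" by (auto simp: T_def)
  then have "inner (\<psi> t) (\<psi> t) = inner (\<psi> 0) (\<psi> 0)"
    using c g\<psi> by metis
  moreover have "\<psi> 0 = u"
  proof -
    have "(\<lambda>k. f k 0) sums f 0 0"
      by (rule sums_unique2[THEN sym, THEN subst, rotated, of "\<lambda>k. f k 0"])
        (use sums_finite[of "{0}" "\<lambda>k. f k 0"] in \<open>auto simp: f_def\<close>)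
    then show ?thesis
      using sums_unique2[OF sums[of 0]] by (simp add: \<psi>_def f_def x_def)
  qed
  ultimately show ?thesis
    by (simp add: \<psi>_def norm_eq_sqrt_inner)
qed

text \<open>\<open>- i H\<close> is skew because \<open>H\<close> is symmetric and commutes with
  \<open>i\<close>. The result bounds the total transition probability by 1.\<close>

lemma (in bounded_potential) norm_evolution: "norm (blinfun_apply (evolution V t) u) = norm u"
proof -
  have "scalarC (- \<i> * of_real t) o\<^sub>L H = t *\<^sub>R (scalarC (- \<i>) o\<^sub>L H)"
    by (intro blinfun_eqI ell2_eqI)
      (simp add: scalarC.rep_eq blinfun.scaleR_left scaleR_ell2.rep_eq scaleC_ell2.rep_eq scaleR_conv_of_real)
  moreover have "inner (blinfun_apply (scalarC (- \<i>) o\<^sub>L H) v) v = 0" for v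
  proof -
    have "inner (scaleC_ell2 \<i> (blinfun_apply H v)) v = - inner (scaleC_ell2 \<i> (blinfun_apply H v)) v"
      by (metis H_symmetric H_scaleC inner_scaleC_ii inner_commute)
    moreover have "scaleC_ell2 (- \<i>) w = - scaleC_ell2 \<i> w" for w :: "int ell2"
      by (rule ell2_eqI) (simp add: scaleC_ell2.rep_eq uminus_ell2.rep_eq)
    ultimately show ?thesis by (simp add: scalarC.rep_eq)
  qed
  ultimately show ?thesis
    unfolding evolution_def by (simp add: norm_exp_skew)
qed

section \<open>Square sums of segment integrals\<close>

text \<open>Cauchy--Schwarz for each n, after which the sum moves under the integral, where the tail
  estimates for \<open>green z\<close> apply at each point separately.\<close>

lemma sum_square_line_integral_le:
  assumes F: "finite F" and f: "\<And>n. n \<in> F \<Longrightarrow> continuous_on (closed_segment a b) (f n)"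
  shows "(\<Sum>n\<in>F. (cmod (contour_integral (linepath a b) (f n)))\<^sup>2)
    \<le> (cmod (b - a))\<^sup>2 * integral {0..1} (\<lambda>s. \<Sum>n\<in>F. (cmod (f n (linepath a b s)))\<^sup>2)"
proof -
  have cont: "continuous_on {0..1} (\<lambda>s. f n (linepath a b s))" if "n \<in> F" for n
    by (rule continuous_on_compose2[OF f[OF that]]) (auto intro!: continuous_intros linepath_in_path)
  have one: "(cmod (contour_integral (linepath a b) (f n)))\<^sup>2
      \<le> (cmod (b - a))\<^sup>2 * integral {0..1} (\<lambda>s. (cmod (f n (linepath a b s)))\<^sup>2)" if n: "n \<in> F" for n
  proof -
    let ?h = "\<lambda>s. cmod (f n (linepath a b s))"
    have ch: "continuous_on {0..1} ?h" by (intro continuous_intros cont n)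
    define I where "I = integral {0..1} ?h"
    \<comment> \<open>Nonnegativity of the variance of \<open>?h\<close> on the unit interval is the
      form of Cauchy--Schwarz used here.\<close>
    have "0 \<le> integral {0..1} (\<lambda>s. (?h s - I)\<^sup>2)"
      by (intro integral_nonneg integrable_continuous_interval continuous_intros ch) auto
    also have "integral {0..1} (\<lambda>s. (?h s - I)\<^sup>2) = integral {0..1} (\<lambda>s. (?h s)\<^sup>2 - (2 * I) * ?h s + I\<^sup>2)"
      by (rule integral_cong) (simp add: power2_diff)
    also have "\<dots> = integral {0..1} (\<lambda>s. (?h s)\<^sup>2) - (2 * I) * I + I\<^sup>2"
      unfolding I_def
      by (subst integral_add integral_diff integral_mult_right |
          intro integrable_continuous_interval continuous_intros ch | simp)+
    finally have I2: "I\<^sup>2 \<le> integral {0..1} (\<lambda>s. (?h s)\<^sup>2)"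
      by (simp add: power2_eq_square)
    have "contour_integral (linepath a b) (f n) = integral {0..1} (\<lambda>s. f n (linepath a b s) * (b - a))"
      by (rule contour_integral_unique, unfold has_contour_integral_linepath)
        (intro integrable_integral integrable_continuous_interval continuous_intros cont n)
    also have "cmod \<dots> \<le> integral {0..1} (\<lambda>s. ?h s * cmod (b - a))"
      by (intro integral_norm_bound_integral integrable_continuous_interval continuous_intros cont n)
        (simp add: norm_mult)
    also have "\<dots> = I * cmod (b - a)"
      by (simp add: I_def)
    finally have "(cmod (contour_integral (linepath a b) (f n)))\<^sup>2 \<le> (I * cmod (b - a))\<^sup>2"
      by (intro power_mono) auto
    also have "\<dots> \<le> (cmod (b - a))\<^sup>2 * integral {0..1} (\<lambda>s. (?h s)\<^sup>2)"
      using mult_left_mono[OF I2, of "(cmod (b - a))\<^sup>2"] by (simp add: power_mult_distrib mult.commute)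
    finally show ?thesis .
  qed
  have "(\<Sum>n\<in>F. (cmod (contour_integral (linepath a b) (f n)))\<^sup>2)
      \<le> (\<Sum>n\<in>F. (cmod (b - a))\<^sup>2 * integral {0..1} (\<lambda>s. (cmod (f n (linepath a b s)))\<^sup>2))"
    by (intro sum_mono one)
  also have "\<dots> = (cmod (b - a))\<^sup>2 * (\<Sum>n\<in>F. integral {0..1} (\<lambda>s. (cmod (f n (linepath a b s)))\<^sup>2))"
    by (rule sum_distrib_left[symmetric])
  also have "(\<Sum>n\<in>F. integral {0..1} (\<lambda>s. (cmod (f n (linepath a b s)))\<^sup>2))
      = integral {0..1} (\<lambda>s. \<Sum>n\<in>F. (cmod (f n (linepath a b s)))\<^sup>2)"
    by (rule integral_sum[symmetric]) (intro F integrable_continuous_interval continuous_intros cont | assumption)+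
  finally show ?thesis .
qed

lemma sum_square_line_integral_bound:
  assumes F: "finite F" and f: "\<And>n. n \<in> F \<Longrightarrow> continuous_on (closed_segment a b) (f n)"
    and B: "\<And>z. z \<in> closed_segment a b \<Longrightarrow> (\<Sum>n\<in>F. (cmod (f n z))\<^sup>2) \<le> B"
  shows "(\<Sum>n\<in>F. (cmod (contour_integral (linepath a b) (f n)))\<^sup>2) \<le> (cmod (b - a))\<^sup>2 * B"
proof -
  have cont: "continuous_on {0..1} (\<lambda>s. f n (linepath a b s))" if "n \<in> F" for n
    by (rule continuous_on_compose2[OF f[OF that]]) (auto intro!: continuous_intros linepath_in_path)
  have "integral {0..1} (\<lambda>s. \<Sum>n\<in>F. (cmod (f n (linepath a b s)))\<^sup>2) \<le> integral {0..1::real} (\<lambda>s. B)"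
    by (intro integral_le integrable_continuous_interval continuous_intros cont B)
      (auto intro: linepath_in_path)
  then have "(cmod (b - a))\<^sup>2 * integral {0..1} (\<lambda>s. \<Sum>n\<in>F. (cmod (f n (linepath a b s)))\<^sup>2) \<le> (cmod (b - a))\<^sup>2 * B"
    by (intro mult_left_mono) auto
  with sum_square_line_integral_le[OF F f] show ?thesis
    by fastforce
qed

section \<open>Bounds on outside probabilities\<close>

lemma matrix_norm_bound: "norm (M *v v) \<le> matrix_norm M * norm v"
  unfolding matrix_norm_def by (rule onorm[OF bounded_linear_matrix_vector_mult])

lemma matrix_norm_le_norm: "matrix_norm M \<le> 4 * norm M"
proof -
  have "cmod ((M *v axis j 1) $ i) \<le> norm M" for i j
  proof -
    have "(M *v axis j 1) $ i = M $ i $ j"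
      by (simp add: matrix_vector_mult_def axis_def if_distrib cong: if_cong)
    also have "cmod (M $ i $ j) \<le> norm (M $ i)" by (rule norm_nth)
    also have "\<dots> \<le> norm M" unfolding norm_vec_def[of M] by (rule member_le_L2_set) auto
    finally show ?thesis .
  qed
  from this[of 1 1] this[of 2 1] this[of 1 2] this[of 2 2] show ?thesis
    using matrix_norm_le_columns[of M] by linarith
qed

lemma matrix_norm_triangle_diff: "\<bar>matrix_norm A - matrix_norm B\<bar> \<le> 4 * norm (A - B)"
proof -
  have "matrix_norm A \<le> matrix_norm B + matrix_norm (A - B)" for A B
    unfolding matrix_norm_def
  proof (rule onorm_le)
    fix v :: "complex^2"
    have "A *v v = B *v v + (A - B) *v v"
      by (simp add: matrix_vector_mult_diff_rdistrib)
    then show "norm (A *v v) \<le> (onorm ((*v) B) + onorm ((*v) (A - B))) * norm v"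
      using norm_triangle_ineq[of "B *v v" "(A - B) *v v"] matrix_norm_bound[of B v] matrix_norm_bound[of "A - B" v]
      by (simp add: matrix_norm_def distrib_right)
  qed
  from this[of A B] this[of B A] show ?thesis
    using matrix_norm_le_norm[of "A - B"] matrix_norm_le_norm[of "B - A"] norm_minus_commute[of A B] by linarith
qed

text \<open>\<open>integral\<close> defaults to 0 for a non-integrable function, so a bound on its
  value carries information only once the integrand is known to be integrable; here this comes from
  continuity in E.\<close>

lemma continuous_on_matrix_norm [continuous_intros]:
  assumes "continuous_on S f"
  shows "continuous_on S (\<lambda>x. matrix_norm (f x))"
proof -
  have "continuous_on UNIV matrix_norm"
  proof (rule lipschitz_on_continuous_on)
    show "4-lipschitz_on UNIV matrix_norm"
      by (rule lipschitz_onI) (use matrix_norm_triangle_diff in \<open>auto simp: dist_norm\<close>)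
  qed
  from continuous_on_compose2[OF this assms] show ?thesis by simp
qed

lemma continuous_on_matrix_mult:
  fixes f g :: "'a::topological_space \<Rightarrow> complex^2^2"
  assumes "continuous_on S f" "continuous_on S g"
  shows "continuous_on S (\<lambda>x. f x ** g x)"
  unfolding matrix_matrix_mult_def by (intro continuous_intros assms)

lemma continuous_on_vector_2x2:
  fixes a b c d :: "'a::topological_space \<Rightarrow> complex"
  assumes "continuous_on S a" "continuous_on S b" "continuous_on S c" "continuous_on S d"
  shows "continuous_on S (\<lambda>x. vector [vector [a x, b x], vector [c x, d x]] :: complex^2^2)"
proof -
  have eq: "(vector [vector [a x, b x], vector [c x, d x]] :: complex^2^2) =
      (\<chi> i j. if i = 1 then if j = 1 then a x else b x else if j = 1 then c x else d x)" for x
    by (simp add: vec_eq_iff forall_2)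
  have "continuous_on S (\<lambda>x. if i = 1 then if j = 1 then a x else b x else if j = 1 then c x else d x)" for i j :: 2
    using assms by (cases "i = 1"; cases "j = 1") simp_all
  then show ?thesis
    unfolding eq by (intro continuous_on_vec_lambda)
qed

lemma continuous_on_Phi: "continuous_on S (Phi V n)"
proof -
  have "continuous_on S (transfer_right V k)" for k
    by (induction k) (auto simp: transfer_def intro!: continuous_on_matrix_mult continuous_on_vector_2x2 continuous_intros)
  moreover have "continuous_on S (transfer_left V k)" for k
    by (induction k) (auto simp: matrix_inv_transfer intro!: continuous_on_matrix_mult continuous_on_vector_2x2 continuous_intros)
  ultimately show ?thesis
    unfolding Phi_def by (cases "n \<ge> 0") simp_all
qed

lemma continuous_on_Max:
  fixes f :: "'i \<Rightarrow> 'a::topological_space \<Rightarrow> real"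
  assumes "finite I" "I \<noteq> {}" "\<And>i. i \<in> I \<Longrightarrow> continuous_on S (f i)"
  shows "continuous_on S (\<lambda>x. Max ((\<lambda>i. f i x) ` I))"
  using assms
proof (induction I rule: finite_ne_induct)
  case (insert i I)
  then have "continuous_on S (\<lambda>x. max (f i x) (Max ((\<lambda>i. f i x) ` I)))"
    by (intro continuous_on_max) auto
  then show ?case using insert by simp
qed simp

text \<open>An entry of modulus 1 in the first column suffices. As soon as 1 or -1 is an admissible
  site, the maximum is at least 1, so its inverse is continuous and the default
  \<open>inverse 0 = 0\<close> cannot occur.\<close>

lemma matrix_norm_Phi_1: "1 \<le> matrix_norm (Phi V 1 z)" "1 \<le> matrix_norm (Phi V (-1) z)"
proof -
  have n: "norm (axis 1 1 :: complex^2) = 1" by simp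
  have "1 \<le> norm (Phi V 1 z *v axis 1 1)"
    using norm_nth[of "Phi V 1 z *v axis 1 1" 2] by (simp add: Phi_def transfer_mult axis_def)
  then show "1 \<le> matrix_norm (Phi V 1 z)"
    using matrix_norm_bound[of "Phi V 1 z" "axis 1 1"] n by simp
  have "1 \<le> norm (Phi V (-1) z *v axis 1 1)"
    using norm_nth[of "Phi V (-1) z *v axis 1 1" 2] by (simp add: Phi_def matrix_inv_transfer_mult axis_def)
  then show "1 \<le> matrix_norm (Phi V (-1) z)"
    using matrix_norm_bound[of "Phi V (-1) z" "axis 1 1"] n by simp
qed

text \<open>Substitution \<open>E = K - 2 * K * s\<close>; the upper side is traversed from right to
  left.\<close>

lemma integral_horizontal_segment:
  fixes g :: "real \<Rightarrow> real"
  assumes "0 < K" "g integrable_on {- K..K}"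
  shows "((\<lambda>s. g (Re (linepath (Complex K \<eta>) (Complex (- K) \<eta>) s))) has_integral integral {- K..K} g / (2 * K)) {0..1}"
proof -
  have "(g has_integral integral {- K..K} g) (cbox (- K) K)"
    using assms(2) by (simp add: integrable_integral)
  from has_integral_affinity[OF this, of "- 2 * K" K]
  have "((\<lambda>x. g (- 2 * K * x + K)) has_integral integral {- K..K} g / (2 * K))
      ((\<lambda>x. (1 / (- 2 * K)) *\<^sub>R x + - ((1 / (- 2 * K)) *\<^sub>R K)) ` cbox (- K) K)"
    using assms(1) by (simp add: field_simps)
  moreover have "(\<lambda>x. (1 / (- 2 * K)) *\<^sub>R x + - ((1 / (- 2 * K)) *\<^sub>R K)) ` cbox (- K) K = {0..1}"
  proof -
    have "(\<lambda>x. (1 / (- 2 * K)) *\<^sub>R x + - ((1 / (- 2 * K)) *\<^sub>R K)) ` cbox (- K) K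
        = cbox ((1 / (- 2 * K)) *\<^sub>R K + - ((1 / (- 2 * K)) *\<^sub>R K)) ((1 / (- 2 * K)) *\<^sub>R (- K) + - ((1 / (- 2 * K)) *\<^sub>R K))"
      using assms(1) image_affinity_atLeastAtMost[of "1 / (- 2 * K)" "- ((1 / (- 2 * K)) * K)" "-K" K]
      by (simp add: zero_le_divide_iff divide_le_0_iff)
    then show ?thesis using assms(1) by (simp add: field_simps)
  qed
  moreover have "Re (linepath (Complex K \<eta>) (Complex (- K) \<eta>) s) = - 2 * K * s + K" for s
    by (simp add: linepath_def algebra_simps)
  ultimately show ?thesis
    by simp
qed

section \<open>Probabilities from the four sides of the contour\<close>

lemma transition_prob_eq: "transition_prob V t n = (cmod (ell2_apply (blinfun_apply (evolution V t) (delta 0)) n))\<^sup>2"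
  by (simp add: transition_prob_def cinner_delta_right)

lemma transition_prob_nonneg: "0 \<le> transition_prob V t n"
  by (simp add: transition_prob_def)

lemma norm_sum4_squared:
  "(cmod (p + q + r + s))\<^sup>2 \<le> 4 * ((cmod p)\<^sup>2 + (cmod q)\<^sup>2 + (cmod r)\<^sup>2 + (cmod s)\<^sup>2)"
proof -
  have "cmod (p + q + r + s) \<le> cmod p + cmod q + cmod r + cmod s"
    by (intro norm_triangle_mono order_refl)
  then have "(cmod (p + q + r + s))\<^sup>2 \<le> (cmod p + cmod q + cmod r + cmod s)\<^sup>2"
    by (intro power_mono) auto
  also have "\<dots> \<le> 4 * ((cmod p)\<^sup>2 + (cmod q)\<^sup>2 + (cmod r)\<^sup>2 + (cmod s)\<^sup>2)"
    using sum_squares_bound[of "cmod p" "cmod q"] sum_squares_bound[of "cmod p" "cmod r"]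
      sum_squares_bound[of "cmod p" "cmod s"] sum_squares_bound[of "cmod q" "cmod r"]
      sum_squares_bound[of "cmod q" "cmod s"] sum_squares_bound[of "cmod r" "cmod s"]
    by (simp add: power2_eq_square algebra_simps)
  finally show ?thesis .
qed

context spectral_interval
begin

text \<open>One constant for three sides: the resolvent at K and at -K gives a bound along each
  vertical line, and |Im z| \<ge> 1 gives the constant 1.\<close>

lemma gap_exists:
  obtains \<kappa> where "0 < \<kappa>" "\<And>z u. \<bar>Re z\<bar> = K \<or> 1 \<le> \<bar>Im z\<bar> \<Longrightarrow> \<kappa> * norm u \<le> norm (blinfun_apply (H - scalarC z) u)"
proof -
  have off: "complex_of_real K \<in> off_spectrum" "complex_of_real (- K) \<in> off_spectrum"
    using K_gt_1 by (auto simp del: of_real_minus)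
  obtain \<kappa>1 where \<kappa>1: "0 < \<kappa>1" "\<And>u. \<kappa>1 * norm u \<le> norm (blinfun_apply (H - scalarC (complex_of_real K)) u)"
    using resolvent_lower_bound[OF off(1)] by blast
  obtain \<kappa>2 where \<kappa>2: "0 < \<kappa>2" "\<And>u. \<kappa>2 * norm u \<le> norm (blinfun_apply (H - scalarC (complex_of_real (- K))) u)"
    using resolvent_lower_bound[OF off(2)] by blast
  define \<kappa> where "\<kappa> = min 1 (min \<kappa>1 \<kappa>2)"
  have "\<kappa> * norm u \<le> norm (blinfun_apply (H - scalarC z) u)" if z: "\<bar>Re z\<bar> = K \<or> 1 \<le> \<bar>Im z\<bar>" for z u
  proof -
    consider "Re z = K" | "Re z = - K" | "1 \<le> \<bar>Im z\<bar>" using z by linarith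
    then show ?thesis
    proof cases
      case 1
      have "\<kappa> * norm u \<le> \<kappa>1 * norm u" by (intro mult_right_mono) (auto simp: \<kappa>_def)
      then show ?thesis using \<kappa>1(2)[of u] norm_H_minus_ge_Re[of z u] 1 by simp
    next
      case 2
      have "\<kappa> * norm u \<le> \<kappa>2 * norm u" by (intro mult_right_mono) (auto simp: \<kappa>_def)
      then show ?thesis using \<kappa>2(2)[of u] norm_H_minus_ge_Re[of z u] 2 by simp
    next
      case 3
      have "\<kappa> * norm u \<le> \<bar>Im z\<bar> * norm u" by (intro mult_right_mono) (use 3 in \<open>auto simp: \<kappa>_def\<close>)
      then show ?thesis using norm_H_minus_ge_Im[of z u] by simp
    qed
  qed
  then show thesis
    by (intro that[of \<kappa>]) (use \<kappa>1 \<kappa>2 in \<open>auto simp: \<kappa>_def\<close>)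
qed

definition \<kappa> :: real where
  "\<kappa> = (SOME \<kappa>. 0 < \<kappa> \<and> (\<forall>z u. \<bar>Re z\<bar> = K \<or> 1 \<le> \<bar>Im z\<bar> \<longrightarrow> \<kappa> * norm u \<le> norm (blinfun_apply (H - scalarC z) u)))"

lemma \<kappa>: "0 < \<kappa>" "\<bar>Re z\<bar> = K \<or> 1 \<le> \<bar>Im z\<bar> \<Longrightarrow> \<kappa> * norm u \<le> norm (blinfun_apply (H - scalarC z) u)"
  using someI_ex[of "\<lambda>\<kappa>. 0 < \<kappa> \<and> (\<forall>z u. \<bar>Re z\<bar> = K \<or> 1 \<le> \<bar>Im z\<bar> \<longrightarrow> \<kappa> * norm u \<le> norm (blinfun_apply (H - scalarC z) u))"]
  unfolding \<kappa>_def[symmetric] by (metis gap_exists)+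

definition decay :: "nat \<Rightarrow> real" where
  "decay N = 2 * (1 / (1 + \<kappa>\<^sup>2)) ^ (N div 2) / \<kappa>\<^sup>2"

lemma green_decay:
  assumes "z \<in> off_spectrum" "\<bar>Re z\<bar> = K \<or> 1 \<le> \<bar>Im z\<bar>" "finite F" "\<And>k. k \<in> F \<Longrightarrow> int N \<le> \<bar>k\<bar>"
  shows "(\<Sum>n\<in>F. (cmod (ell2_apply (green z) n))\<^sup>2) \<le> decay N"
  unfolding decay_def by (rule outside_decay[OF green[OF assms(1)] \<kappa>(2)[OF assms(2)] \<kappa>(1) assms(3,4)])

text \<open>Stated for any height \<eta> and any majorant \<open>g\<close> on the upper side because
  it serves twice: with \<eta> = 1/t and the transfer matrices, and with \<eta> = 1 and exponential
  decay. \<open>4 * K^2\<close> is the squared length of the lower side, 8 accounts for two vertical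
  sides of length at most 2, and \<open>2 * K\<close> is the squared length of the upper side
  divided by the Jacobian.\<close>

lemma transition_prob_sum_le:
  assumes \<eta>: "0 < \<eta>" "\<eta> \<le> 1" and t: "0 \<le> t" and F: "finite F" "\<And>k. k \<in> F \<Longrightarrow> int N \<le> \<bar>k\<bar>"
    and g: "g integrable_on {- K..K}"
    and top: "\<And>E. E \<in> {- K..K} \<Longrightarrow> (\<Sum>n\<in>F. (cmod (ell2_apply (green (Complex E \<eta>)) n))\<^sup>2) \<le> g E"
  shows "(\<Sum>n\<in>F. transition_prob V t n) \<le> exp (2 * t * \<eta>) * ((4 * K\<^sup>2 + 8) * decay N + 2 * K * integral {- K..K} g)"
proof -
  let ?\<Gamma> = "rect (- K) K (- 1) \<eta>"
  define f where "f n z = exp (- \<i> * of_real t * z) * ell2_apply (green z) n" for n z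
  define I where "I a b n = contour_integral (linepath a b) (f n)" for a b n
  have off: "path_image ?\<Gamma> \<subseteq> off_spectrum"
    by (rule rect_off_spectrum) (use \<eta> in auto)
  have cont: "continuous_on (path_image ?\<Gamma>) (f n)" for n
    unfolding f_def by (intro continuous_intros holomorphic_on_imp_continuous_on holomorphic_on_subset[OF green_holomorphic off])
  have sub: "closed_segment (Complex (- K) (- 1)) (Complex K (- 1)) \<subseteq> path_image ?\<Gamma>"
    "closed_segment (Complex K (- 1)) (Complex K \<eta>) \<subseteq> path_image ?\<Gamma>"
    "closed_segment (Complex K \<eta>) (Complex (- K) \<eta>) \<subseteq> path_image ?\<Gamma>"
    "closed_segment (Complex (- K) \<eta>) (Complex (- K) (- 1)) \<subseteq> path_image ?\<Gamma>"
    by (auto simp: rectpath_def Let_def path_image_join)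
  have sq: "(cmod (f n z))\<^sup>2 \<le> exp (2 * t * \<eta>) * (cmod (ell2_apply (green z) n))\<^sup>2" if "Im z \<le> \<eta>" for n z
  proof -
    have "(cmod (exp (- \<i> * of_real t * z)))\<^sup>2 = exp (2 * t * Im z)"
      by (simp add: norm_exp_eq_Re power2_eq_square flip: exp_add)
    also have "\<dots> \<le> exp (2 * t * \<eta>)"
      using that t by (simp add: mult_left_mono)
    finally show ?thesis
      by (simp add: f_def norm_mult power_mult_distrib mult_right_mono)
  qed
  have ssq: "(\<Sum>n\<in>F. (cmod (f n z))\<^sup>2) \<le> exp (2 * t * \<eta>) * (\<Sum>n\<in>F. (cmod (ell2_apply (green z) n))\<^sup>2)" if "Im z \<le> \<eta>" for z
    unfolding sum_distrib_left by (intro sum_mono sq that)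
  have decay: "(\<Sum>n\<in>F. (cmod (f n z))\<^sup>2) \<le> exp (2 * t * \<eta>) * decay N"
    if "z \<in> path_image ?\<Gamma>" "\<bar>Re z\<bar> = K \<or> 1 \<le> \<bar>Im z\<bar>" for z
  proof -
    have "Im z \<le> \<eta>"
      using that(1) \<eta> K_gt_1 by (auto simp: path_image_rectpath)
    from ssq[OF this] show ?thesis
      by (rule order_trans) (use green_decay[OF _ that(2) F] off that(1) in \<open>auto intro!: mult_left_mono\<close>)
  qed
  have decay_nonneg: "0 \<le> decay N"
    unfolding decay_def by (simp add: add_nonneg_nonneg)
  have len: "cmod (Complex K (- 1) - Complex (- K) (- 1)) = 2 * K" "cmod (Complex K \<eta> - Complex K (- 1)) = 1 + \<eta>"
    "cmod (Complex (- K) \<eta> - Complex K \<eta>) = 2 * K" "cmod (Complex (- K) (- 1) - Complex (- K) \<eta>) = 1 + \<eta>"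
    using K_gt_1 \<eta> by (simp_all add: cmod_def real_sqrt_mult)
  have bottom: "(\<Sum>n\<in>F. (cmod (I (Complex (- K) (- 1)) (Complex K (- 1)) n))\<^sup>2) \<le> (2 * K)\<^sup>2 * (exp (2 * t * \<eta>) * decay N)"
    unfolding I_def len(1)[symmetric]
  proof (rule sum_square_line_integral_bound[OF F(1)])
    fix z assume z: "z \<in> closed_segment (Complex (- K) (- 1)) (Complex K (- 1))"
    then have "Im z = - 1" by (auto simp: closed_segment_same_Im)
    then show "(\<Sum>n\<in>F. (cmod (f n z))\<^sup>2) \<le> exp (2 * t * \<eta>) * decay N"
      using z sub(1) by (intro decay) auto
  qed (rule continuous_on_subset[OF cont sub(1)])
  have side: "(1 + \<eta>)\<^sup>2 * (exp (2 * t * \<eta>) * decay N) \<le> 4 * (exp (2 * t * \<eta>) * decay N)"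
    using power_mono[of "1 + \<eta>" 2 2] \<eta> decay_nonneg by (intro mult_right_mono) auto
  have right: "(\<Sum>n\<in>F. (cmod (I (Complex K (- 1)) (Complex K \<eta>) n))\<^sup>2) \<le> (1 + \<eta>)\<^sup>2 * (exp (2 * t * \<eta>) * decay N)"
    unfolding I_def len(2)[symmetric]
  proof (rule sum_square_line_integral_bound[OF F(1)])
    fix z assume z: "z \<in> closed_segment (Complex K (- 1)) (Complex K \<eta>)"
    then have "\<bar>Re z\<bar> = K" using K_gt_1 by (auto simp: closed_segment_same_Re)
    then show "(\<Sum>n\<in>F. (cmod (f n z))\<^sup>2) \<le> exp (2 * t * \<eta>) * decay N"
      using z sub(2) by (intro decay) auto
  qed (rule continuous_on_subset[OF cont sub(2)])
  have left: "(\<Sum>n\<in>F. (cmod (I (Complex (- K) \<eta>) (Complex (- K) (- 1)) n))\<^sup>2) \<le> (1 + \<eta>)\<^sup>2 * (exp (2 * t * \<eta>) * decay N)"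
    unfolding I_def len(4)[symmetric]
  proof (rule sum_square_line_integral_bound[OF F(1)])
    fix z assume z: "z \<in> closed_segment (Complex (- K) \<eta>) (Complex (- K) (- 1))"
    then have "\<bar>Re z\<bar> = K" using K_gt_1 by (auto simp: closed_segment_same_Re)
    then show "(\<Sum>n\<in>F. (cmod (f n z))\<^sup>2) \<le> exp (2 * t * \<eta>) * decay N"
      using z sub(4) by (intro decay) auto
  qed (rule continuous_on_subset[OF cont sub(4)])
  let ?l = "linepath (Complex K \<eta>) (Complex (- K) \<eta>)"
  have "(\<Sum>n\<in>F. (cmod (I (Complex K \<eta>) (Complex (- K) \<eta>) n))\<^sup>2) \<le> (2 * K)\<^sup>2 * integral {0..1} (\<lambda>s. \<Sum>n\<in>F. (cmod (f n (?l s)))\<^sup>2)"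
    unfolding I_def len(3)[symmetric]
    by (rule sum_square_line_integral_le[OF F(1)]) (rule continuous_on_subset[OF cont sub(3)])
  also have "\<dots> \<le> (2 * K)\<^sup>2 * (exp (2 * t * \<eta>) * (integral {- K..K} g / (2 * K)))"
  proof (rule mult_left_mono)
    have int: "((\<lambda>s. exp (2 * t * \<eta>) * g (Re (?l s))) has_integral exp (2 * t * \<eta>) * (integral {- K..K} g / (2 * K))) {0..1}"
      by (rule has_integral_mult_right[OF integral_horizontal_segment[OF _ g]]) (use K_gt_1 in auto)
    have l: "?l s = Complex (Re (?l s)) \<eta>" "Re (?l s) \<in> {- K..K}" if "s \<in> {0..1}" for s
    proof -
      have "?l s \<in> closed_segment (Complex K \<eta>) (Complex (- K) \<eta>)"
        using that by (rule linepath_in_path)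
      then have *: "Im (?l s) = \<eta>" "Re (?l s) \<in> {- K..K}"
        using K_gt_1 by (auto simp: closed_segment_same_Im closed_segment_eq_real_ivl split: if_splits)
      then show "?l s = Complex (Re (?l s)) \<eta>" "Re (?l s) \<in> {- K..K}" by (simp_all add: complex_eq_iff)
    qed
    have "integral {0..1} (\<lambda>s. \<Sum>n\<in>F. (cmod (f n (?l s)))\<^sup>2) \<le> integral {0..1} (\<lambda>s. exp (2 * t * \<eta>) * g (Re (?l s)))"
    proof (rule integral_le)
      have "continuous_on {0..1} (\<lambda>s. f n (?l s))" for n
        by (rule continuous_on_compose2[OF continuous_on_subset[OF cont sub(3)]])
          (auto intro!: continuous_intros linepath_in_path)
      then show "(\<lambda>s. \<Sum>n\<in>F. (cmod (f n (?l s)))\<^sup>2) integrable_on {0..1}"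
        by (intro integrable_continuous_interval continuous_intros)
      show "(\<lambda>s. exp (2 * t * \<eta>) * g (Re (?l s))) integrable_on {0..1}"
        using int by blast
      fix s :: real assume s: "s \<in> {0..1}"
      have Im: "Im (?l s) \<le> \<eta>" using arg_cong[OF l(1)[OF s], of Im] by simp
      have "(\<Sum>n\<in>F. (cmod (ell2_apply (green (?l s)) n))\<^sup>2) \<le> g (Re (?l s))"
        using top[OF l(2)[OF s]] l(1)[OF s] by simp
      then show "(\<Sum>n\<in>F. (cmod (f n (?l s)))\<^sup>2) \<le> exp (2 * t * \<eta>) * g (Re (?l s))"
        by (intro order_trans[OF ssq[OF Im]] mult_left_mono) auto
    qed
    then show "integral {0..1} (\<lambda>s. \<Sum>n\<in>F. (cmod (f n (?l s)))\<^sup>2) \<le> exp (2 * t * \<eta>) * (integral {- K..K} g / (2 * K))"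
      using integral_unique[OF int] by simp
  qed simp
  also have "\<dots> = 2 * K * (exp (2 * t * \<eta>) * integral {- K..K} g)"
    using K_gt_1 by (simp add: power2_eq_square)
  finally have topb: "(\<Sum>n\<in>F. (cmod (I (Complex K \<eta>) (Complex (- K) \<eta>) n))\<^sup>2) \<le> 2 * K * (exp (2 * t * \<eta>) * integral {- K..K} g)" .
  define J where "J n = (cmod (I (Complex (- K) (- 1)) (Complex K (- 1)) n))\<^sup>2 + (cmod (I (Complex K (- 1)) (Complex K \<eta>) n))\<^sup>2
      + (cmod (I (Complex K \<eta>) (Complex (- K) \<eta>) n))\<^sup>2 + (cmod (I (Complex (- K) \<eta>) (Complex (- K) (- 1)) n))\<^sup>2" for n
  \<comment> \<open>The factor 4 from squaring a sum of four terms is absorbed by the normalisation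
    \<open>4 * pi^2\<close>.\<close>
  have prob: "transition_prob V t n \<le> J n" for n
  proof -
    have "contour_integral ?\<Gamma> (f n) = - 2 * pi * \<i> * ell2_apply (blinfun_apply (evolution V t) (delta 0)) n"
      unfolding f_def by (rule evolution_contour_integral) (use \<eta> in auto)
    then have "(cmod (contour_integral ?\<Gamma> (f n)))\<^sup>2 = 4 * pi\<^sup>2 * transition_prob V t n"
      by (simp add: transition_prob_eq norm_mult power_mult_distrib)
    moreover have "4 * transition_prob V t n \<le> 4 * pi\<^sup>2 * transition_prob V t n"
      using mult_right_mono[of 1 "pi\<^sup>2" "transition_prob V t n"] pi_ge_two transition_prob_nonneg[of V t n]
        one_le_power[of pi 2] by simp
    moreover have "(cmod (contour_integral ?\<Gamma> (f n)))\<^sup>2 \<le> 4 * J n"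
      unfolding contour_integral_rect[OF cont] J_def I_def by (rule norm_sum4_squared)
    ultimately show ?thesis by linarith
  qed
  have "(\<Sum>n\<in>F. transition_prob V t n) \<le> (\<Sum>n\<in>F. J n)"
    by (intro sum_mono prob)
  also have "\<dots> \<le> (2 * K)\<^sup>2 * (exp (2 * t * \<eta>) * decay N) + 4 * (exp (2 * t * \<eta>) * decay N)
      + 2 * K * (exp (2 * t * \<eta>) * integral {- K..K} g) + 4 * (exp (2 * t * \<eta>) * decay N)"
    unfolding J_def sum.distrib using bottom right left topb side by linarith
  also have "\<dots> = exp (2 * t * \<eta>) * ((4 * K\<^sup>2 + 8) * decay N + 2 * K * integral {- K..K} g)"
    by (simp add: algebra_simps)
  finally show ?thesis .
qed

text \<open>With \<eta> = 1 all four sides decay exponentially in |n|; the price is the factor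
  \<open>exp (2 * t)\<close>. The upper side adds another \<open>4 * K^2\<close>.\<close>

lemma transition_prob_ballistic:
  assumes "0 \<le> t"
  shows "transition_prob V t n \<le> exp (2 * t) * ((8 * K\<^sup>2 + 8) * decay (nat \<bar>n\<bar>))"
proof -
  have "(\<Sum>k\<in>{n}. transition_prob V t k) \<le> exp (2 * t * 1)
      * ((4 * K\<^sup>2 + 8) * decay (nat \<bar>n\<bar>) + 2 * K * integral {- K..K} (\<lambda>_. decay (nat \<bar>n\<bar>)))"
  proof (rule transition_prob_sum_le)
    fix E assume "E \<in> {- K..K}"
    have "Complex E 1 \<in> off_spectrum" by (auto simp: complex_eq_iff)
    then show "(\<Sum>k\<in>{n}. (cmod (ell2_apply (green (Complex E 1)) k))\<^sup>2) \<le> decay (nat \<bar>n\<bar>)"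
      by (rule green_decay) auto
  qed (use assms in auto)
  then show ?thesis
    using K_gt_1 by (simp add: algebra_simps power2_eq_square)
qed

definition transfer_bound :: real where
  "transfer_bound = K + 1 + (SUP n. \<bar>V n\<bar>)"

lemma transfer_bound:
  assumes "E \<in> {- K..K}" "0 < \<eta>" "\<eta> \<le> 1"
  shows "cmod (Complex E \<eta> - complex_of_real (V n)) \<le> transfer_bound"
proof -
  obtain M where "\<And>n. \<bar>V n\<bar> \<le> M"
    using bounded_V by (auto simp: bounded_iff)
  then have "bdd_above (range (\<lambda>n. \<bar>V n\<bar>))"
    by (intro bdd_aboveI2[where M = M])
  then have "\<bar>V n\<bar> \<le> (SUP n. \<bar>V n\<bar>)"
    by (intro cSUP_upper) auto
  moreover have "cmod (Complex E \<eta> - complex_of_real (V n)) \<le> cmod (Complex E \<eta>) + \<bar>V n\<bar>"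
    using norm_triangle_ineq4[of "Complex E \<eta>" "complex_of_real (V n)"] by simp
  moreover have "cmod (Complex E \<eta>) \<le> \<bar>E\<bar> + \<bar>\<eta>\<bar>"
    using cmod_le[of "Complex E \<eta>"] by simp
  moreover have "\<bar>E\<bar> \<le> K" "\<bar>\<eta>\<bar> \<le> 1"
    using assms by auto
  ultimately show ?thesis
    unfolding transfer_bound_def by linarith
qed

lemma norm_green_le:
  assumes "0 < Im z"
  shows "(norm (green z))\<^sup>2 \<le> 1 / (Im z)\<^sup>2"
proof -
  have "z \<in> off_spectrum" using assms by auto
  then have "Im z * norm (green z) \<le> 1"
    using norm_H_minus_ge_Im[of z "green z"] assms by (simp add: green)
  then have "norm (green z) \<le> 1 / Im z"
    using assms by (simp add: field_simps)
  then have "(norm (green z))\<^sup>2 \<le> (1 / Im z)\<^sup>2"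
    by (intro power_mono) auto
  then show ?thesis
    by (simp add: power_divide)
qed

text \<open>The power \<open>t ^ 5\<close> is \<eta>^-2 from the norm of \<open>green\<close> times
  \<eta>^-3 from the Wronskian argument. The set \<open>I\<close> and the estimate
  \<open>tail\<close> are left open so that both half-lines are covered; \<open>n0\<close> keeps the
  maximum at least 1.\<close>

lemma transition_prob_outside:
  assumes t: "1 \<le> t" and F: "finite F" "\<And>k. k \<in> F \<Longrightarrow> int N \<le> \<bar>k\<bar>"
    and I: "finite I" "I \<noteq> {}" and n0: "n0 \<in> I" "\<And>z. 1 \<le> matrix_norm (Phi V n0 z)"
    and tail: "\<And>n u z. n \<in> I \<Longrightarrow> blinfun_apply (H - scalarC z) u = delta 0 \<Longrightarrow> 0 < Im z \<Longrightarrow> Im z \<le> 1 \<Longrightarrow>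
      (\<And>k. cmod (z - complex_of_real (V k)) \<le> transfer_bound) \<Longrightarrow>
      (\<Sum>k\<in>F. (cmod (ell2_apply u k))\<^sup>2) * (matrix_norm (Phi V n z))\<^sup>2 \<le> 16 * (transfer_bound + 2) ^ 6 * (norm u)\<^sup>2 / (Im z) ^ 3"
  shows "(\<Sum>n\<in>F. transition_prob V t n) \<le> exp 2 * ((4 * K\<^sup>2 + 8) * decay N + 2 * K * (16 * (transfer_bound + 2) ^ 6 * (t ^ 5 *
    integral {- K..K} (\<lambda>E. inverse (Max ((\<lambda>n. (matrix_norm (Phi V n (complex_of_real E + \<i> * complex_of_real (inverse t))))\<^sup>2) ` I))))))"
proof -
  define \<eta> where "\<eta> = inverse t"
  have \<eta>: "0 < \<eta>" "\<eta> \<le> 1" using t by (auto simp: \<eta>_def inverse_le_1_iff)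
  define M where "M E = Max ((\<lambda>n. (matrix_norm (Phi V n (complex_of_real E + \<i> * complex_of_real \<eta>)))\<^sup>2) ` I)" for E
  define c where "c = 16 * (transfer_bound + 2) ^ 6 * t ^ 5"
  have A0: "0 \<le> transfer_bound"
    using transfer_bound[of 0 1 0] K_gt_1 norm_ge_zero order_trans by (metis atLeastAtMost_iff less_imp_le neg_le_0_iff_le order_refl zero_less_one less_trans)
  have M1: "1 \<le> M E" for E
  proof -
    have "1 \<le> (matrix_norm (Phi V n0 (complex_of_real E + \<i> * complex_of_real \<eta>)))\<^sup>2"
      by (rule one_le_power[OF n0(2)])
    also have "\<dots> \<le> M E" unfolding M_def using I n0(1) by (intro Max_ge) auto
    finally show ?thesis .
  qed
  have contM: "continuous_on S M" for S
    unfolding M_def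
    by (intro continuous_on_Max I continuous_intros continuous_on_compose2[OF continuous_on_Phi[of UNIV]]) auto
  have int: "(\<lambda>E. c * inverse (M E)) integrable_on {- K..K}"
    by (intro integrable_continuous_interval continuous_intros contM) (use M1 in \<open>metis not_one_le_zero\<close>)
  have "(\<Sum>n\<in>F. transition_prob V t n) \<le> exp (2 * t * \<eta>) * ((4 * K\<^sup>2 + 8) * decay N
      + 2 * K * integral {- K..K} (\<lambda>E. c * inverse (M E)))"
  proof (rule transition_prob_sum_le[OF \<eta> _ F int])
    fix E assume E: "E \<in> {- K..K}"
    let ?z = "Complex E \<eta>"
    have z: "complex_of_real E + \<i> * complex_of_real \<eta> = ?z" by (simp add: complex_eq_iff)
    have off: "?z \<in> off_spectrum" using \<eta> by (auto simp: complex_eq_iff)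
    \<comment> \<open>The maximising site depends on E. Since \<open>tail\<close> is available for
      every site in \<open>I\<close>, it may be applied at the maximiser.\<close>
    have "M E \<in> (\<lambda>n. (matrix_norm (Phi V n ?z))\<^sup>2) ` I"
      unfolding M_def z using I by (intro Max_in) auto
    then obtain n where n: "n \<in> I" "M E = (matrix_norm (Phi V n ?z))\<^sup>2" by auto
    let ?S = "\<Sum>k\<in>F. (cmod (ell2_apply (green ?z) k))\<^sup>2"
    have "?S * M E \<le> 16 * (transfer_bound + 2) ^ 6 * (norm (green ?z))\<^sup>2 / \<eta> ^ 3"
      using tail[OF n(1) green[OF off]] \<eta> transfer_bound[OF E \<eta>] by (simp add: n(2))
    also have "\<dots> \<le> 16 * (transfer_bound + 2) ^ 6 * (1 / \<eta>\<^sup>2) / \<eta> ^ 3"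
      using norm_green_le[of ?z] \<eta> A0 by (intro divide_right_mono mult_left_mono) auto
    also have "\<dots> = c"
      using t by (simp add: c_def \<eta>_def field_simps power2_eq_square power3_eq_cube eval_nat_numeral)
    finally have "?S * M E \<le> c" .
    then show "?S \<le> c * inverse (M E)"
      using M1[of E] by (simp add: field_simps)
  qed (use t in auto)
  also have "exp (2 * t * \<eta>) = exp 2" using t by (simp add: \<eta>_def)
  also have "integral {- K..K} (\<lambda>E. c * inverse (M E)) = c * integral {- K..K} (\<lambda>E. inverse (M E))"
    by simp
  finally show ?thesis
    unfolding M_def \<eta>_def c_def by (simp only: mult.assoc)
qed

end

section \<open>Transport exponents\<close>

lemma ereal_log_le:
  assumes "x \<le> ereal b" "0 < b"
  shows "ereal_log x \<le> ereal (ln b)"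
proof (cases x)
  case (real r)
  then show ?thesis using assms by (auto simp: ereal_log_def)
qed (use assms in \<open>auto simp: ereal_log_def\<close>)

text \<open>The constant D contributes \<open>ln D / (p * ln t)\<close>, which vanishes in the
  limit. Needed with a = -m for the outside probabilities and with a = p \<alpha> for the
  moments.\<close>

lemma Limsup_log_ratio_le:
  fixes f :: "real \<Rightarrow> ereal"
  assumes f: "\<forall>\<^sub>F t in at_top. f t \<le> ereal (D * t powr a)" and D: "0 < D" and p: "0 < p"
  shows "Limsup at_top (\<lambda>t. ereal_log (f t) / ereal (p * ln t)) \<le> ereal (a / p)"
proof -
  have "Limsup at_top (\<lambda>t. ereal_log (f t) / ereal (p * ln t)) \<le> Limsup at_top (\<lambda>t. ereal (a / p + ln D / p / ln t))"
  proof (rule Limsup_mono)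
    show "\<forall>\<^sub>F t in at_top. ereal_log (f t) / ereal (p * ln t) \<le> ereal (a / p + ln D / p / ln t)"
      using f eventually_gt_at_top[of 1]
    proof eventually_elim
      case (elim t)
      have "ereal_log (f t) \<le> ereal (ln (D * t powr a))"
        by (rule ereal_log_le) (use elim D in auto)
      then have "ereal_log (f t) / ereal (p * ln t) \<le> ereal (ln (D * t powr a)) / ereal (p * ln t)"
        by (rule ereal_divide_right_mono) (use elim p in auto)
      also have "\<dots> = ereal (a / p + ln D / p / ln t)"
        using elim D p by (simp add: ln_mult ln_powr field_simps)
      finally show ?case .
    qed
  qed
  also have "\<dots> = ereal (a / p)"
  proof (rule lim_imp_Limsup)
    have "((\<lambda>t. q + r / ln t) \<longlongrightarrow> q) at_top" for q r :: real
      by real_asymp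
    then show "((\<lambda>t. ereal (a / p + ln D / p / ln t)) \<longlongrightarrow> ereal (a / p)) at_top"
      by (intro tendsto_ereal)
  qed simp
  finally show ?thesis .
qed

lemma bigo_cmult_left: "f \<in> O[F](g) \<Longrightarrow> (\<lambda>x. c * f x) \<in> O[F](g)" for c :: real
  by (cases "c = 0") simp_all

lemma transition_prob_summable: "transition_prob V t summable_on A"
  unfolding transition_prob_eq[abs_def] by (rule ell2_summable_on)

section \<open>Sites beyond t^2\<close>

context spectral_interval
begin

lemma gap_gt_1: "1 < 1 + \<kappa>\<^sup>2"
  using \<kappa>(1) by simp

text \<open>The exponential form is what asymptotic comparison needs; the \<open>- 1\<close> pays
  for the integer division in \<open>decay\<close>.\<close>

lemma decay_le: "decay N \<le> 2 / \<kappa>\<^sup>2 * exp (- (ln (1 + \<kappa>\<^sup>2) / 2) * (real N - 1))"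
proof -
  note pos = gap_gt_1
  have "(1 / (1 + \<kappa>\<^sup>2)) ^ (N div 2) = exp (- ln (1 + \<kappa>\<^sup>2) * real (N div 2))"
  proof -
    have "0 < 1 + \<kappa>\<^sup>2" using pos by linarith
    then have "1 / (1 + \<kappa>\<^sup>2) = exp (- ln (1 + \<kappa>\<^sup>2))"
      by (simp add: exp_minus exp_ln inverse_eq_divide)
    then show ?thesis
      by (simp only: exp_of_nat_mult[symmetric] mult.commute)
  qed
  also have "\<dots> \<le> exp (- (ln (1 + \<kappa>\<^sup>2) / 2) * (real N - 1))"
  proof -
    have "real N - 1 \<le> 2 * real (N div 2)" by linarith
    then have "ln (1 + \<kappa>\<^sup>2) * (real N - 1) \<le> ln (1 + \<kappa>\<^sup>2) * (2 * real (N div 2))"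
      by (rule mult_left_mono) (use pos in simp)
    then show ?thesis by simp
  qed
  finally have "2 / \<kappa>\<^sup>2 * (1 / (1 + \<kappa>\<^sup>2)) ^ (N div 2) \<le> 2 / \<kappa>\<^sup>2 * exp (- (ln (1 + \<kappa>\<^sup>2) / 2) * (real N - 1))"
    by (rule mult_left_mono) simp
  then show ?thesis by (simp add: decay_def)
qed

text \<open>\<open>exp (- c * j)\<close> beats both \<open>exp (2 * sqrt j)\<close> and every power
  of j.\<close>

lemma ballistic_series_summable:
  "summable (\<lambda>j. real j powr p * (exp (2 * sqrt (real j)) * ((8 * K\<^sup>2 + 8) * decay j)))"
proof -
  define c where "c = ln (1 + \<kappa>\<^sup>2) / 2"
  have c: "0 < c" using ln_gt_zero[OF gap_gt_1] by (simp add: c_def)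
  define Q where "Q = (8 * K\<^sup>2 + 8) * (2 / \<kappa>\<^sup>2)"
  have "(\<lambda>j. real j powr p * (exp (2 * sqrt (real j)) * exp (- c * (real j - 1)))) \<in> O(\<lambda>j. 1 / real j ^ 2)"
    using c by real_asymp
  moreover have "summable (\<lambda>j. norm (1 / real j ^ 2))"
    using inverse_power_summable[of 2, where 'a = real] by (simp add: inverse_eq_divide)
  ultimately have "summable (\<lambda>j. real j powr p * (exp (2 * sqrt (real j)) * exp (- c * (real j - 1))))"
    by (rule summable_comparison_test_bigo[rotated])
  then have "summable (\<lambda>j. Q * (real j powr p * (exp (2 * sqrt (real j)) * exp (- c * (real j - 1)))))"
    by (rule summable_mult)
  then show ?thesis
  proof (rule summable_comparison_test')
    fix j :: nat
    have d: "0 \<le> decay j" by (simp add: decay_def add_nonneg_nonneg)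
    have "(8 * K\<^sup>2 + 8) * decay j \<le> (8 * K\<^sup>2 + 8) * (2 / \<kappa>\<^sup>2 * exp (- c * (real j - 1)))"
      unfolding c_def by (intro mult_left_mono decay_le) auto
    also have "\<dots> = Q * exp (- c * (real j - 1))" by (simp add: Q_def)
    finally have *: "(8 * K\<^sup>2 + 8) * decay j \<le> Q * exp (- c * (real j - 1))" .
    show "norm (real j powr p * (exp (2 * sqrt (real j)) * ((8 * K\<^sup>2 + 8) * decay j)))
        \<le> Q * (real j powr p * (exp (2 * sqrt (real j)) * exp (- c * (real j - 1))))"
      using d mult_left_mono[OF *, of "real j powr p * exp (2 * sqrt (real j))"] by (simp add: abs_mult mult_ac)
  qed
qed

text \<open>Beyond |n| = t^2 the time is at most \<open>sqrt |n|\<close>, so every term is dominated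
  by a series that no longer depends on t. Its sum is doubled for the two half-lines.\<close>

lemma ballistic_tail_bounded:
  obtains S where "\<And>F t. finite F \<Longrightarrow> 0 \<le> t \<Longrightarrow> (\<And>n. n \<in> F \<Longrightarrow> t\<^sup>2 \<le> \<bar>real_of_int n\<bar>) \<Longrightarrow>
    (\<Sum>n\<in>F. \<bar>real_of_int n\<bar> powr p * transition_prob V t n) \<le> S"
proof -
  define h where "h j = real j powr p * (exp (2 * sqrt (real j)) * ((8 * K\<^sup>2 + 8) * decay j))" for j
  have h0: "0 \<le> h j" for j by (simp add: h_def decay_def add_nonneg_nonneg)
  have hs: "summable h" unfolding h_def by (rule ballistic_series_summable)
  have half: "(\<Sum>n\<in>G. h (nat \<bar>n\<bar>)) \<le> suminf h" if "finite G" "inj_on (\<lambda>n. nat \<bar>n\<bar>) G" for G :: "int set"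
    using sum_le_suminf[OF hs, of "(\<lambda>n. nat \<bar>n\<bar>) ` G"] that h0 by (simp add: sum.reindex)
  show thesis
  proof (rule that[of "2 * suminf h"])
    fix F :: "int set" and t :: real
    assume F: "finite F" "\<And>n. n \<in> F \<Longrightarrow> t\<^sup>2 \<le> \<bar>real_of_int n\<bar>" and t: "0 \<le> t"
    have "\<bar>real_of_int n\<bar> powr p * transition_prob V t n \<le> h (nat \<bar>n\<bar>)" if n: "n \<in> F" for n
    proof -
      have "t \<le> sqrt (real (nat \<bar>n\<bar>))"
        by (rule real_le_rsqrt) (use F(2)[OF n] in simp)
      then have "exp (2 * t) \<le> exp (2 * sqrt (real (nat \<bar>n\<bar>)))" by simp
      then have "exp (2 * t) * ((8 * K\<^sup>2 + 8) * decay (nat \<bar>n\<bar>)) \<le> exp (2 * sqrt (real (nat \<bar>n\<bar>))) * ((8 * K\<^sup>2 + 8) * decay (nat \<bar>n\<bar>))"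
        by (rule mult_right_mono) (simp add: decay_def add_nonneg_nonneg)
      then have "\<bar>real_of_int n\<bar> powr p * transition_prob V t n \<le> \<bar>real_of_int n\<bar> powr p * (exp (2 * sqrt (real (nat \<bar>n\<bar>))) * ((8 * K\<^sup>2 + 8) * decay (nat \<bar>n\<bar>)))"
        by (intro mult_left_mono order_trans[OF transition_prob_ballistic[OF t]]) auto
      then show ?thesis by (simp add: h_def)
    qed
    then have "(\<Sum>n\<in>F. \<bar>real_of_int n\<bar> powr p * transition_prob V t n) \<le> (\<Sum>n\<in>F. h (nat \<bar>n\<bar>))"
      by (rule sum_mono)
    also have "\<dots> = (\<Sum>n\<in>F \<inter> {0..}. h (nat \<bar>n\<bar>)) + (\<Sum>n\<in>F \<inter> {..<0}. h (nat \<bar>n\<bar>))"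
      by (subst sum.union_disjoint[symmetric]) (use F in \<open>auto intro!: sum.cong\<close>)
    also have "\<dots> \<le> suminf h + suminf h"
      by (intro add_mono half) (use F in \<open>auto intro!: inj_onI\<close>)
    finally show "(\<Sum>n\<in>F. \<bar>real_of_int n\<bar> powr p * transition_prob V t n) \<le> 2 * suminf h" by simp
  qed
qed

end

section \<open>Superpolynomial decay beyond C t^\<alpha>\<close>

locale superpolynomial_transfer = spectral_interval +
  fixes C \<alpha> :: real
  assumes C: "0 < C" and \<alpha>: "0 < \<alpha>"
    and right: "\<And>m::nat. m \<ge> 1 \<Longrightarrow>
      (\<lambda>t::real. integral {- K..K} (\<lambda>E.
         inverse (Max ((\<lambda>n. (matrix_norm (Phi V n (complex_of_real E + \<i> * complex_of_real (inverse t))))\<^sup>2)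
           ` {n::int. 1 \<le> n \<and> real_of_int n \<le> C * t powr \<alpha>}))))
      \<in> O[at_top](\<lambda>t. t powr (- real m))"
    and left: "\<And>m::nat. m \<ge> 1 \<Longrightarrow>
      (\<lambda>t::real. integral {- K..K} (\<lambda>E.
         inverse (Max ((\<lambda>n. (matrix_norm (Phi V n (complex_of_real E + \<i> * complex_of_real (inverse t))))\<^sup>2)
           ` {n::int. 1 \<le> - n \<and> real_of_int (- n) \<le> C * t powr \<alpha>}))))
      \<in> O[at_top](\<lambda>t. t powr (- real m))"
begin

definition cutoff :: "real \<Rightarrow> nat" where
  "cutoff t = nat \<lfloor>C * t powr \<alpha>\<rfloor>"

text \<open>A positive power of t in the exponent beats every power of t; this uses \<alpha> >
  0.\<close>

lemma decay_cutoff_bigo: "(\<lambda>t. decay (cutoff t)) \<in> O[at_top](\<lambda>t. t powr (- real m))"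
proof -
  define c where "c = ln (1 + \<kappa>\<^sup>2) / 2"
  have c: "0 < c" using ln_gt_zero[OF gap_gt_1] by (simp add: c_def)
  have "decay (cutoff t) \<le> 2 / \<kappa>\<^sup>2 * exp (- c * (C * t powr \<alpha> - 2))" for t
  proof -
    have "0 \<le> C * t powr \<alpha>" using C by simp
    \<comment> \<open>One unit is lost to the floor in \<open>cutoff\<close>, the other is the
      \<open>- 1\<close> in \<open>decay_le\<close>.\<close>
    then have "C * t powr \<alpha> - 2 \<le> real (cutoff t) - 1"
      unfolding cutoff_def by linarith
    then have "exp (- c * (real (cutoff t) - 1)) \<le> exp (- c * (C * t powr \<alpha> - 2))"
      using c by (simp add: mult_left_mono)
    then have "2 / \<kappa>\<^sup>2 * exp (- c * (real (cutoff t) - 1)) \<le> 2 / \<kappa>\<^sup>2 * exp (- c * (C * t powr \<alpha> - 2))"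
      by (rule mult_left_mono) simp
    then show ?thesis
      using decay_le[of "cutoff t"] unfolding c_def by (rule order_trans[rotated])
  qed
  moreover have "0 \<le> decay N" for N by (simp add: decay_def add_nonneg_nonneg)
  ultimately have "(\<lambda>t. decay (cutoff t)) \<in> O[at_top](\<lambda>t. 2 / \<kappa>\<^sup>2 * exp (- c * (C * t powr \<alpha> - 2)))"
    by (intro bigoI[of _ 1] always_eventually) simp
  also have "(\<lambda>t. d * exp (- c * (C * t powr \<alpha> - 2))) \<in> O[at_top](\<lambda>t. t powr (- real m))" for d
    by (rule bigo_cmult_left) (use c C \<alpha> in real_asymp)
  finally show ?thesis .
qed

text \<open>The margin \<open>+ 1\<close> in \<open>G\<close> places its sites strictly beyond every
  admissible n and beyond \<open>cutoff t\<close>. Membership of \<open>n0\<close> is asked only for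
  \<open>1 \<le> C * t powr \<alpha>\<close>, as the range of sites is empty for small t. The
  threshold in t is uniform in \<open>F\<close>, which later allows passing to infinite
  sums.\<close>

lemma one_sided_transition_prob_bigo:
  fixes I G :: "real \<Rightarrow> int set"
  assumes \<mu>: "\<And>m::nat. m \<ge> 1 \<Longrightarrow> (\<lambda>t. integral {- K..K} (\<lambda>E.
         inverse (Max ((\<lambda>n. (matrix_norm (Phi V n (complex_of_real E + \<i> * complex_of_real (inverse t))))\<^sup>2) ` I t))))
      \<in> O[at_top](\<lambda>t. t powr (- real m))"
    and I: "\<And>t. finite (I t)" "\<And>t. 1 \<le> C * t powr \<alpha> \<Longrightarrow> n0 \<in> I t" "\<And>z. 1 \<le> matrix_norm (Phi V n0 z)"
    and G: "\<And>t k. k \<in> G t \<Longrightarrow> C * t powr \<alpha> + 1 \<le> \<bar>real_of_int k\<bar>"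
    and tail: "\<And>t F n u z. finite F \<Longrightarrow> F \<subseteq> G t \<Longrightarrow> n \<in> I t \<Longrightarrow> blinfun_apply (H - scalarC z) u = delta 0 \<Longrightarrow>
      0 < Im z \<Longrightarrow> Im z \<le> 1 \<Longrightarrow> (\<And>k. cmod (z - complex_of_real (V k)) \<le> transfer_bound) \<Longrightarrow>
      (\<Sum>k\<in>F. (cmod (ell2_apply u k))\<^sup>2) * (matrix_norm (Phi V n z))\<^sup>2 \<le> 16 * (transfer_bound + 2) ^ 6 * (norm u)\<^sup>2 / (Im z) ^ 3"
  shows "\<exists>D>0. \<forall>\<^sub>F t in at_top. \<forall>F. finite F \<longrightarrow> F \<subseteq> G t \<longrightarrow> (\<Sum>n\<in>F. transition_prob V t n) \<le> D * t powr (- real m)"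
proof -
  let ?\<mu> = "\<lambda>t. integral {- K..K} (\<lambda>E.
         inverse (Max ((\<lambda>n. (matrix_norm (Phi V n (complex_of_real E + \<i> * complex_of_real (inverse t))))\<^sup>2) ` I t)))"
  let ?b = "\<lambda>t. exp 2 * ((4 * K\<^sup>2 + 8) * decay (cutoff t) + 2 * K * (16 * (transfer_bound + 2) ^ 6 * (t ^ 5 * ?\<mu> t)))"
  \<comment> \<open>The hypothesis is invoked at the exponent m + 5 to pay for
    \<open>t ^ 5\<close>.\<close>
  have "(\<lambda>t. t ^ 5 * ?\<mu> t) \<in> O[at_top](\<lambda>t. t ^ 5 * t powr (- real (m + 5)))"
    by (intro landau_o.big.mult \<mu>) auto
  also have "(\<lambda>t. t ^ 5 * t powr (- real (m + 5))) \<in> O[at_top](\<lambda>t::real. t powr (- real m))"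
    by real_asymp
  finally have "?b \<in> O[at_top](\<lambda>t. t powr (- real m))"
    by (intro bigo_cmult_left sum_in_bigo decay_cutoff_bigo)
  then obtain D where D: "0 < D" "\<forall>\<^sub>F t in at_top. norm (?b t) \<le> D * norm (t powr (- real m))"
    by (elim landau_o.bigE)
  have "filterlim (\<lambda>t. C * t powr \<alpha>) at_top at_top"
    using C \<alpha> by real_asymp
  then have "\<forall>\<^sub>F t in at_top. 1 \<le> C * t powr \<alpha>"
    by (simp add: filterlim_at_top)
  then have "\<forall>\<^sub>F t in at_top. \<forall>F. finite F \<longrightarrow> F \<subseteq> G t \<longrightarrow> (\<Sum>n\<in>F. transition_prob V t n) \<le> D * t powr (- real m)"
    using D(2) eventually_ge_at_top[of 1]
  proof eventually_elim
    case (elim t)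
    show ?case
    proof (intro allI impI)
      fix F assume F: "finite F" "F \<subseteq> G t"
      have n0: "n0 \<in> I t" using I(2) elim by blast
      have far: "int (cutoff t) \<le> \<bar>k\<bar>" if "k \<in> F" for k
        using G[of k t] F(2) that elim(1) unfolding cutoff_def by (simp add: subset_iff) linarith
      have "(\<Sum>n\<in>F. transition_prob V t n) \<le> ?b t"
        by (rule transition_prob_outside[OF elim(3) F(1) far I(1) _ n0 I(3) tail[OF F]]) (use n0 in auto)
      also have "\<dots> \<le> D * t powr (- real m)"
        using elim(2) by simp
      finally show "(\<Sum>n\<in>F. transition_prob V t n) \<le> D * t powr (- real m)" .
    qed
  qed
  with D(1) show ?thesis by blast
qed

lemma right_transition_prob_bigo:
  "\<exists>D>0. \<forall>\<^sub>F t in at_top. \<forall>F. finite F \<longrightarrow> F \<subseteq> {n. C * t powr \<alpha> + 1 \<le> real_of_int n} \<longrightarrow>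
    (\<Sum>n\<in>F. transition_prob V t n) \<le> D * t powr (- real m)"
proof (rule one_sided_transition_prob_bigo[OF right, where ?n0.0 = 1])
  fix t :: real
  have "{n::int. 1 \<le> n \<and> real_of_int n \<le> C * t powr \<alpha>} \<subseteq> {1..\<lfloor>C * t powr \<alpha>\<rfloor>}"
    by (auto simp: le_floor_iff)
  then show "finite {n::int. 1 \<le> n \<and> real_of_int n \<le> C * t powr \<alpha>}"
    by (rule finite_subset) simp
next
  fix t z u and n :: int and F :: "int set"
  assume n: "n \<in> {n. 1 \<le> n \<and> real_of_int n \<le> C * t powr \<alpha>}"
    and F: "finite F" "F \<subseteq> {n. C * t powr \<alpha> + 1 \<le> real_of_int n}"
    and *: "blinfun_apply (H - scalarC z) u = delta 0" "0 < Im z" "Im z \<le> 1"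
      "\<And>k. cmod (z - complex_of_real (V k)) \<le> transfer_bound"
  have "1 \<le> nat n" "F \<subseteq> {int (nat n)<..}" using F(2) n by force+
  then show "(\<Sum>k\<in>F. (cmod (ell2_apply u k))\<^sup>2) * (matrix_norm (Phi V n z))\<^sup>2 \<le> 16 * (transfer_bound + 2) ^ 6 * (norm u)\<^sup>2 / (Im z) ^ 3"
    using green_right_tail[OF * _ F(1), of "nat n"] n by simp
qed (auto simp: matrix_norm_Phi_1)

lemma left_transition_prob_bigo:
  "\<exists>D>0. \<forall>\<^sub>F t in at_top. \<forall>F. finite F \<longrightarrow> F \<subseteq> {n. real_of_int n \<le> - (C * t powr \<alpha> + 1)} \<longrightarrow>
    (\<Sum>n\<in>F. transition_prob V t n) \<le> D * t powr (- real m)"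
proof (rule one_sided_transition_prob_bigo[OF left, where ?n0.0 = "- 1"])
  fix t :: real
  have "{n::int. 1 \<le> - n \<and> real_of_int (- n) \<le> C * t powr \<alpha>} \<subseteq> {- \<lfloor>C * t powr \<alpha>\<rfloor>..-1}"
    by (auto simp: le_floor_iff minus_le_iff)
  then show "finite {n::int. 1 \<le> - n \<and> real_of_int (- n) \<le> C * t powr \<alpha>}"
    by (rule finite_subset) simp
next
  fix t z u and n :: int and F :: "int set"
  assume n: "n \<in> {n. 1 \<le> - n \<and> real_of_int (- n) \<le> C * t powr \<alpha>}"
    and F: "finite F" "F \<subseteq> {n. real_of_int n \<le> - (C * t powr \<alpha> + 1)}"
    and *: "blinfun_apply (H - scalarC z) u = delta 0" "0 < Im z" "Im z \<le> 1"
      "\<And>k. cmod (z - complex_of_real (V k)) \<le> transfer_bound"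
  have "1 \<le> nat (- n)" "F \<subseteq> {..- int (nat (- n))}" using F(2) n by force+
  then show "(\<Sum>k\<in>F. (cmod (ell2_apply u k))\<^sup>2) * (matrix_norm (Phi V n z))\<^sup>2 \<le> 16 * (transfer_bound + 2) ^ 6 * (norm u)\<^sup>2 / (Im z) ^ 3"
    using green_left_tail[OF * _ F(1), of "nat (- n)"] n by simp
qed (auto simp: matrix_norm_Phi_1)

lemma transition_prob_bigo:
  obtains D where "0 < D" "\<forall>\<^sub>F t in at_top. \<forall>F. finite F \<longrightarrow> F \<subseteq> {n. C * t powr \<alpha> + 1 \<le> \<bar>real_of_int n\<bar>} \<longrightarrow>
    (\<Sum>n\<in>F. transition_prob V t n) \<le> D * t powr (- real m)"
proof -
  obtain D1 where D1: "0 < D1" "\<forall>\<^sub>F t in at_top. \<forall>F. finite F \<longrightarrow> F \<subseteq> {n. C * t powr \<alpha> + 1 \<le> real_of_int n} \<longrightarrow>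
    (\<Sum>n\<in>F. transition_prob V t n) \<le> D1 * t powr (- real m)"
    using right_transition_prob_bigo by blast
  obtain D2 where D2: "0 < D2" "\<forall>\<^sub>F t in at_top. \<forall>F. finite F \<longrightarrow> F \<subseteq> {n. real_of_int n \<le> - (C * t powr \<alpha> + 1)} \<longrightarrow>
    (\<Sum>n\<in>F. transition_prob V t n) \<le> D2 * t powr (- real m)"
    using left_transition_prob_bigo by blast
  have "\<forall>\<^sub>F t in at_top. \<forall>F. finite F \<longrightarrow> F \<subseteq> {n. C * t powr \<alpha> + 1 \<le> \<bar>real_of_int n\<bar>} \<longrightarrow>
    (\<Sum>n\<in>F. transition_prob V t n) \<le> (D1 + D2) * t powr (- real m)"
    using D1(2) D2(2)
  proof eventually_elim
    case (elim t)
    show ?case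
    proof (intro allI impI)
      fix F assume F: "finite F" "F \<subseteq> {n. C * t powr \<alpha> + 1 \<le> \<bar>real_of_int n\<bar>}"
      have "(\<Sum>n\<in>F. transition_prob V t n) = (\<Sum>n\<in>F \<inter> {0..}. transition_prob V t n) + (\<Sum>n\<in>F \<inter> {..<0}. transition_prob V t n)"
        by (subst sum.union_disjoint[symmetric]) (use F in \<open>auto intro!: sum.cong\<close>)
      moreover have "F \<inter> {0..} \<subseteq> {n. C * t powr \<alpha> + 1 \<le> real_of_int n}"
        "F \<inter> {..<0} \<subseteq> {n. real_of_int n \<le> - (C * t powr \<alpha> + 1)}"
        using F(2) by force+
      ultimately show "(\<Sum>n\<in>F. transition_prob V t n) \<le> (D1 + D2) * t powr (- real m)"
        using elim F(1) by (simp add: distrib_right add_mono)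
    qed
  qed
  then show thesis
    using D1(1) D2(1) by (intro that[of "D1 + D2"]) auto
qed

section \<open>The two exponents\<close>

text \<open>For \<alpha>' > \<alpha> the radius \<open>t powr \<alpha>' - 1\<close> eventually
  exceeds \<open>C * t powr \<alpha> + 1\<close>, whatever C is, so the limit superior lies below -m
  for every m.\<close>

lemma S_plus_eq_infinity:
  assumes "\<alpha> < \<alpha>'"
  shows "S_plus V \<alpha>' = \<infinity>"
proof -
  let ?L = "Limsup at_top (\<lambda>t::real. ereal_log (ereal (P_outside V (t powr \<alpha>' - 1) t)) / ereal (ln t))"
  have "?L \<le> ereal (- real m)" for m
  proof -
    obtain D where D: "0 < D" "\<forall>\<^sub>F t in at_top. \<forall>F. finite F \<longrightarrow> F \<subseteq> {n. C * t powr \<alpha> + 1 \<le> \<bar>real_of_int n\<bar>} \<longrightarrow>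
      (\<Sum>n\<in>F. transition_prob V t n) \<le> D * t powr (- real m)"
      by (rule transition_prob_bigo)
    have "\<forall>\<^sub>F t in at_top. C * t powr \<alpha> + 1 \<le> t powr \<alpha>' - 1"
      using assms \<alpha> by real_asymp
    then have "\<forall>\<^sub>F t in at_top. ereal (P_outside V (t powr \<alpha>' - 1) t) \<le> ereal (2 * D * t powr (- real m))"
      using D(2)
    proof eventually_elim
      case (elim t)
      have "P_left V (t powr \<alpha>' - 1) t \<le> D * t powr (- real m)"
        unfolding P_left_def
      proof (rule infsum_le_finite_sums[OF transition_prob_summable])
        fix F :: "int set" assume "finite F" "F \<subseteq> {n. real_of_int n \<le> - (t powr \<alpha>' - 1)}"
        then show "(\<Sum>n\<in>F. transition_prob V t n) \<le> D * t powr (- real m)"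
          using elim by (intro elim(2)[rule_format]) force+
      qed
      moreover have "P_right V (t powr \<alpha>' - 1) t \<le> D * t powr (- real m)"
        unfolding P_right_def
      proof (rule infsum_le_finite_sums[OF transition_prob_summable])
        fix F :: "int set" assume "finite F" "F \<subseteq> {n. t powr \<alpha>' - 1 \<le> real_of_int n}"
        then show "(\<Sum>n\<in>F. transition_prob V t n) \<le> D * t powr (- real m)"
          using elim by (intro elim(2)[rule_format]) force+
      qed
      ultimately show ?case by (simp add: P_outside_def)
    qed
    from Limsup_log_ratio_le[OF this, of 1] D(1) show ?thesis by simp
  qed
  then have "?L \<le> - ereal (real m)" for m by simp
  then have "ereal (real m) \<le> - ?L" for m
    using ereal_minus_le_minus by fastforce
  then have "- ?L = \<infinity>"
    by (intro ereal_top) (meson ereal_less_eq(3) order_trans real_arch_simple)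
  then show ?thesis
    by (simp add: S_plus_def)
qed

lemma alpha_u_plus_le: "alpha_u_plus V \<le> ereal \<alpha>"
  unfolding alpha_u_plus_def
proof (rule Sup_least)
  fix x assume "x \<in> ereal ` {\<alpha>. 0 \<le> \<alpha> \<and> S_plus V \<alpha> < \<infinity>}"
  then obtain \<alpha>' where \<alpha>': "x = ereal \<alpha>'" "S_plus V \<alpha>' < \<infinity>" by auto
  then show "x \<le> ereal \<alpha>"
    using S_plus_eq_infinity[of \<alpha>'] by (cases "\<alpha> < \<alpha>'") auto
qed

text \<open>Only the bulk sites |n| < C t^\<alpha> + 1 contribute the growth t^(p \<alpha>), and
  they carry total mass at most 1; the two outer regions stay bounded in t.\<close>

lemma moment_le:
  assumes p: "0 < p"
  obtains D where "0 < D" "\<forall>\<^sub>F t in at_top. enn2ereal (moment V p t) \<le> ereal (D * t powr (p * \<alpha>))"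
proof -
  obtain S where S: "\<And>F t. finite F \<Longrightarrow> 0 \<le> t \<Longrightarrow> (\<And>n. n \<in> F \<Longrightarrow> t\<^sup>2 \<le> \<bar>real_of_int n\<bar>) \<Longrightarrow>
    (\<Sum>n\<in>F. \<bar>real_of_int n\<bar> powr p * transition_prob V t n) \<le> S"
    using ballistic_tail_bounded[where p = p] by blast
  have S0: "0 \<le> S" using S[of "{}" 0] by simp
  \<comment> \<open>Below t^2 the weight is at most t^(2p), which the decay t^(-m) then
    cancels.\<close>
  obtain m :: nat where m: "2 * p \<le> real m" using real_arch_simple by blast
  obtain D where D: "0 < D" "\<forall>\<^sub>F t in at_top. \<forall>F. finite F \<longrightarrow> F \<subseteq> {n. C * t powr \<alpha> + 1 \<le> \<bar>real_of_int n\<bar>} \<longrightarrow>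
    (\<Sum>n\<in>F. transition_prob V t n) \<le> D * t powr (- real m)"
    by (rule transition_prob_bigo)
  define Q where "Q = (C + 1) powr p + D + S"
  have Q: "0 < Q" using C D S0 by (simp add: Q_def add_pos_pos add_pos_nonneg)
  have "\<forall>\<^sub>F t in at_top. enn2ereal (moment V p t) \<le> ereal (Q * t powr (p * \<alpha>))"
    using D(2) eventually_ge_at_top[of 1]
  proof eventually_elim
    case (elim t)
    let ?q = "\<lambda>n. \<bar>real_of_int n\<bar> powr p * transition_prob V t n"
    have t: "1 \<le> t" by (rule elim)
    have ta: "1 \<le> t powr \<alpha>" using t \<alpha> by (simp add: ge_one_powr_ge_zero)
    \<comment> \<open>The bound is proved for finite sums of reals; in \<open>ennreal\<close> every
      series is summable, so it passes directly to the moment.\<close>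
    have fin: "(\<Sum>n\<in>F. ?q n) \<le> Q * t powr (p * \<alpha>)" if F: "finite F" for F
    proof -
      let ?R = "C * t powr \<alpha> + 1"
      let ?A = "{n\<in>F. \<bar>real_of_int n\<bar> < ?R}" and ?B = "{n\<in>F. ?R \<le> \<bar>real_of_int n\<bar> \<and> \<bar>real_of_int n\<bar> < t\<^sup>2}"
        and ?T = "{n\<in>F. ?R \<le> \<bar>real_of_int n\<bar> \<and> t\<^sup>2 \<le> \<bar>real_of_int n\<bar>}"
      have split: "(\<Sum>n\<in>F. ?q n) = (\<Sum>n\<in>?A. ?q n) + ((\<Sum>n\<in>?B. ?q n) + (\<Sum>n\<in>?T. ?q n))"
        by (subst sum.union_disjoint[symmetric], use F in \<open>auto\<close>)+ (auto intro!: sum.cong)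
      have "(\<Sum>n\<in>?A. ?q n) \<le> (\<Sum>n\<in>?A. ((C + 1) * t powr \<alpha>) powr p * transition_prob V t n)"
      proof (intro sum_mono mult_right_mono powr_mono2 transition_prob_nonneg)
        fix n assume "n \<in> ?A"
        then show "\<bar>real_of_int n\<bar> \<le> (C + 1) * t powr \<alpha>" using ta by (simp add: distrib_right)
      qed (use p in auto)
      also have "\<dots> = ((C + 1) * t powr \<alpha>) powr p * (\<Sum>n\<in>?A. transition_prob V t n)"
        by (simp add: sum_distrib_left)
      also have "\<dots> \<le> ((C + 1) * t powr \<alpha>) powr p * 1"
      proof (rule mult_left_mono)
        have "(\<Sum>n\<in>?A. transition_prob V t n) \<le> (norm (blinfun_apply (evolution V t) (delta 0)))\<^sup>2"
          unfolding transition_prob_eq by (rule sum_le_norm_ell2) (use F in simp)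
        then show "(\<Sum>n\<in>?A. transition_prob V t n) \<le> 1" by (simp add: norm_evolution)
      qed simp
      also have "\<dots> = (C + 1) powr p * t powr (p * \<alpha>)"
        using C by (simp add: powr_mult powr_powr mult.commute)
      finally have A: "(\<Sum>n\<in>?A. ?q n) \<le> (C + 1) powr p * t powr (p * \<alpha>)" .
      have "(\<Sum>n\<in>?B. ?q n) \<le> (\<Sum>n\<in>?B. (t\<^sup>2) powr p * transition_prob V t n)"
        by (intro sum_mono mult_right_mono powr_mono2 transition_prob_nonneg) (use p in auto)
      also have "\<dots> = (t\<^sup>2) powr p * (\<Sum>n\<in>?B. transition_prob V t n)"
        by (simp add: sum_distrib_left)
      also have "\<dots> \<le> (t\<^sup>2) powr p * (D * t powr (- real m))"
        by (intro mult_left_mono elim(1)[rule_format]) (use F in auto)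
      also have "(t\<^sup>2) powr p = t powr (2 * p)"
        using t by (simp add: powr_powr flip: powr_numeral)
      also have "t powr (2 * p) * (D * t powr (- real m)) = D * t powr (2 * p - real m)"
        by (simp add: powr_diff powr_minus field_simps)
      also have "\<dots> \<le> D * 1"
        using powr_mono[of "2 * p - real m" 0 t] t m D(1) by (intro mult_left_mono) auto
      finally have B: "(\<Sum>n\<in>?B. ?q n) \<le> D" by simp
      have T: "(\<Sum>n\<in>?T. ?q n) \<le> S"
        by (rule S) (use F t in auto)
      have "1 \<le> t powr (p * \<alpha>)" using t \<alpha> p by (simp add: ge_one_powr_ge_zero)
      then have "D + S \<le> (D + S) * t powr (p * \<alpha>)"
        using D(1) S0 mult_left_mono[of 1 "t powr (p * \<alpha>)" "D + S"] by simp
      with A B T show ?thesis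
        unfolding split Q_def by (simp add: distrib_right)
    qed
    have "moment V p t \<le> ennreal (Q * t powr (p * \<alpha>))"
      unfolding moment_def
    proof (rule infsum_le_finite_sums)
      show "(\<lambda>n. ennreal (?q n)) summable_on UNIV" by (rule nonneg_summable_on_complete) simp
      fix F :: "int set" assume "finite F"
      then show "(\<Sum>n\<in>F. ennreal (?q n)) \<le> ennreal (Q * t powr (p * \<alpha>))"
        using fin[of F] by (subst sum_ennreal) (auto intro: ennreal_leI simp: transition_prob_nonneg)
    qed
    then have "enn2ereal (moment V p t) \<le> enn2ereal (ennreal (Q * t powr (p * \<alpha>)))"
      by (simp add: less_eq_ennreal.rep_eq)
    then show ?case
      using Q by (simp add: enn2ereal_ennreal)
  qed
  with Q show thesis by (rule that)
qed

lemma beta_plus_le: "0 < p \<Longrightarrow> beta_plus V p \<le> ereal \<alpha>"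
proof -
  assume p: "0 < p"
  obtain D where "0 < D" "\<forall>\<^sub>F t in at_top. enn2ereal (moment V p t) \<le> ereal (D * t powr (p * \<alpha>))"
    by (rule moment_le[OF p])
  from Limsup_log_ratio_le[OF this(2,1) p] p show ?thesis
    by (simp add: beta_plus_def)
qed

end

theorem corollary1:
  fixes V :: "int \<Rightarrow> real" and K C \<alpha> :: real
  assumes "bounded (range V)"
    and "K \<ge> 4"
    and "spectrum (schroedinger V) \<subseteq> complex_of_real ` {- K + 1..K - 1}"
    and "C > 0"
    and "0 < \<alpha>" and "\<alpha> < 1"
    and "\<And>m::nat. m \<ge> 1 \<Longrightarrow>
      (\<lambda>t::real. integral {- K..K} (\<lambda>E.
         inverse (Max ((\<lambda>n. (matrix_norm (Phi V n (complex_of_real E + \<i> * complex_of_real (inverse t))))\<^sup>2)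
           ` {n::int. 1 \<le> n \<and> real_of_int n \<le> C * t powr \<alpha>}))))
      \<in> O[at_top](\<lambda>t. t powr (- real m))"
    and "\<And>m::nat. m \<ge> 1 \<Longrightarrow>
      (\<lambda>t::real. integral {- K..K} (\<lambda>E.
         inverse (Max ((\<lambda>n. (matrix_norm (Phi V n (complex_of_real E + \<i> * complex_of_real (inverse t))))\<^sup>2)
           ` {n::int. 1 \<le> - n \<and> real_of_int (- n) \<le> C * t powr \<alpha>}))))
      \<in> O[at_top](\<lambda>t. t powr (- real m))"
  shows "alpha_u_plus V \<le> ereal \<alpha> \<and> (\<forall>p>0. beta_plus V p \<le> ereal \<alpha>)"
proof -
  interpret superpolynomial_transfer V K C \<alpha>
    using assms by unfold_locales auto
  show ?thesis
    using alpha_u_plus_le beta_plus_le by blast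
qed

end
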